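(* For any central arrangement $\mathcal{A}$ of $n\ge 1$ hyperplanes in $V$, of rank $\ell$, $$[\mathfrak{X}(\mathcal{A})]=\chi^+(\mathcal{A},-h,k-h)\quad\text{in } A^\bullet(\mathbb{P}V\times\mathbb{P}^{n-1}).$$
   Context: Let $V$ be a complex vector space of finite dimension $m$ and let $\mathcal{A}=\{H_1,\dots,H_n\}$ be a central arrangement: a set of $n$ distinct linear hyperplanes $H_i=\ker f_i$ with $f_i\in V^*$ nonzero. Its rank is $\ell=\operatorname{codim}_V\bigcap_i H_i$. Let $L(\mathcal{A})$ be the lattice of all intersections of hyperplanes of $\mathcal{A}$ (including $V$, the empty intersection), ordered by reverse inclusion, with Möbius function $\mu$ and $\operatorname{rank}X=\operatorname{codim}_V X$. The characteristic polynomial is $\chi(\mathcal{A},t)=\sum_{X\in L(\mathcal{A})}\mu(V,X)t^{\ell-\operatorname{rank}X}$ (of degree $\ell$), and its homogenization is $\chi^+(\mathcal{A},s,t)=s^\ell\chi(\mathcal{A},t/s)\in\mathbb{Z}[s,t]$. Let $M=V\setminus\bigcup_i H_i$. Let $a_1,\dots,a_n$ be the coordinate functions on $\mathbb{C}^n$ and put $\omega_{\mathbf a}=\sum_{i=1}^n a_i\,\frac{df_i}{f_i}$; for $\lambda\in\mathbb{C}^n$ let $\omega_\lambda$ be the 1-form on $M$ obtained by setting $a_i=\lambda_i$. Let $\Sigma(\mathcal{A})=\{(x,\lambda)\in M\times\mathbb{C}^n : \omega_\lambda(x)=0\}$ and let $\overline{\Sigma}(\mathcal{A})$ be its Zariski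 closure in $V\times\mathbb{C}^n$. It is preserved by the scaling actions of $\mathbb{C}^*$ on $V$ and on $\mathbb{C}^n$, and $\mathfrak{X}(\mathcal{A})=\overline{\Sigma}(\mathcal{A})/(\mathbb{C}^*\times\mathbb{C}^* )\subseteq\mathbb{P}V\times\mathbb{P}^{n-1}$ is the associated biprojective (reduced) subvariety, i.e. the image of $\overline\Sigma(\mathcal{A})\cap((V\setminus 0)\times(\mathbb{C}^n\setminus0))$. It is either empty or irreducible of codimension $\ell$, and $[\mathfrak{X}(\mathcal{A})]$ denotes its class in the Chow ring (zero if it is empty). The Chow ring is $A^\bullet(\mathbb{P}V\times\mathbb{P}^{n-1})\cong\mathbb{Z}[h,k]/(h^m,k^n)$, where $h,k$ are the (pullbacks of the) hyperplane classes of $\mathbb{P}V$ and $\mathbb{P}^{n-1}$ respectively. *)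

theory Defs
  imports
    "HOL-Analysis.Analysis"
    "HOL-Computational_Algebra.Polynomial"
    "HOL-Library.Poly_Mapping"
    "HOL-Algebra.QuotRing"
    "HOL-Algebra.Free_Abelian_Groups"
begin

lemma frac_trans_aux:
  fixes a :: complex
  assumes "a * b' = a' * b" "a' * b'' = a'' * b'"
  shows "(a * b'' - a'' * b) * b' = 0"
proof -
  have "(a * b'' - a'' * b) * b' = (a * b') * b'' - (a'' * b') * b" by (simp add: algebra_simps)
  also have "\<dots> = 0" by (simp add: assms(1) assms(2)[symmetric])
  finally show ?thesis .
qed

lemma frac_cong_aux:
  fixes a :: complex
  assumes "a * b' = a' * b" "c * d' = c' * d"
  shows "(a * c) * (b' * d') = (a' * c') * (b * d)"
    and "(a * d + c * b) * (b' * d') = (a' * d' + c' * b') * (b * d)"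
proof -
  have "(a * c) * (b' * d') = (a * b') * (c * d')" by simp
  then show "(a * c) * (b' * d') = (a' * c') * (b * d)" by (simp add: assms)
  have "(a * d + c * b) * (b' * d') = (a * b') * (d * d') + (c * d') * (b * b')"
    by (simp add: algebra_simps)
  then show "(a * d + c * b) * (b' * d') = (a' * d' + c' * b') * (b * d)"
    by (simp add: assms algebra_simps)
qed


section \<open>The Chow group of a product of two projective spaces\<close>

text \<open>
  Throughout, \<open>V\<close> and \<open>W\<close> are complex vector spaces (of finite dimension in all uses) carried by
  the types \<open>'v\<close> and \<open>'w\<close>. Since the base field is infinite, polynomials on \<open>V \<times> W\<close> are
  identified with polynomial functions.
\<close>

locale biprojective =
  V: vector_space scaleV + W: vector_space scaleW
  for scaleV :: "complex \<Rightarrow> 'v::ab_group_add \<Rightarrow> 'v"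
    and scaleW :: "complex \<Rightarrow> 'w::ab_group_add \<Rightarrow> 'w"
begin

inductive_set poly_funs :: "('v \<times> 'w \<Rightarrow> complex) set" where
  const: "(\<lambda>_. c) \<in> poly_funs"
| fst: "Vector_Spaces.linear scaleV (*) \<phi> \<Longrightarrow> (\<lambda>z. \<phi> (fst z)) \<in> poly_funs"
| snd: "Vector_Spaces.linear scaleW (*) \<psi> \<Longrightarrow> (\<lambda>z. \<psi> (snd z)) \<in> poly_funs"
| add: "F \<in> poly_funs \<Longrightarrow> G \<in> poly_funs \<Longrightarrow> (\<lambda>z. F z + G z) \<in> poly_funs"
| mult: "F \<in> poly_funs \<Longrightarrow> G \<in> poly_funs \<Longrightarrow> (\<lambda>z. F z * G z) \<in> poly_funs"

definition zariski_closure :: "('v \<times> 'w) set \<Rightarrow> ('v \<times> 'w) set" where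
  "zariski_closure S = {z. \<forall>F\<in>poly_funs. (\<forall>w\<in>S. F w = 0) \<longrightarrow> F z = 0}"

text \<open>The zero function is bihomogeneous of every bidegree.\<close>

definition bihom :: "nat \<Rightarrow> nat \<Rightarrow> ('v \<times> 'w \<Rightarrow> complex) \<Rightarrow> bool" where
  "bihom a b F \<longleftrightarrow> F \<in> poly_funs \<and>
     (\<forall>c d x y. F (scaleV c x, scaleW d y) = c ^ a * d ^ b * F (x, y))"

text \<open>Points of \<open>\<P>V\<close> and \<open>\<P>W\<close> are lines through the origin.\<close>

definition pt :: "'v \<Rightarrow> 'w \<Rightarrow> 'v set \<times> 'w set" where
  "pt x y = (V.span {x}, W.span {y})"

definition proj_image :: "('v \<times> 'w) set \<Rightarrow> ('v set \<times> 'w set) set" where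
  "proj_image S = {pt x y | x y. x \<noteq> 0 \<and> y \<noteq> 0 \<and> (x, y) \<in> S}"

definition vanishes_on :: "('v \<times> 'w \<Rightarrow> complex) \<Rightarrow> ('v set \<times> 'w set) set \<Rightarrow> bool" where
  "vanishes_on F Z \<longleftrightarrow> (\<forall>x y. x \<noteq> 0 \<longrightarrow> y \<noteq> 0 \<longrightarrow> pt x y \<in> Z \<longrightarrow> F (x, y) = 0)"

definition closed_set :: "('v set \<times> 'w set) set \<Rightarrow> bool" where
  "closed_set Z \<longleftrightarrow> (\<exists>\<F>. (\<forall>F\<in>\<F>. \<exists>a b. bihom a b F) \<and> Z = proj_image {z. \<forall>F\<in>\<F>. F z = 0})"

text \<open>Subvarieties are irreducible (and closed, nonempty).\<close>

definition subvariety :: "('v set \<times> 'w set) set \<Rightarrow> bool" where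
  "subvariety Z \<longleftrightarrow> closed_set Z \<and> Z \<noteq> {} \<and>
     (\<forall>A B. closed_set A \<longrightarrow> closed_set B \<longrightarrow> Z \<subseteq> A \<union> B \<longrightarrow> Z \<subseteq> A \<or> Z \<subseteq> B)"

definition codim_one :: "('v set \<times> 'w set) set \<Rightarrow> ('v set \<times> 'w set) set \<Rightarrow> bool" where
  "codim_one D Z \<longleftrightarrow> subvariety D \<and> subvariety Z \<and> D \<subset> Z \<and>
     \<not> (\<exists>Y. subvariety Y \<and> D \<subset> Y \<and> Y \<subset> Z)"


subsection \<open>The local ring of a subvariety \<open>Z\<close> along \<open>D \<subseteq> Z\<close>\<close>

text \<open>
  Its elements are rational functions on \<open>Z\<close> that are regular at the generic point of \<open>D\<close>: fractions
  \<open>F/G\<close> of bihomogeneous polynomials of equal bidegree with \<open>G\<close> not vanishing identically on \<open>D\<close>,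
  modulo equality on \<open>Z\<close>.
\<close>

definition fracs :: "('v set \<times> 'w set) set \<Rightarrow> (('v \<times> 'w \<Rightarrow> complex) \<times> ('v \<times> 'w \<Rightarrow> complex)) set" where
  "fracs D = {(F, G). (\<exists>a b. bihom a b F \<and> bihom a b G) \<and> \<not> vanishes_on G D}"

definition frac_rel :: "('v set \<times> 'w set) set \<Rightarrow> ('v set \<times> 'w set) set \<Rightarrow>
    ((('v \<times> 'w \<Rightarrow> complex) \<times> ('v \<times> 'w \<Rightarrow> complex)) \<times>
     (('v \<times> 'w \<Rightarrow> complex) \<times> ('v \<times> 'w \<Rightarrow> complex))) set" where
  "frac_rel Z D = {((F, G), (F', G')). (F, G) \<in> fracs D \<and> (F', G') \<in> fracs D \<and>
     vanishes_on (\<lambda>z. F z * G' z - F' z * G z) Z}"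

definition frac_class :: "('v set \<times> 'w set) set \<Rightarrow> ('v set \<times> 'w set) set \<Rightarrow>
    ('v \<times> 'w \<Rightarrow> complex) \<times> ('v \<times> 'w \<Rightarrow> complex) \<Rightarrow>
    (('v \<times> 'w \<Rightarrow> complex) \<times> ('v \<times> 'w \<Rightarrow> complex)) set" where
  "frac_class Z D r = frac_rel Z D `` {r}"

definition frac_mult :: "('v \<times> 'w \<Rightarrow> complex) \<times> ('v \<times> 'w \<Rightarrow> complex) \<Rightarrow>
    ('v \<times> 'w \<Rightarrow> complex) \<times> ('v \<times> 'w \<Rightarrow> complex) \<Rightarrow>
    ('v \<times> 'w \<Rightarrow> complex) \<times> ('v \<times> 'w \<Rightarrow> complex)" where
  "frac_mult r s = ((\<lambda>z. fst r z * fst s z), (\<lambda>z. snd r z * snd s z))"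

definition frac_add :: "('v \<times> 'w \<Rightarrow> complex) \<times> ('v \<times> 'w \<Rightarrow> complex) \<Rightarrow>
    ('v \<times> 'w \<Rightarrow> complex) \<times> ('v \<times> 'w \<Rightarrow> complex) \<Rightarrow>
    ('v \<times> 'w \<Rightarrow> complex) \<times> ('v \<times> 'w \<Rightarrow> complex)" where
  "frac_add r s = ((\<lambda>z. fst r z * snd s z + fst s z * snd r z), (\<lambda>z. snd r z * snd s z))"

definition local_ring :: "('v set \<times> 'w set) set \<Rightarrow> ('v set \<times> 'w set) set \<Rightarrow>
    (('v \<times> 'w \<Rightarrow> complex) \<times> ('v \<times> 'w \<Rightarrow> complex)) set ring" where
  "local_ring Z D =
    \<lparr>carrier = fracs D // frac_rel Z D,
     monoid.mult = (\<lambda>A B. \<Union>r\<in>A. \<Union>s\<in>B. frac_class Z D (frac_mult r s)),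
     monoid.one = frac_class Z D ((\<lambda>_. 1), (\<lambda>_. 1)),
     ring.zero = frac_class Z D ((\<lambda>_. 0), (\<lambda>_. 1)),
     ring.add = (\<lambda>A B. \<Union>r\<in>A. \<Union>s\<in>B. frac_class Z D (frac_add r s))\<rparr>"

text \<open>
  The construction is sound: for subvarieties \<open>D \<subseteq> Z\<close> this is a commutative ring. In particular the
  ideals used below, whose library definition includes the ring axioms, are available.
\<close>

lemma bihom_mult:
  assumes "bihom a b F" "bihom c d G" shows "bihom (a + c) (b + d) (\<lambda>z. F z * G z)"
  using assms by (auto simp: bihom_def power_add intro: poly_funs.mult)

lemma bihom_add:
  assumes "bihom a b F" "bihom a b G" shows "bihom a b (\<lambda>z. F z + G z)"
  using assms by (auto simp: bihom_def distrib_left intro: poly_funs.add)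

lemma bihom_minus:
  assumes "bihom a b F" shows "bihom a b (\<lambda>z. - F z)"
  using assms poly_funs.mult[OF poly_funs.const[of "-1"], of F] by (auto simp: bihom_def)

lemma bihom_diff:
  assumes "bihom a b F" "bihom a b G" shows "bihom a b (\<lambda>z. F z - G z)"
  using bihom_add[OF assms(1) bihom_minus[OF assms(2)]] by simp

lemma bihom_const: "bihom 0 0 (\<lambda>_. c)"
  by (auto simp: bihom_def intro: poly_funs.const)

lemma bihom_pt:
  assumes F: "bihom a b F" and "pt x y = pt x' y'" and "F (x', y') = 0"
  shows "F (x, y) = 0"
proof -
  have "x \<in> V.span {x'}" "y \<in> W.span {y'}"
    using assms(2) V.span_base[of x "{x}"] W.span_base[of y "{y}"] by (auto simp: pt_def)
  then obtain c d where "x = scaleV c x'" "y = scaleW d y'"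
    by (auto simp: V.span_singleton W.span_singleton)
  then show ?thesis using F assms(3) by (simp add: bihom_def)
qed

lemma closed_zeros: "bihom a b F \<Longrightarrow> closed_set (proj_image {z. F z = 0})"
  unfolding closed_set_def by (rule exI[of _ "{F}"]) auto

lemma vanishes_on_prod:
  assumes Z: "subvariety Z" and F: "bihom a b F" and G: "bihom c d G"
    and FG: "vanishes_on (\<lambda>z. F z * G z) Z"
  shows "vanishes_on F Z \<or> vanishes_on G Z"
proof -
  have "Z \<subseteq> proj_image {z. F z = 0} \<union> proj_image {z. G z = 0}"
  proof
    fix p assume p: "p \<in> Z"
    with Z obtain x y where "p = pt x y" "x \<noteq> 0" "y \<noteq> 0"
      unfolding subvariety_def closed_set_def proj_image_def by auto
    with p FG show "p \<in> proj_image {z. F z = 0} \<union> proj_image {z. G z = 0}"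
      unfolding vanishes_on_def proj_image_def by force
  qed
  then have "Z \<subseteq> proj_image {z. F z = 0} \<or> Z \<subseteq> proj_image {z. G z = 0}"
    using Z closed_zeros[OF F] closed_zeros[OF G] unfolding subvariety_def by blast
  moreover have "vanishes_on H Z" if "bihom i j H" "Z \<subseteq> proj_image {z. H z = 0}" for i j H
    using that bihom_pt[OF that(1)] unfolding vanishes_on_def proj_image_def by blast
  ultimately show ?thesis using F G by blast
qed

context
  fixes Z D
  assumes Z: "subvariety Z" and D: "subvariety D" and DZ: "D \<subseteq> Z"
begin

lemma fracs_mult:
  assumes "r \<in> fracs D" "s \<in> fracs D" shows "frac_mult r s \<in> fracs D"
proof -
  obtain F G F' G' a b c d where rs: "r = (F, G)" "s = (F', G')"
    and h: "bihom a b F" "bihom a b G" "bihom c d F'" "bihom c d G'"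
      "\<not> vanishes_on G D" "\<not> vanishes_on G' D"
    using assms unfolding fracs_def by auto
  have "\<not> vanishes_on (\<lambda>z. G z * G' z) D"
    using vanishes_on_prod[OF D h(2,4)] h(5,6) by blast
  with bihom_mult[OF h(1,3)] bihom_mult[OF h(2,4)] show ?thesis
    unfolding rs fracs_def frac_mult_def by auto
qed

lemma fracs_add:
  assumes "r \<in> fracs D" "s \<in> fracs D" shows "frac_add r s \<in> fracs D"
proof -
  obtain F G F' G' a b c d where rs: "r = (F, G)" "s = (F', G')"
    and h: "bihom a b F" "bihom a b G" "bihom c d F'" "bihom c d G'"
      "\<not> vanishes_on G D" "\<not> vanishes_on G' D"
    using assms unfolding fracs_def by auto
  have "bihom (a + c) (b + d) (\<lambda>z. F z * G' z + F' z * G z)"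
    using bihom_add[OF bihom_mult[OF h(1,4)]] bihom_mult[OF h(3,2)] by (simp add: ac_simps)
  moreover have "\<not> vanishes_on (\<lambda>z. G z * G' z) D"
    using vanishes_on_prod[OF D h(2,4)] h(5,6) by blast
  ultimately show ?thesis
    using bihom_mult[OF h(2,4)] unfolding rs fracs_def frac_add_def by auto
qed

lemma equiv_frac_rel: "equiv (fracs D) (frac_rel Z D)"
proof (rule equivI)
  show "frac_rel Z D \<subseteq> fracs D \<times> fracs D" by (auto simp: frac_rel_def)
  show "refl_on (fracs D) (frac_rel Z D)"
    by (auto simp: refl_on_def frac_rel_def vanishes_on_def)
  show "sym (frac_rel Z D)"
    by (auto simp: sym_def frac_rel_def vanishes_on_def)
  show "trans (frac_rel Z D)"
  proof (rule transI)
    fix r s t assume "(r, s) \<in> frac_rel Z D" "(s, t) \<in> frac_rel Z D"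
    then obtain F G F' G' F'' G'' where e: "r = (F, G)" "s = (F', G')" "t = (F'', G'')"
      and m: "(F, G) \<in> fracs D" "(F', G') \<in> fracs D" "(F'', G'') \<in> fracs D"
      and v: "vanishes_on (\<lambda>z. F z * G' z - F' z * G z) Z"
        "vanishes_on (\<lambda>z. F' z * G'' z - F'' z * G' z) Z"
      by (auto simp: frac_rel_def)
    have "vanishes_on (\<lambda>z. (F z * G'' z - F'' z * G z) * G' z) Z"
      unfolding vanishes_on_def
    proof (intro allI impI)
      fix x y assume "x \<noteq> 0" "y \<noteq> 0" "pt x y \<in> Z"
      with v have "F (x,y) * G' (x,y) = F' (x,y) * G (x,y)" "F' (x,y) * G'' (x,y) = F'' (x,y) * G' (x,y)"
        by (auto simp: vanishes_on_def)
      then show "(F (x,y) * G'' (x,y) - F'' (x,y) * G (x,y)) * G' (x,y) = 0"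
        by (rule frac_trans_aux)
    qed
    moreover from m obtain a b c d a' b' where h: "bihom a b F" "bihom a b G" "bihom c d F''" "bihom c d G''" "bihom a' b' G'"
      unfolding fracs_def by blast
    moreover have "bihom (a + c) (b + d) (\<lambda>z. F z * G'' z - F'' z * G z)"
      using bihom_diff[OF bihom_mult[OF h(1,4)]] bihom_mult[OF h(3,2)] by (simp add: ac_simps)
    moreover have "\<not> vanishes_on G' Z"
      using m DZ by (auto simp: fracs_def vanishes_on_def)
    ultimately have "vanishes_on (\<lambda>z. F z * G'' z - F'' z * G z) Z"
      using vanishes_on_prod[OF Z] by blast
    then show "(r, t) \<in> frac_rel Z D" using e m by (auto simp: frac_rel_def)
  qed
qed

lemma frac_rel_iff:
  "(r, s) \<in> frac_rel Z D \<longleftrightarrow> r \<in> fracs D \<and> s \<in> fracs D \<and>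
     (\<forall>x y. x \<noteq> 0 \<longrightarrow> y \<noteq> 0 \<longrightarrow> pt x y \<in> Z \<longrightarrow> fst r (x,y) * snd s (x,y) = fst s (x,y) * snd r (x,y))"
  by (cases r; cases s) (auto simp: frac_rel_def vanishes_on_def)

lemma mult_respects:
  "(\<lambda>r s. frac_class Z D (frac_mult r s)) respects2 frac_rel Z D"
proof (rule congruent2I')
  fix r r' s s' assume a: "(r, r') \<in> frac_rel Z D" "(s, s') \<in> frac_rel Z D"
  have "(frac_mult r s, frac_mult r' s') \<in> frac_rel Z D"
    unfolding frac_rel_iff
  proof (intro conjI allI impI)
    fix x y assume "x \<noteq> 0" "y \<noteq> 0" "pt x y \<in> Z"
    with a have "fst r (x,y) * snd r' (x,y) = fst r' (x,y) * snd r (x,y)"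
      "fst s (x,y) * snd s' (x,y) = fst s' (x,y) * snd s (x,y)" by (auto simp: frac_rel_iff)
    then show "fst (frac_mult r s) (x,y) * snd (frac_mult r' s') (x,y) =
        fst (frac_mult r' s') (x,y) * snd (frac_mult r s) (x,y)"
      unfolding frac_mult_def fst_conv snd_conv by (rule frac_cong_aux)
  qed (use a fracs_mult in \<open>auto simp: frac_rel_iff\<close>)
  then show "frac_class Z D (frac_mult r s) = frac_class Z D (frac_mult r' s')"
    unfolding frac_class_def by (rule equiv_class_eq[OF equiv_frac_rel])
qed

lemma add_respects:
  "(\<lambda>r s. frac_class Z D (frac_add r s)) respects2 frac_rel Z D"
proof (rule congruent2I')
  fix r r' s s' assume a: "(r, r') \<in> frac_rel Z D" "(s, s') \<in> frac_rel Z D"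
  have "(frac_add r s, frac_add r' s') \<in> frac_rel Z D"
    unfolding frac_rel_iff
  proof (intro conjI allI impI)
    fix x y assume "x \<noteq> 0" "y \<noteq> 0" "pt x y \<in> Z"
    with a have "fst r (x,y) * snd r' (x,y) = fst r' (x,y) * snd r (x,y)"
      "fst s (x,y) * snd s' (x,y) = fst s' (x,y) * snd s (x,y)" by (auto simp: frac_rel_iff)
    then show "fst (frac_add r s) (x,y) * snd (frac_add r' s') (x,y) = fst (frac_add r' s') (x,y) * snd (frac_add r s) (x,y)"
      unfolding frac_add_def fst_conv snd_conv by (rule frac_cong_aux)
  qed (use a fracs_add in \<open>auto simp: frac_rel_iff\<close>)
  then show "frac_class Z D (frac_add r s) = frac_class Z D (frac_add r' s')"
    unfolding frac_class_def by (rule equiv_class_eq[OF equiv_frac_rel])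
qed

lemma local_ring_mult_class:
  "r \<in> fracs D \<Longrightarrow> s \<in> fracs D \<Longrightarrow>
    frac_class Z D r \<otimes>\<^bsub>local_ring Z D\<^esub> frac_class Z D s = frac_class Z D (frac_mult r s)"
  using UN_equiv_class2[OF equiv_frac_rel equiv_frac_rel mult_respects]
  by (simp add: local_ring_def frac_class_def[of Z D r] frac_class_def[of Z D s])

lemma local_ring_add_class:
  "r \<in> fracs D \<Longrightarrow> s \<in> fracs D \<Longrightarrow>
    frac_class Z D r \<oplus>\<^bsub>local_ring Z D\<^esub> frac_class Z D s = frac_class Z D (frac_add r s)"
  using UN_equiv_class2[OF equiv_frac_rel equiv_frac_rel add_respects]
  by (simp add: local_ring_def frac_class_def[of Z D r] frac_class_def[of Z D s])

lemma carrier_local_ring: "carrier (local_ring Z D) = frac_class Z D ` fracs D"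
  by (auto simp: local_ring_def quotient_def frac_class_def)

lemma frac_class_eqI:
  "r \<in> fracs D \<Longrightarrow> s \<in> fracs D \<Longrightarrow> (\<And>z. fst r z * snd s z = fst s z * snd r z) \<Longrightarrow>
    frac_class Z D r = frac_class Z D s"
  unfolding frac_class_def by (rule equiv_class_eq[OF equiv_frac_rel]) (auto simp: frac_rel_iff)

lemma one_not_vanishes: "\<not> vanishes_on (\<lambda>_. 1) D"
proof -
  obtain p where p: "p \<in> D" using D unfolding subvariety_def by blast
  moreover obtain S where "D = proj_image S" using D unfolding subvariety_def closed_set_def by blast
  ultimately obtain x y where "x \<noteq> 0" "y \<noteq> 0" "pt x y \<in> D" unfolding proj_image_def by auto
  then show ?thesis unfolding vanishes_on_def by auto
qed

lemma one_frac: "((\<lambda>_. c), (\<lambda>_. 1)) \<in> fracs D"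
  using one_not_vanishes bihom_const by (auto simp: fracs_def)

lemma uminus_frac: "(F, G) \<in> fracs D \<Longrightarrow> ((\<lambda>z. - F z), G) \<in> fracs D"
  using bihom_minus by (fastforce simp: fracs_def)

lemma cring_local_ring: "cring (local_ring Z D)" (is "cring ?R")
proof -
  note cl = local_ring_mult_class local_ring_add_class fracs_mult fracs_add one_frac
  have one: "\<one>\<^bsub>?R\<^esub> = frac_class Z D ((\<lambda>_. 1), (\<lambda>_. 1))" and zero: "\<zero>\<^bsub>?R\<^esub> = frac_class Z D ((\<lambda>_. 0), (\<lambda>_. 1))"
    by (simp_all add: local_ring_def)
  have eq: "frac_class Z D r = frac_class Z D s" if "r \<in> fracs D" "s \<in> fracs D" "\<forall>z. fst r z * snd s z = fst s z * snd r z" for r s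
    using frac_class_eqI that by blast
  show ?thesis
  proof (rule cringI)
    show "abelian_group ?R"
    proof (rule abelian_groupI)
      fix x assume "x \<in> carrier ?R"
      then obtain F G where x: "x = frac_class Z D (F, G)" "(F, G) \<in> fracs D"
        by (auto simp: carrier_local_ring)
      note u = uminus_frac[OF x(2)]
      have "frac_class Z D ((\<lambda>z. - F z), G) \<oplus>\<^bsub>?R\<^esub> x = \<zero>\<^bsub>?R\<^esub>"
        unfolding x(1) zero cl(2)[OF u x(2)]
        by (intro eq fracs_add u x one_frac) (simp add: frac_add_def)
      with u show "\<exists>y\<in>carrier ?R. y \<oplus>\<^bsub>?R\<^esub> x = \<zero>\<^bsub>?R\<^esub>" by (auto simp: carrier_local_ring)
    qed (auto simp: carrier_local_ring one zero cl intro!: eq, auto simp: frac_add_def algebra_simps)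
    show "comm_monoid ?R"
      by (rule comm_monoidI) (auto simp: carrier_local_ring one zero cl intro!: eq, auto simp: frac_mult_def algebra_simps)
    fix x y z assume "x \<in> carrier ?R" "y \<in> carrier ?R" "z \<in> carrier ?R"
    then obtain r s t where m: "r \<in> fracs D" "s \<in> fracs D" "t \<in> fracs D"
      and e: "x = frac_class Z D r" "y = frac_class Z D s" "z = frac_class Z D t"
      unfolding carrier_local_ring by blast
    have "frac_class Z D (frac_mult (frac_add r s) t) =
        frac_class Z D (frac_add (frac_mult r t) (frac_mult s t))"
      by (intro eq fracs_mult fracs_add m) (simp add: frac_mult_def frac_add_def algebra_simps)
    then show "(x \<oplus>\<^bsub>?R\<^esub> y) \<otimes>\<^bsub>?R\<^esub> z = x \<otimes>\<^bsub>?R\<^esub> z \<oplus>\<^bsub>?R\<^esub> y \<otimes>\<^bsub>?R\<^esub> z"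
      using m by (simp add: e cl)
  qed
qed

end

end

text \<open>
  Length of a ring as a module over itself. For a quotient \<open>A/I\<close> this is also its length as an
  \<open>A\<close>-module. It is used for rings of finite length only, where the supremum is a maximum.
\<close>

definition ring_length :: "('a, 'b) ring_scheme \<Rightarrow> nat" where
  "ring_length R = Sup {n. \<exists>J :: nat \<Rightarrow> 'a set. (\<forall>i\<le>n. ideal (J i) R) \<and> (\<forall>i<n. J i \<subset> J (Suc i))}"

text \<open>The cycle of a reduced closed subset that is empty or irreducible.\<close>

definition fundamental_cycle :: "'p set \<Rightarrow> 'p set \<Rightarrow>\<^sub>0 int" where
  "fundamental_cycle Z = (if Z = {} then 0 else frag_of Z)"

context biprojective
begin

subsection \<open>Divisors and rational equivalence\<close>

text \<open>
  Order of vanishing along \<open>D\<close> of a bihomogeneous \<open>F\<close> on \<open>Z\<close>, where \<open>D\<close> has codimension one in \<open>Z\<close>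
  and \<open>F\<close> does not vanish identically on \<open>Z\<close>: the length of \<open>O/(F/G)\<close>, where \<open>O\<close> is the
  local ring and \<open>G\<close> has the bidegree of \<open>F\<close> and does not vanish identically on \<open>D\<close>. Different choices
  of \<open>G\<close> change the local equation \<open>F/G\<close> by a unit; all of them are put into the generating set.
\<close>

definition ord_along ::
    "('v set \<times> 'w set) set \<Rightarrow> ('v set \<times> 'w set) set \<Rightarrow> ('v \<times> 'w \<Rightarrow> complex) \<Rightarrow> nat" where
  "ord_along Z D F = (let R = local_ring Z D in
     ring_length (R Quot (Idl\<^bsub>R\<^esub> {frac_class Z D (F, G) | G. (F, G) \<in> fracs D})))"

text \<open>The Weil divisor on \<open>Z\<close> of the section \<open>F\<close> of \<open>O(a,b)\<close>.\<close>

definition div_form ::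
    "('v set \<times> 'w set) set \<Rightarrow> ('v \<times> 'w \<Rightarrow> complex) \<Rightarrow> ('v set \<times> 'w set) set \<Rightarrow>\<^sub>0 int" where
  "div_form Z F = (\<Sum>D\<in>{D. codim_one D Z \<and> ord_along Z D F \<noteq> 0}.
     frag_cmul (int (ord_along Z D F)) (frag_of D))"

definition cycle_group :: "(('v set \<times> 'w set) set \<Rightarrow>\<^sub>0 int) monoid" where
  "cycle_group = free_Abelian_group {Z. subvariety Z}"

text \<open>
  Cycles rationally equivalent to zero: generated by the divisors of the rational functions \<open>F/G\<close>,
  \<open>div (F/G) = div F - div G\<close>, on arbitrary subvarieties \<open>Z\<close>.
\<close>

definition rat_equiv_zero :: "(('v set \<times> 'w set) set \<Rightarrow>\<^sub>0 int) set" where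
  "rat_equiv_zero = generate cycle_group
     {div_form Z F - div_form Z G | Z F G a b. subvariety Z \<and> bihom a b F \<and> bihom a b G \<and>
        \<not> vanishes_on F Z \<and> \<not> vanishes_on G Z}"

text \<open>The additive group underlying the Chow ring, and the class of a cycle in it.\<close>

definition chow_group :: "(('v set \<times> 'w set) set \<Rightarrow>\<^sub>0 int) set monoid" where
  "chow_group = cycle_group Mod rat_equiv_zero"

definition chow_class ::
    "(('v set \<times> 'w set) set \<Rightarrow>\<^sub>0 int) \<Rightarrow> (('v set \<times> 'w set) set \<Rightarrow>\<^sub>0 int) set" where
  "chow_class c = rat_equiv_zero #>\<^bsub>cycle_group\<^esub> c"

lemma div_form_cycle: "div_form Z F \<in> carrier cycle_group"
proof -
  have "frag_cmul (int (ord_along Z D F)) (frag_of D) \<in> carrier cycle_group"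
    if "codim_one D Z" for D
  proof -
    have "Poly_Mapping.keys (frag_cmul (int (ord_along Z D F)) (frag_of D)) \<subseteq> {D}"
      using keys_cmul[of _ "frag_of D"] by simp
    then show ?thesis
      using that by (force simp: cycle_group_def codim_one_def)
  qed
  then show ?thesis
    unfolding div_form_def cycle_group_def by (intro sum_closed_free_Abelian_group) simp
qed

lemma rat_equiv_zero_normal: "rat_equiv_zero \<lhd> cycle_group"
proof -
  have G: "comm_group cycle_group"
    unfolding cycle_group_def by (rule abelian_free_Abelian_group)
  have "div_form Z F - div_form Z G \<in> carrier cycle_group" for Z F G
    using div_form_cycle[of Z F] div_form_cycle[of Z G] keys_diff[of "div_form Z F" "div_form Z G"]
    unfolding cycle_group_def carrier_free_Abelian_group_iff by (meson Un_least order_trans)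
  then have "subgroup rat_equiv_zero cycle_group"
    unfolding rat_equiv_zero_def
    by (intro group.generate_is_subgroup comm_group.axioms(2)[OF G]) auto
  then show ?thesis by (rule comm_group.subgroup_imp_normal[OF G])
qed

lemma chow_class_in_chow_group: "c \<in> carrier cycle_group \<Longrightarrow> chow_class c \<in> carrier chow_group"
  by (auto simp: chow_group_def chow_class_def FactGroup_def RCOSETS_def)


subsection \<open>Polynomials in the hyperplane classes\<close>

text \<open>
  In the Chow ring, multiplication by the class of a divisor \<open>E\<close> is the first Chern class of \<open>O(E)\<close>:
  it sends the class of a subvariety \<open>Z\<close> to that of the divisor on \<open>Z\<close> of any section of
  \<open>O(E)\<close> not vanishing identically on \<open>Z\<close>. For the two hyperplane classes, \<open>O(E)\<close> is \<open>O(1,0)\<close>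
  and \<open>O(0,1)\<close>; its sections are the linear forms on \<open>V\<close> and on \<open>W\<close>, respectively. The class
  does not depend on the section chosen below.
\<close>

definition chern_cap :: "nat \<Rightarrow> nat \<Rightarrow> (('v set \<times> 'w set) set \<Rightarrow>\<^sub>0 int) \<Rightarrow>
    (('v set \<times> 'w set) set \<Rightarrow>\<^sub>0 int)" where
  "chern_cap a b = frag_extend
     (\<lambda>Z. div_form Z (SOME F. bihom a b F \<and> \<not> vanishes_on F Z))"

text \<open>The unit of the Chow ring is the class of the whole space \<open>\<P>V \<times> \<P>W\<close>.\<close>

definition hyperplane_monomial :: "nat \<Rightarrow> nat \<Rightarrow> ('v set \<times> 'w set) set \<Rightarrow>\<^sub>0 int" where
  "hyperplane_monomial i j =
     (chern_cap 1 0 ^^ i) ((chern_cap 0 1 ^^ j) (fundamental_cycle (proj_image UNIV)))"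

text \<open>
  Elements of \<open>\<int>[h,k]\<close> are represented as polynomials in \<open>k\<close> with coefficients in \<open>\<int>[h]\<close>. The map
  \<open>hk_class\<close> induces the isomorphism from \<open>\<int>[h,k]/(h\<^sup>m,k\<^sup>n)\<close> to the Chow ring.
\<close>

definition hk_class :: "int poly poly \<Rightarrow> (('v set \<times> 'w set) set \<Rightarrow>\<^sub>0 int) set" where
  "hk_class P = chow_class (\<Sum>j\<le>degree P. \<Sum>i\<le>degree (coeff P j).
     frag_cmul (coeff (coeff P j) i) (hyperplane_monomial i j))"

end

abbreviation h_var :: "int poly poly" where "h_var \<equiv> [:[:0, 1:]:]"
abbreviation k_var :: "int poly poly" where "k_var \<equiv> [:0, 1:]"


section \<open>Central arrangements\<close>

text \<open>
  Moebius function of a finite family of sets ordered by reverse inclusion, with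
  \<open>X\<close> above \<open>Y\<close> if \<open>X \<subseteq> Y\<close>.
\<close>

function moebius :: "'a set set \<Rightarrow> 'a set \<Rightarrow> 'a set \<Rightarrow> int" where
  "moebius L Y X =
     (if finite L \<and> X \<in> L \<and> Y \<in> L \<and> X \<subseteq> Y then
        (if X = Y then 1 else - (\<Sum>Z\<in>{Z \<in> L. X \<subset> Z \<and> Z \<subseteq> Y}. moebius L Y Z))
      else 0)"
  by auto
termination
proof (relation "Wellfounded.measure (\<lambda>(L, Y, X). card {Z \<in> L. X \<subset> Z})", goal_cases)
  case (2 L Y X Z)
  then have "{Z' \<in> L. Z \<subset> Z'} \<subset> {Z \<in> L. X \<subset> Z}" by auto
  then show ?case using 2 by (auto intro: psubset_card_mono)
qed simp

declare moebius.simps [simp del]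

definition hyperplane :: "('v \<Rightarrow> complex) \<Rightarrow> 'v set" where
  "hyperplane \<phi> = {x. \<phi> x = 0}"

text \<open>The choice \<open>I = {}\<close> contributes the whole space.\<close>

definition intersection_lattice :: "('n \<Rightarrow> 'v \<Rightarrow> complex) \<Rightarrow> 'v set set" where
  "intersection_lattice f = {\<Inter>i\<in>I. hyperplane (f i) | I. True}"

definition flat_rank :: "(complex \<Rightarrow> 'v::ab_group_add \<Rightarrow> 'v) \<Rightarrow> 'v set \<Rightarrow> nat" where
  "flat_rank scaleV X = vector_space.dim scaleV UNIV - vector_space.dim scaleV X"

definition arr_rank :: "(complex \<Rightarrow> 'v::ab_group_add \<Rightarrow> 'v) \<Rightarrow> ('n \<Rightarrow> 'v \<Rightarrow> complex) \<Rightarrow> nat" where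
  "arr_rank scaleV f = flat_rank scaleV (\<Inter>i. hyperplane (f i))"

definition char_poly ::
    "(complex \<Rightarrow> 'v::ab_group_add \<Rightarrow> 'v) \<Rightarrow> ('n \<Rightarrow> 'v \<Rightarrow> complex) \<Rightarrow> int poly" where
  "char_poly scaleV f = (\<Sum>X\<in>intersection_lattice f.
     monom (moebius (intersection_lattice f) UNIV X) (arr_rank scaleV f - flat_rank scaleV X))"

text \<open>The value of the homogenization \<open>s\<^sup>l \<chi>(t/s)\<close>, \<open>l\<close> the rank, at elements \<open>s\<close>, \<open>t\<close> of a ring.\<close>

definition char_poly_hom ::
    "(complex \<Rightarrow> 'v::ab_group_add \<Rightarrow> 'v) \<Rightarrow> ('n \<Rightarrow> 'v \<Rightarrow> complex) \<Rightarrow> 'r::comm_ring_1 \<Rightarrow> 'r \<Rightarrow> 'r" where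
  "char_poly_hom scaleV f s t = (\<Sum>d\<le>arr_rank scaleV f.
     of_int (coeff (char_poly scaleV f) d) * s ^ (arr_rank scaleV f - d) * t ^ d)"

definition arr_complement :: "('n \<Rightarrow> 'v \<Rightarrow> complex) \<Rightarrow> 'v set" where
  "arr_complement f = UNIV - (\<Union>i. hyperplane (f i))"

text \<open>
  The value at the tangent vector \<open>v\<close> of the form \<open>\<Sum> lam\<^sub>i df\<^sub>i/f\<^sub>i\<close> at the point \<open>x\<close>; the
  differential of the linear form \<open>f\<^sub>i\<close> at any point is \<open>f\<^sub>i\<close>.
\<close>

definition log_form :: "('n::finite \<Rightarrow> 'v \<Rightarrow> complex) \<Rightarrow> complex ^ 'n \<Rightarrow> 'v \<Rightarrow> 'v \<Rightarrow> complex" where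
  "log_form f lam x v = (\<Sum>i\<in>UNIV. lam $ i * (f i v / f i x))"

definition critical_set :: "('n::finite \<Rightarrow> 'v \<Rightarrow> complex) \<Rightarrow> ('v \<times> (complex ^ 'n)) set" where
  "critical_set f = {(x, lam). x \<in> arr_complement f \<and> (\<forall>v. log_form f lam x v = 0)}"

definition critical_variety :: "(complex \<Rightarrow> 'v::ab_group_add \<Rightarrow> 'v) \<Rightarrow>
    ('n::finite \<Rightarrow> 'v \<Rightarrow> complex) \<Rightarrow> ('v set \<times> (complex ^ 'n) set) set" where
  "critical_variety scaleV f = biprojective.proj_image scaleV (*s)
     (biprojective.zariski_closure scaleV (*s) (critical_set f))"

end

theory Submission
  imports Defs
begin

text \<open>
  Every variety that occurs is the closure of an integral bicone in \<open>V \<times> \<complex>\<^sup>n\<close>, and all divisors are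
  computed in explicit charts, so that neither dimension theory nor properness enters.

  Fix one hyperplane as the hyperplane at infinity. Contracting with the Euler field shows that
  \<open>\<Sum>j. \<lambda>\<^sub>j\<close> cuts the critical variety out of the cone over it in which the coordinate at infinity is
  free, so that the critical variety is rationally equivalent to the section of this cone by the
  coordinate at infinity. For the remaining hyperplanes one adds a free coordinate \<open>\<lambda>\<^sub>k\<close> and compares
  the divisors of \<open>\<lambda>\<^sub>k\<close> and \<open>\<lambda>\<^sub>i\<close>: the first is the variety itself, the second is the sum of the varieties
  of the deletion and of the restriction at \<open>i\<close>. This is the deletion-restriction recursion of the
  characteristic polynomial, and it ends with products of linear subspaces.

  The divisor of \<open>\<lambda>\<^sub>i\<close> has no further components: over the flat where the \<open>f j\<close> with \<open>j \<in> J\<close> vanish,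
  the variety is itself the closure of an integral bicone, on which \<open>\<lambda>\<^sub>i\<close> vanishes only if \<open>i\<close> is a
  coloop of \<open>J\<close>, and then this bicone lies in the restriction.
\<close>

text \<open>Multiplicities are lengths of local rings, and codimension one means that no subvariety
  lies strictly in between. One certificate yields both: every form not vanishing on
  \<open>Z\<close> is, up to units along \<open>D\<close>, a power of one form \<pi>. It comes from
  curves that start in \<open>D\<close> and sweep out a dense part of \<open>Z\<close>, with \<pi>
  or a unit multiple of it as parameter. That no further component exists is seen from inclusions
  alone: a codimension-one \<open>D\<close> inside a proper subvariety is equal to it.

  A second obstacle is that a variety and its deletion and restriction have to be divisors of
  sections of one line bundle on one larger variety. Freeing a vanishing coordinate provides that
  variety, and \<open>K\<close> records which coordinates are free. Testing only directions parallel
  to infinity keeps the class of sets stable under restriction, because the recursion never removes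
  the hyperplane at infinity.

  At \<open>s = -h\<close>, \<open>t = k - h\<close> the recursion has only positive terms:
  \<open>-s = h\<close> pays for the hyperplane section of \<open>X\<close>, and
  \<open>t - s = k\<close> for one vanishing coordinate.\<close>

declare split_paired_All [simp del] split_paired_Ex [simp del]

section \<open>Linear functionals, and polynomials determined by their values\<close>

lemma ex_linear_functional:
  fixes s :: "complex \<Rightarrow> 'a::ab_group_add \<Rightarrow> 'a"
  assumes "vector_space s" "module.subspace s A" "a \<notin> A"
  shows "\<exists>\<phi>. Vector_Spaces.linear s (*) \<phi> \<and> (\<forall>x\<in>A. \<phi> x = 0) \<and> \<phi> a = 1"
proof -
  interpret V: vector_space s by fact
  interpret vector_space_pair s "(*) :: complex \<Rightarrow> complex \<Rightarrow> complex" ..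
  obtain B where B: "B \<subseteq> A" "V.independent B" "V.span B = A"
    using V.basis_exists[of A] assms(2) V.span_subspace[of _ A] by metis
  have ind: "V.independent (insert a B)"
    using B assms(3) V.independent_insertI by blast
  obtain \<phi> where \<phi>: "Vector_Spaces.linear s (*) \<phi>"
    "\<forall>x\<in>insert a B. \<phi> x = (if x = a then 1 else 0)"
    using linear_independent_extend[OF ind, of "\<lambda>x. if x = a then 1 else 0"] by blast
  have "\<phi> x = 0" if "x \<in> A" for x
  proof (rule linear_eq_0_on_span[OF \<phi>(1)])
    show "\<phi> b = 0" if "b \<in> B" for b using \<phi>(2) B(1) that assms(3) by auto
    show "x \<in> V.span B" using that B by simp
  qed
  then show ?thesis using \<phi> by auto
qed

lemma ex_linear_functional_nonzero:
  fixes s :: "complex \<Rightarrow> 'a::ab_group_add \<Rightarrow> 'a"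
  assumes "vector_space s" "a \<noteq> 0"
  shows "\<exists>\<phi>. Vector_Spaces.linear s (*) \<phi> \<and> \<phi> a = 1"
proof -
  interpret V: vector_space s by fact
  show ?thesis
    using ex_linear_functional[OF assms(1) V.subspace_single_0, of a] assms(2) by auto
qed

lemma linear_functional_simps:
  fixes s :: "complex \<Rightarrow> 'a::ab_group_add \<Rightarrow> 'a"
  assumes "Vector_Spaces.linear s (*) \<phi>"
  shows "\<phi> (x + y) = \<phi> x + \<phi> y" "\<phi> (s c x) = c * \<phi> x" "\<phi> 0 = 0" "\<phi> (- x) = - \<phi> x"
    "\<phi> (x - y) = \<phi> x - \<phi> y"
proof -
  interpret Vector_Spaces.linear s "(*) :: complex \<Rightarrow> complex \<Rightarrow> complex" \<phi> by fact
  show "\<phi> (x + y) = \<phi> x + \<phi> y" "\<phi> (s c x) = c * \<phi> x" "\<phi> 0 = 0" "\<phi> (- x) = - \<phi> x"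
    "\<phi> (x - y) = \<phi> x - \<phi> y"
    by (simp_all add: add scale zero neg diff)
qed

lemma poly_all_eq_imp_eq:
  fixes p q :: "complex poly"
  assumes "\<And>x. poly p x = poly q x" shows "p = q"
  using assms poly_eq_poly_eq_iff by blast

text \<open>The curves below lie in a given set for all but finitely many parameters; this carries
  equations over to the exceptional ones.\<close>

lemma poly_eq_0_cofinite:
  fixes p :: "complex poly"
  assumes "finite A" "\<And>x. x \<notin> A \<Longrightarrow> poly p x = 0" shows "p = 0"
proof (rule ccontr)
  assume "p \<noteq> 0"
  then have "finite {x. poly p x = 0}" by (rule poly_roots_finite)
  moreover have "UNIV \<subseteq> A \<union> {x. poly p x = 0}" using assms(2) by auto
  ultimately have "finite (UNIV :: complex set)" using assms(1) finite_subset by blast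
  then show False using infinite_UNIV_char_0 by blast
qed

context biprojective
begin

subsection \<open>Polynomial functions and their bihomogeneous components\<close>

lemmas pf_intros = poly_funs.const poly_funs.add poly_funs.mult

lemma pf_uminus: "F \<in> poly_funs \<Longrightarrow> (\<lambda>z. - F z) \<in> poly_funs"
  using poly_funs.mult[OF poly_funs.const[of "-1"], of F] by simp

lemma pf_diff: "F \<in> poly_funs \<Longrightarrow> G \<in> poly_funs \<Longrightarrow> (\<lambda>z. F z - G z) \<in> poly_funs"
  using poly_funs.add[OF _ pf_uminus, of F G] by simp

lemma pf_sum: "(\<And>i. i \<in> I \<Longrightarrow> F i \<in> poly_funs) \<Longrightarrow> (\<lambda>z. \<Sum>i\<in>I. F i z) \<in> poly_funs"
  by (induction I rule: infinite_finite_induct) (auto intro: pf_intros)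

lemma pf_prod: "(\<And>i. i \<in> I \<Longrightarrow> F i \<in> poly_funs) \<Longrightarrow> (\<lambda>z. \<Prod>i\<in>I. F i z) \<in> poly_funs"
  by (induction I rule: infinite_finite_induct) (auto intro: pf_intros)

lemma pf_power: "F \<in> poly_funs \<Longrightarrow> (\<lambda>z. F z ^ n) \<in> poly_funs"
  by (induction n) (auto intro: pf_intros)

lemmas pf_closed = pf_intros pf_uminus pf_diff pf_sum pf_prod pf_power poly_funs.fst poly_funs.snd

lemma bihom_pf: "bihom a b F \<Longrightarrow> F \<in> poly_funs"
  by (simp add: bihom_def)

lemma bihom_scale: "bihom a b F \<Longrightarrow> F (scaleV c x, scaleW d y) = c ^ a * d ^ b * F (x, y)"
  by (simp add: bihom_def)

lemma bihom_fst: "Vector_Spaces.linear scaleV (*) \<phi> \<Longrightarrow> bihom 1 0 (\<lambda>z. \<phi> (fst z))"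
  by (auto simp: bihom_def linear_functional_simps intro: poly_funs.fst)

lemma bihom_snd: "Vector_Spaces.linear scaleW (*) \<psi> \<Longrightarrow> bihom 0 1 (\<lambda>z. \<psi> (snd z))"
  by (auto simp: bihom_def linear_functional_simps intro: poly_funs.snd)

lemma bihom_power: "bihom a b F \<Longrightarrow> bihom (k * a) (k * b) (\<lambda>z. F z ^ k)"
  by (auto simp: bihom_def power_mult_distrib power_mult mult.commute[of k] intro: pf_power)

text \<open>The degree bound is uniform in the point, so that evaluation at a polynomial function is
  again a finite sum of polynomial functions.\<close>

definition poly_family :: "('v \<times> 'w \<Rightarrow> complex poly) set" where
  "poly_family = {p. (\<forall>k. (\<lambda>z. coeff (p z) k) \<in> poly_funs) \<and> (\<exists>d. \<forall>z. degree (p z) \<le> d)}"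

lemma poly_family_coeff: "p \<in> poly_family \<Longrightarrow> (\<lambda>z. coeff (p z) k) \<in> poly_funs"
  by (simp add: poly_family_def)

lemma poly_family_pCons:
  assumes "F \<in> poly_funs" "p \<in> poly_family"
  shows "(\<lambda>z. pCons (F z) (p z)) \<in> poly_family"
proof -
  obtain d where d: "\<And>z. degree (p z) \<le> d" using assms(2) by (auto simp: poly_family_def)
  have "degree (pCons (F z) (p z)) \<le> Suc d" for z
    using degree_pCons_le[of "F z" "p z"] d[of z] by linarith
  moreover have "(\<lambda>z. coeff (pCons (F z) (p z)) k) \<in> poly_funs" for k
    using assms by (cases k) (auto simp: poly_family_def)
  ultimately show ?thesis unfolding poly_family_def by blast
qed

lemma poly_family_0: "(\<lambda>z. 0) \<in> poly_family"
  by (auto simp: poly_family_def intro: pf_intros)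

lemma poly_family_const: "F \<in> poly_funs \<Longrightarrow> (\<lambda>z. [:F z:]) \<in> poly_family"
  by (intro poly_family_pCons poly_family_0)

lemma poly_family_add:
  assumes "p \<in> poly_family" "q \<in> poly_family" shows "(\<lambda>z. p z + q z) \<in> poly_family"
proof -
  obtain d e where "\<And>z. degree (p z) \<le> d" "\<And>z. degree (q z) \<le> e"
    using assms unfolding poly_family_def by blast
  then have "degree (p z + q z) \<le> max d e" for z
    by (meson degree_add_le le_max_iff_disj)
  then have "\<exists>d. \<forall>z. degree (p z + q z) \<le> d" by blast
  then show ?thesis using assms unfolding poly_family_def by (simp add: pf_intros)
qed

lemma poly_family_mult:
  assumes "p \<in> poly_family" "q \<in> poly_family" shows "(\<lambda>z. p z * q z) \<in> poly_family"
proof -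
  obtain d e where "\<And>z. degree (p z) \<le> d" "\<And>z. degree (q z) \<le> e"
    using assms unfolding poly_family_def by blast
  then have "degree (p z * q z) \<le> d + e" for z
    by (meson degree_mult_le add_mono order_trans)
  then have "\<exists>d. \<forall>z. degree (p z * q z) \<le> d" by blast
  then show ?thesis using assms
    unfolding poly_family_def by (auto simp: coeff_mult intro!: pf_sum pf_intros)
qed

text \<open>The restriction of \<open>F\<close> to the line of multiples of the first component. For
  polynomial functions it is unique because the field is infinite, so the choice does no
  harm.\<close>

definition vpoly :: "('v \<times> 'w \<Rightarrow> complex) \<Rightarrow> 'v \<times> 'w \<Rightarrow> complex poly" where
  "vpoly F z = (SOME p. \<forall>c. poly p c = F (scaleV c (fst z), snd z))"

definition wpoly :: "('v \<times> 'w \<Rightarrow> complex) \<Rightarrow> 'v \<times> 'w \<Rightarrow> complex poly" where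
  "wpoly F z = (SOME p. \<forall>c. poly p c = F (fst z, scaleW c (snd z)))"

lemma vpoly_eqI: "(\<And>c. poly p c = F (scaleV c (fst z), snd z)) \<Longrightarrow> vpoly F z = p"
  unfolding vpoly_def by (rule some_equality) (auto intro: poly_all_eq_imp_eq)

lemma wpoly_eqI: "(\<And>c. poly p c = F (fst z, scaleW c (snd z))) \<Longrightarrow> wpoly F z = p"
  unfolding wpoly_def by (rule some_equality) (auto intro: poly_all_eq_imp_eq)

lemma ex_vpoly:
  assumes "F \<in> poly_funs"
  shows "\<exists>p\<in>poly_family. \<forall>z c. poly (p z) c = F (scaleV c (fst z), snd z)"
  using assms
proof induction
  case (const c)
  then show ?case by (intro bexI[of _ "\<lambda>_. [:c:]"] poly_family_const pf_intros) auto
next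
  case (fst \<phi>)
  then show ?case
    by (intro bexI[of _ "\<lambda>z. [:0, \<phi> (fst z):]"] poly_family_pCons poly_family_0 pf_intros poly_funs.fst)
      (auto simp: linear_functional_simps)
next
  case (snd \<psi>)
  then show ?case
    by (intro bexI[of _ "\<lambda>z. [:\<psi> (snd z):]"] poly_family_const poly_funs.snd) auto
next
  case (add F G)
  then obtain p q where "p \<in> poly_family" "\<forall>z c. poly (p z) c = F (scaleV c (fst z), snd z)"
    "q \<in> poly_family" "\<forall>z c. poly (q z) c = G (scaleV c (fst z), snd z)" by blast
  then show ?case by (intro bexI[of _ "\<lambda>z. p z + q z"] poly_family_add) auto
next
  case (mult F G)
  then obtain p q where "p \<in> poly_family" "\<forall>z c. poly (p z) c = F (scaleV c (fst z), snd z)"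
    "q \<in> poly_family" "\<forall>z c. poly (q z) c = G (scaleV c (fst z), snd z)" by blast
  then show ?case by (intro bexI[of _ "\<lambda>z. p z * q z"] poly_family_mult) auto
qed

lemma ex_wpoly:
  assumes "F \<in> poly_funs"
  shows "\<exists>p\<in>poly_family. \<forall>z c. poly (p z) c = F (fst z, scaleW c (snd z))"
  using assms
proof induction
  case (const c)
  then show ?case by (intro bexI[of _ "\<lambda>_. [:c:]"] poly_family_const pf_intros) auto
next
  case (fst \<phi>)
  then show ?case
    by (intro bexI[of _ "\<lambda>z. [:\<phi> (fst z):]"] poly_family_const poly_funs.fst) auto
next
  case (snd \<psi>)
  then show ?case
    by (intro bexI[of _ "\<lambda>z. [:0, \<psi> (snd z):]"] poly_family_pCons poly_family_0 pf_intros poly_funs.snd)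
      (auto simp: linear_functional_simps)
next
  case (add F G)
  then obtain p q where "p \<in> poly_family" "\<forall>z c. poly (p z) c = F (fst z, scaleW c (snd z))"
    "q \<in> poly_family" "\<forall>z c. poly (q z) c = G (fst z, scaleW c (snd z))" by blast
  then show ?case by (intro bexI[of _ "\<lambda>z. p z + q z"] poly_family_add) auto
next
  case (mult F G)
  then obtain p q where "p \<in> poly_family" "\<forall>z c. poly (p z) c = F (fst z, scaleW c (snd z))"
    "q \<in> poly_family" "\<forall>z c. poly (q z) c = G (fst z, scaleW c (snd z))" by blast
  then show ?case by (intro bexI[of _ "\<lambda>z. p z * q z"] poly_family_mult) auto
qed

lemma vpoly:
  assumes "F \<in> poly_funs"
  shows "vpoly F \<in> poly_family" "poly (vpoly F z) c = F (scaleV c (fst z), snd z)"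
proof -
  obtain p where p: "p \<in> poly_family" "\<forall>z c. poly (p z) c = F (scaleV c (fst z), snd z)"
    using ex_vpoly[OF assms] by blast
  then have "vpoly F = p" by (intro ext vpoly_eqI) auto
  with p show "vpoly F \<in> poly_family" "poly (vpoly F z) c = F (scaleV c (fst z), snd z)" by auto
qed

lemma wpoly:
  assumes "F \<in> poly_funs"
  shows "wpoly F \<in> poly_family" "poly (wpoly F z) c = F (fst z, scaleW c (snd z))"
proof -
  obtain p where p: "p \<in> poly_family" "\<forall>z c. poly (p z) c = F (fst z, scaleW c (snd z))"
    using ex_wpoly[OF assms] by blast
  then have "wpoly F = p" by (intro ext wpoly_eqI) auto
  with p show "wpoly F \<in> poly_family" "poly (wpoly F z) c = F (fst z, scaleW c (snd z))" by auto
qed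

definition vcomp :: "nat \<Rightarrow> ('v \<times> 'w \<Rightarrow> complex) \<Rightarrow> 'v \<times> 'w \<Rightarrow> complex" where
  "vcomp k F z = coeff (vpoly F z) k"

definition wcomp :: "nat \<Rightarrow> ('v \<times> 'w \<Rightarrow> complex) \<Rightarrow> 'v \<times> 'w \<Rightarrow> complex" where
  "wcomp k F z = coeff (wpoly F z) k"

definition bicomp :: "nat \<Rightarrow> nat \<Rightarrow> ('v \<times> 'w \<Rightarrow> complex) \<Rightarrow> 'v \<times> 'w \<Rightarrow> complex" where
  "bicomp k l F = wcomp l (vcomp k F)"

lemma vcomp_pf: "F \<in> poly_funs \<Longrightarrow> vcomp k F \<in> poly_funs"
  using poly_family_coeff[OF vpoly(1)] by (simp add: vcomp_def[abs_def])

lemma wcomp_pf: "F \<in> poly_funs \<Longrightarrow> wcomp k F \<in> poly_funs"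
  using poly_family_coeff[OF wpoly(1)] by (simp add: wcomp_def[abs_def])

lemma vcomp_scale:
  assumes "F \<in> poly_funs" shows "vcomp k F (scaleV c x, y) = c ^ k * vcomp k F (x, y)"
proof -
  have "vpoly F (scaleV c x, y) = pcompose (vpoly F (x, y)) [:0, c:]"
    by (rule vpoly_eqI) (simp add: poly_pcompose vpoly(2)[OF assms] mult.commute)
  then show ?thesis by (simp add: vcomp_def coeff_pcompose_linear)
qed

lemma wcomp_scale:
  assumes "F \<in> poly_funs" shows "wcomp k F (x, scaleW c y) = c ^ k * wcomp k F (x, y)"
proof -
  have "wpoly F (x, scaleW c y) = pcompose (wpoly F (x, y)) [:0, c:]"
    by (rule wpoly_eqI) (simp add: poly_pcompose wpoly(2)[OF assms] mult.commute)
  then show ?thesis by (simp add: wcomp_def coeff_pcompose_linear)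
qed

text \<open>\<open>vcomp k F\<close> has degree \<open>k\<close> in the first variable. By
  uniqueness of \<open>wpoly\<close>, rescaling that variable multiplies the polynomial in the
  second one by a scalar, so passing to its coefficients keeps the degree.\<close>

lemma bicomp_bihom:
  assumes "F \<in> poly_funs" shows "bihom k l (bicomp k l F)"
proof -
  let ?A = "vcomp k F"
  have A: "?A \<in> poly_funs" by (rule vcomp_pf[OF assms])
  have "wpoly ?A (scaleV c x, y) = smult (c ^ k) (wpoly ?A (x, y))" for c x y
    by (rule wpoly_eqI) (simp add: wpoly(2)[OF A] vcomp_scale[OF assms])
  then have "wcomp l ?A (scaleV c x, y) = c ^ k * wcomp l ?A (x, y)" for c x y
    by (simp add: wcomp_def)
  then show ?thesis
    using wcomp_scale[OF A] wcomp_pf[OF A] by (simp add: bihom_def bicomp_def)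
qed

lemma bicomp_all_0:
  assumes "F \<in> poly_funs" "\<And>k l. bicomp k l F z = 0" shows "F z = 0"
proof -
  have "vcomp k F z = 0" for k
  proof -
    have "wpoly (vcomp k F) z = 0"
      by (rule poly_eqI) (use assms(2) in \<open>simp add: bicomp_def wcomp_def\<close>)
    then show ?thesis using wpoly(2)[OF vcomp_pf[OF assms(1), of k], where z = z and c = 1] by simp
  qed
  then have "vpoly F z = 0" by (intro poly_eqI) (simp add: vcomp_def)
  then show ?thesis using vpoly(2)[OF assms(1), where z = z and c = 1] by simp
qed

lemma bicomp_diff:
  assumes "F \<in> poly_funs" "G \<in> poly_funs"
  shows "bicomp k l (\<lambda>z. F z - G z) z = bicomp k l F z - bicomp k l G z"
proof -
  have v: "vcomp k (\<lambda>z. F z - G z) = (\<lambda>z. vcomp k F z - vcomp k G z)"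
  proof
    fix z
    have "vpoly (\<lambda>z. F z - G z) z = vpoly F z - vpoly G z"
      by (rule vpoly_eqI) (simp add: vpoly(2) assms)
    then show "vcomp k (\<lambda>z. F z - G z) z = vcomp k F z - vcomp k G z" by (simp add: vcomp_def)
  qed
  have "wpoly (\<lambda>z. vcomp k F z - vcomp k G z) z = wpoly (vcomp k F) z - wpoly (vcomp k G) z"
    by (rule wpoly_eqI) (simp add: wpoly(2) vcomp_pf assms)
  then show ?thesis by (simp add: bicomp_def v wcomp_def)
qed

text \<open>A bihomogeneous factor only shifts components, and nothing is left below its bidegree.
  Identities between products can therefore be compared degree by degree.\<close>

lemma bicomp_bihom_mult:
  assumes F: "bihom c d F" and G: "G \<in> poly_funs"
  shows "bicomp k l (\<lambda>z. F z * G z) z =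
    (if c \<le> k \<and> d \<le> l then F z * bicomp (k - c) (l - d) G z else 0)"
proof -
  have v: "vcomp k (\<lambda>z. F z * G z) = (\<lambda>z. if c \<le> k then F z * vcomp (k - c) G z else 0)"
  proof
    fix z
    have "F (scaleV a x, y) = a ^ c * F (x, y)" for a x y
      using bihom_scale[OF F, of a x 1 y] by simp
    then have "vpoly (\<lambda>z. F z * G z) z = monom (F z) c * vpoly G z"
      by (intro vpoly_eqI) (cases z, simp add: vpoly(2) G poly_monom)
    then show "vcomp k (\<lambda>z. F z * G z) z = (if c \<le> k then F z * vcomp (k - c) G z else 0)"
      by (simp add: vcomp_def coeff_monom_mult)
  qed
  show ?thesis
  proof (cases "c \<le> k")
    case True
    have "F (x, scaleW a y) = a ^ d * F (x, y)" for a x y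
      using bihom_scale[OF F, of 1 x a y] by simp
    then have "wpoly (\<lambda>z. F z * vcomp (k - c) G z) z = monom (F z) d * wpoly (vcomp (k - c) G) z"
      by (intro wpoly_eqI) (cases z, simp add: wpoly(2) vcomp_pf G poly_monom)
    then show ?thesis using True by (simp add: bicomp_def v wcomp_def coeff_monom_mult)
  next
    case False
    have "wpoly (\<lambda>z. 0) z = 0" by (rule wpoly_eqI) simp
    then show ?thesis using False by (simp add: bicomp_def v wcomp_def)
  qed
qed

subsection \<open>Bicones\<close>

definition vanish :: "('v \<times> 'w \<Rightarrow> complex) \<Rightarrow> ('v \<times> 'w) set \<Rightarrow> bool" where
  "vanish F C \<longleftrightarrow> (\<forall>z\<in>C. F z = 0)"

definition biconical :: "('v \<times> 'w) set \<Rightarrow> bool" where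
  "biconical C \<longleftrightarrow> (\<forall>x y c d. (x, y) \<in> C \<longrightarrow> c \<noteq> 0 \<longrightarrow> d \<noteq> 0 \<longrightarrow> (scaleV c x, scaleW d y) \<in> C)"

text \<open>Irreducibility of the closure, phrased on \<open>C\<close> itself so that it can be
  tested on explicit points.\<close>

definition integral_set :: "('v \<times> 'w) set \<Rightarrow> bool" where
  "integral_set C \<longleftrightarrow> C \<noteq> {} \<and>
     (\<forall>F\<in>poly_funs. \<forall>G\<in>poly_funs. vanish (\<lambda>z. F z * G z) C \<longrightarrow> vanish F C \<or> vanish G C)"

text \<open>Excludes bicones all of whose points have \<open>x = 0\<close> or \<open>y = 0\<close>;
  their image in the product of projective spaces is empty (\<open>proj_degenerate\<close>).\<close>

definition nondegenerate :: "('v \<times> 'w) set \<Rightarrow> bool" where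
  "nondegenerate C \<longleftrightarrow> (\<exists>x y. (x, y) \<in> C \<and> x \<noteq> 0 \<and> y \<noteq> 0)"

definition proj :: "('v \<times> 'w) set \<Rightarrow> ('v set \<times> 'w set) set" where
  "proj C = proj_image (zariski_closure C)"

lemma integral_setD:
  assumes "integral_set C" "F \<in> poly_funs" "G \<in> poly_funs" "\<And>z. z \<in> C \<Longrightarrow> F z * G z = 0"
    "\<not> vanish F C"
  shows "vanish G C"
proof -
  have "vanish (\<lambda>z. F z * G z) C" using assms(4) unfolding vanish_def by blast
  then show ?thesis using assms(1,2,3,5) unfolding integral_set_def by blast
qed

lemma vanish_power: "vanish (\<lambda>z. F z ^ k) C \<Longrightarrow> vanish F C"
  unfolding vanish_def by simp

lemma vanish_closure: "F \<in> poly_funs \<Longrightarrow> vanish F (zariski_closure C) \<longleftrightarrow> vanish F C"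
  unfolding vanish_def zariski_closure_def by blast

lemma closure_subset: "C \<subseteq> zariski_closure C"
  unfolding zariski_closure_def by blast

lemma closure_minimal: "C \<subseteq> zariski_closure C' \<Longrightarrow> zariski_closure C \<subseteq> zariski_closure C'"
  unfolding zariski_closure_def by blast

lemma subset_closureI:
  assumes "\<And>F z. F \<in> poly_funs \<Longrightarrow> vanish F C' \<Longrightarrow> z \<in> C \<Longrightarrow> F z = 0"
  shows "C \<subseteq> zariski_closure C'"
  using assms unfolding zariski_closure_def vanish_def by blast

lemma closure_open_subset:
  assumes C: "integral_set C" and q: "q \<in> poly_funs" "\<not> vanish q C"
  shows "C \<subseteq> zariski_closure {z\<in>C. q z \<noteq> 0}"
proof (rule subset_closureI)
  fix F z assume F: "F \<in> poly_funs" "vanish F {z\<in>C. q z \<noteq> 0}" and z: "z \<in> C"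
  have "vanish F C" by (rule integral_setD[OF C q(1) F(1) _ q(2)]) (use F in \<open>auto simp: vanish_def\<close>)
  then show "F z = 0" using z by (simp add: vanish_def)
qed

lemma closure_empty: "zariski_closure {} = {}"
proof -
  have "z \<notin> zariski_closure {}" for z
  proof
    assume "z \<in> zariski_closure {}"
    then have "\<forall>F\<in>poly_funs. F z = 0" unfolding zariski_closure_def by blast
    from bspec[OF this poly_funs.const[of 1]] show False by (simp only: one_neq_zero)
  qed
  then show ?thesis by blast
qed

lemma proj_empty [simp]: "proj {} = {}"
  by (auto simp: proj_def closure_empty proj_image_def)

lemma proj_mono: "C \<subseteq> zariski_closure C' \<Longrightarrow> proj C \<subseteq> proj C'"
  using closure_minimal[of C C'] unfolding proj_def proj_image_def by blast

lemma proj_eqI: "C \<subseteq> zariski_closure C' \<Longrightarrow> C' \<subseteq> zariski_closure C \<Longrightarrow> proj C = proj C'"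
  by (simp add: proj_mono subset_antisym)

text \<open>On a bicone the polynomial of \<open>F\<close> along multiples of \<open>x\<close>
  vanishes at every nonzero parameter, hence all its coefficients vanish; the same argument applies
  to multiples of \<open>y\<close>.\<close>

lemma vanish_bicomp:
  assumes C: "biconical C" and F: "F \<in> poly_funs" "vanish F C"
  shows "vanish (bicomp k l F) C"
  unfolding vanish_def
proof
  fix z assume z: "z \<in> C"
  obtain x y where xy: "z = (x, y)" by (cases z)
  have van: "vanish (vcomp k F) C" for k
    unfolding vanish_def
  proof
    fix z assume z: "z \<in> C"
    have "vpoly F z = 0"
    proof (rule poly_eq_0_cofinite[of "{0}"])
      fix c :: complex assume "c \<notin> {0}"
      then show "poly (vpoly F z) c = 0"
        using C z F(2) unfolding vpoly(2)[OF F(1)] biconical_def vanish_def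
        by (cases z) (metis W.scale_one fst_conv snd_conv insertI1 zero_neq_one)
    qed simp
    then show "vcomp k F z = 0" by (simp add: vcomp_def)
  qed
  have "wpoly (vcomp k F) z = 0"
  proof (rule poly_eq_0_cofinite[of "{0}"])
    fix c :: complex assume "c \<notin> {0}"
    then show "poly (wpoly (vcomp k F) z) c = 0"
      using C z van unfolding wpoly(2)[OF vcomp_pf[OF F(1)]] biconical_def vanish_def
      by (cases z) (metis V.scale_one fst_conv snd_conv insertI1 zero_neq_one)
  qed simp
  then show "bicomp k l F z = 0" by (simp add: bicomp_def wcomp_def)
qed

lemma closure_biconical_eq:
  assumes "biconical C"
  shows "zariski_closure C = {z. \<forall>F\<in>{F. (\<exists>a b. bihom a b F) \<and> vanish F C}. F z = 0}"
proof -
  have "F z = 0" if z: "\<forall>F\<in>{F. (\<exists>a b. bihom a b F) \<and> vanish F C}. F z = 0"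
    and F: "F \<in> poly_funs" "vanish F C" for F z
    by (rule bicomp_all_0[OF F(1)]) (use z bicomp_bihom[OF F(1)] vanish_bicomp[OF assms F] in blast)
  then show ?thesis using bihom_pf unfolding zariski_closure_def vanish_def by blast
qed

lemma closed_set_proj:
  assumes "biconical C" shows "closed_set (proj C)"
  unfolding closed_set_def proj_def
  by (rule exI[of _ "{F. (\<exists>a b. bihom a b F) \<and> vanish F C}"])
    (simp only: closure_biconical_eq[OF assms] mem_Collect_eq, blast)

lemma closure_biconicalI:
  assumes "biconical C" "\<And>a b F. bihom a b F \<Longrightarrow> vanish F C \<Longrightarrow> F z = 0"
  shows "z \<in> zariski_closure C"
  unfolding closure_biconical_eq[OF assms(1)] mem_Collect_eq using assms(2) by blast

lemma pt_in_proj: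
  assumes C: "biconical C" and "x \<noteq> 0" "y \<noteq> 0"
  shows "pt x y \<in> proj C \<longleftrightarrow> (x, y) \<in> zariski_closure C"
proof
  assume "pt x y \<in> proj C"
  then obtain x' y' where p: "pt x y = pt x' y'" "(x', y') \<in> zariski_closure C"
    unfolding proj_def proj_image_def by blast
  show "(x, y) \<in> zariski_closure C"
    by (rule closure_biconicalI[OF C], rule bihom_pt[OF _ p(1)])
      (use p(2) bihom_pf in \<open>auto simp: zariski_closure_def vanish_def\<close>)
next
  assume "(x, y) \<in> zariski_closure C"
  then show "pt x y \<in> proj C" using assms unfolding proj_def proj_image_def by blast
qed

text \<open>A product \<phi>\<psi> of linear forms that is nonzero at one point of \<open>C\<close>
  vanishes at all points with \<open>x = 0\<close> or \<open>y = 0\<close>. So its product with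
  \<open>F\<close> vanishes on \<open>C\<close>, and integrality cancels it.\<close>

lemma vanish_on_nonzero:
  assumes C: "integral_set C" "nondegenerate C" and F: "F \<in> poly_funs"
    and 0: "\<And>x y. (x, y) \<in> C \<Longrightarrow> x \<noteq> 0 \<Longrightarrow> y \<noteq> 0 \<Longrightarrow> F (x, y) = 0"
  shows "vanish F C"
proof -
  obtain x0 y0 where z0: "(x0, y0) \<in> C" "x0 \<noteq> 0" "y0 \<noteq> 0"
    using C by (auto simp: nondegenerate_def)
  obtain \<phi> where \<phi>: "Vector_Spaces.linear scaleV (*) \<phi>" "\<phi> x0 = 1"
    using ex_linear_functional_nonzero[OF V.vector_space_axioms z0(2)] by blast
  obtain \<psi> where \<psi>: "Vector_Spaces.linear scaleW (*) \<psi>" "\<psi> y0 = 1"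
    using ex_linear_functional_nonzero[OF W.vector_space_axioms z0(3)] by blast
  show ?thesis
  proof (rule integral_setD[OF C(1) _ F])
    show "(\<lambda>z. \<phi> (fst z) * \<psi> (snd z)) \<in> poly_funs"
      using \<phi> \<psi> by (intro pf_closed)
    show "\<not> vanish (\<lambda>z. \<phi> (fst z) * \<psi> (snd z)) C"
      using z0 \<phi> \<psi> unfolding vanish_def by (metis fst_conv snd_conv mult_1 zero_neq_one)
    fix z assume "z \<in> C"
    then show "\<phi> (fst z) * \<psi> (snd z) * F z = 0"
      using 0[of "fst z" "snd z"] linear_functional_simps(3)[OF \<phi>(1)] linear_functional_simps(3)[OF \<psi>(1)]
      by (cases "fst z = 0"; cases "snd z = 0") auto
  qed
qed

lemma vanishes_on_proj:
  assumes C: "biconical C" "integral_set C" "nondegenerate C" and F: "F \<in> poly_funs"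
  shows "vanishes_on F (proj C) \<longleftrightarrow> vanish F C"
proof
  assume v: "vanishes_on F (proj C)"
  show "vanish F C"
  proof (rule vanish_on_nonzero[OF C(2,3) F])
    fix x y assume "(x, y) \<in> C" "x \<noteq> 0" "y \<noteq> 0"
    then show "F (x, y) = 0"
      using v pt_in_proj[OF C(1)] closure_subset[of C] unfolding vanishes_on_def by blast
  qed
next
  assume "vanish F C"
  then have "vanish F (zariski_closure C)" using vanish_closure[OF F] by simp
  then show "vanishes_on F (proj C)"
    using pt_in_proj[OF C(1)] unfolding vanishes_on_def vanish_def by blast
qed

lemma proj_nonempty: "nondegenerate C \<Longrightarrow> proj C \<noteq> {}"
  using closure_subset[of C] unfolding nondegenerate_def proj_def proj_image_def by blast

text \<open>A closed set not containing \<open>proj C\<close> has an equation that is not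
  identically zero on \<open>C\<close>. If two such sets covered \<open>proj C\<close>, the product
  of two such equations would vanish on \<open>C\<close>.\<close>

lemma subvariety_proj:
  assumes C: "biconical C" "integral_set C" "nondegenerate C"
  shows "subvariety (proj C)"
  unfolding subvariety_def
proof (intro conjI allI impI)
  show "closed_set (proj C)" by (rule closed_set_proj[OF C(1)])
  show "proj C \<noteq> {}" by (rule proj_nonempty[OF C(3)])
  fix A B assume A: "closed_set A" and B: "closed_set B" and AB: "proj C \<subseteq> A \<union> B"
  obtain \<F> where \<F>: "\<forall>F\<in>\<F>. \<exists>a b. bihom a b F" "A = proj_image {z. \<forall>F\<in>\<F>. F z = 0}"
    using A unfolding closed_set_def by blast
  obtain \<G> where \<G>: "\<forall>F\<in>\<G>. \<exists>a b. bihom a b F" "B = proj_image {z. \<forall>F\<in>\<G>. F z = 0}"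
    using B unfolding closed_set_def by blast
  show "proj C \<subseteq> A \<or> proj C \<subseteq> B"
  proof (rule ccontr)
    assume n: "\<not> (proj C \<subseteq> A \<or> proj C \<subseteq> B)"
    have *: "\<exists>F\<in>\<H>. \<not> vanish F C" if "\<not> proj C \<subseteq> proj_image {z. \<forall>F\<in>\<H>. F z = 0}"
      "\<forall>F\<in>\<H>. \<exists>a b. bihom a b F" for \<H>
    proof (rule ccontr)
      assume "\<not> (\<exists>F\<in>\<H>. \<not> vanish F C)"
      then have "\<forall>z\<in>zariski_closure C. \<forall>F\<in>\<H>. F z = 0"
        using that(2) bihom_pf unfolding zariski_closure_def vanish_def by blast
      then show False using that(1) unfolding proj_def proj_image_def by blast
    qed
    obtain F where F: "F \<in> \<F>" "\<not> vanish F C" using *[of \<F>] n \<F> by blast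
    obtain G where G: "G \<in> \<G>" "\<not> vanish G C" using *[of \<G>] n \<G> by blast
    have FG: "F \<in> poly_funs" "G \<in> poly_funs" using F G \<F> \<G> bihom_pf by blast+
    have "vanish (\<lambda>z. F z * G z) C"
    proof (rule vanish_on_nonzero[OF C(2,3)])
      fix x y assume xy: "(x, y) \<in> C" "x \<noteq> 0" "y \<noteq> 0"
      then have "pt x y \<in> A \<union> B"
        using AB pt_in_proj[OF C(1)] closure_subset[of C] by blast
      then show "F (x, y) * G (x, y) = 0"
      proof
        assume "pt x y \<in> A"
        then obtain x' y' where "pt x y = pt x' y'" "F (x', y') = 0"
          using F(1) unfolding \<F>(2) proj_image_def by auto
        then show ?thesis using bihom_pt F(1) \<F>(1) by fastforce
      next
        assume "pt x y \<in> B"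
        then obtain x' y' where "pt x y = pt x' y'" "G (x', y') = 0"
          using G(1) unfolding \<G>(2) proj_image_def by auto
        then show ?thesis using bihom_pt G(1) \<G>(1) by fastforce
      qed
    qed (intro pf_closed FG)
    then show False using F(2) G(2) integral_setD[OF C(2) FG] unfolding vanish_def by blast
  qed
qed

lemma closed_set_subsetI:
  assumes Y: "closed_set Y" and X: "closed_set X"
    and v: "\<And>a b F. bihom a b F \<Longrightarrow> vanishes_on F Y \<Longrightarrow> vanishes_on F X"
  shows "X \<subseteq> Y"
proof
  fix p assume p: "p \<in> X"
  then obtain x y where xy: "p = pt x y" "x \<noteq> 0" "y \<noteq> 0"
    using X unfolding closed_set_def proj_image_def by auto
  obtain \<F> where \<F>: "\<forall>F\<in>\<F>. \<exists>a b. bihom a b F" "Y = proj_image {z. \<forall>F\<in>\<F>. F z = 0}"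
    using Y unfolding closed_set_def by blast
  have "F (x, y) = 0" if F: "F \<in> \<F>" for F
  proof -
    obtain a b where h: "bihom a b F" using \<F>(1) F by blast
    have "vanishes_on F Y"
      using bihom_pt[OF h] F unfolding \<F>(2) vanishes_on_def proj_image_def by blast
    then have "vanishes_on F X" by (rule v[OF h])
    then show ?thesis using p xy by (auto simp: vanishes_on_def)
  qed
  then show "p \<in> Y" using xy unfolding \<F>(2) proj_image_def by blast
qed

lemma vanishes_on_subset: "X \<subseteq> Y \<Longrightarrow> vanishes_on F Y \<Longrightarrow> vanishes_on F X"
  unfolding vanishes_on_def by blast

lemma subvariety_closed: "subvariety Z \<Longrightarrow> closed_set Z"
  by (simp add: subvariety_def)

lemma subvariety_point:
  assumes "subvariety Z" obtains x y where "x \<noteq> 0" "y \<noteq> 0" "pt x y \<in> Z"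
proof -
  have "closed_set Z" "Z \<noteq> {}" using assms by (auto simp: subvariety_def)
  then show ?thesis using that unfolding closed_set_def proj_image_def by auto
qed

end

section \<open>Lengths of the zero ring and of fields\<close>

lemma ring_length_trivial:
  assumes "carrier R = {x}" shows "ring_length R = 0"
proof -
  have "n = 0" if "\<forall>i\<le>n. ideal (J i) R" "\<forall>i<n. J i \<subset> J (Suc i)" for n and J :: "nat \<Rightarrow> 'a set"
  proof (rule ccontr)
    assume "n \<noteq> 0"
    then have "ideal (J 0) R" "ideal (J 1) R" "J 0 \<subset> J 1" using that by auto
    moreover have "I = {x}" if "ideal I R" for I
    proof -
      have "I \<subseteq> {x}" using additive_subgroup.a_subset[OF ideal.axioms(1)[OF that]] assms by simp
      moreover have "I \<noteq> {}"
        using additive_subgroup.zero_closed[OF ideal.axioms(1)[OF that]] by blast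
      ultimately show ?thesis by blast
    qed
    ultimately show False by blast
  qed
  then have "{n. \<exists>J :: nat \<Rightarrow> 'a set. (\<forall>i\<le>n. ideal (J i) R) \<and> (\<forall>i<n. J i \<subset> J (Suc i))} \<subseteq> {0}"
    by blast
  \<comment> \<open>\<open>R\<close> need not satisfy the ring axioms, so even the chain consisting
    of one ideal may be missing; the supremum of the empty set is \<open>0\<close> as well.\<close>
  then have "{n. \<exists>J :: nat \<Rightarrow> 'a set. (\<forall>i\<le>n. ideal (J i) R) \<and> (\<forall>i<n. J i \<subset> J (Suc i))} \<in> {{}, {0}}"
    by (simp only: subset_singleton_iff insert_iff empty_iff simp_thms)
  then show ?thesis unfolding ring_length_def
    by (elim insertE) (simp_all only: Sup_nat_empty cSup_singleton empty_iff)
qed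

lemma ring_length_field:
  assumes "field R" shows "ring_length R = 1"
  unfolding ring_length_def
proof (rule cSup_eq_maximum)
  interpret field R by fact
  have ideals: "I = {\<zero>\<^bsub>R\<^esub>} \<or> I = carrier R" if "ideal I R" for I
    using all_ideals that by blast
  have lt: "{\<zero>\<^bsub>R\<^esub>} \<subset> carrier R"
    using one_closed zero_closed one_not_zero by (metis psubsetI empty_subsetI insert_subset singletonD)
  show "1 \<in> {n. \<exists>J :: nat \<Rightarrow> 'a set. (\<forall>i\<le>n. ideal (J i) R) \<and> (\<forall>i<n. J i \<subset> J (Suc i))}"
    using lt zeroideal oneideal
    by (intro CollectI exI[of _ "\<lambda>i. if i = 0 then {\<zero>\<^bsub>R\<^esub>} else carrier R"]) auto
  fix n assume "n \<in> {n. \<exists>J :: nat \<Rightarrow> 'a set. (\<forall>i\<le>n. ideal (J i) R) \<and> (\<forall>i<n. J i \<subset> J (Suc i))}"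
  then obtain J :: "nat \<Rightarrow> 'a set" where J: "\<forall>i\<le>n. ideal (J i) R" "\<forall>i<n. J i \<subset> J (Suc i)" by blast
  show "n \<le> 1"
  proof (rule ccontr)
    assume "\<not> n \<le> 1"
    then have n: "0 \<le> n" "1 \<le> n" "2 \<le> n" "0 < n" "1 < n" by auto
    then have "ideal (J 0) R" "ideal (J 1) R" "ideal (J 2) R" using J(1) by blast+
    then have "J 0 = {\<zero>\<^bsub>R\<^esub>} \<or> J 0 = carrier R" "J 1 = {\<zero>\<^bsub>R\<^esub>} \<or> J 1 = carrier R"
      "J 2 = {\<zero>\<^bsub>R\<^esub>} \<or> J 2 = carrier R" by (blast dest: ideals)+
    moreover have "J 0 \<subset> J 1" "J 1 \<subset> J 2"
      using J(2) n(4,5) by (auto simp: numeral_2_eq_2)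
    ultimately show False using lt by (elim disjE) (simp_all add: less_le_not_le)
  qed
qed

context biprojective
begin

subsection \<open>Uniformizers and orders of vanishing\<close>

text \<open>States that the local ring along \<open>D\<close> is a discrete valuation ring with
  parameter \<pi>, without mentioning that ring: \<open>G\<close> and \<open>H\<close> are units
  along \<open>D\<close>, and the degree equations make the two sides of the identity forms of one
  bidegree.\<close>

definition uniformizer ::
    "nat \<Rightarrow> nat \<Rightarrow> ('v set \<times> 'w set) set \<Rightarrow> ('v set \<times> 'w set) set \<Rightarrow> ('v \<times> 'w \<Rightarrow> complex) \<Rightarrow> bool" where
  "uniformizer a b Z D \<pi> \<longleftrightarrow> bihom a b \<pi> \<and> vanishes_on \<pi> D \<and> \<not> vanishes_on \<pi> Z \<and>
     (\<forall>c d F. bihom c d F \<longrightarrow> \<not> vanishes_on F Z \<longrightarrow>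
       (\<exists>k p q p' q' G H. bihom p q G \<and> bihom p' q' H \<and> p + c = k * a + p' \<and> q + d = k * b + q' \<and>
          \<not> vanishes_on G D \<and> \<not> vanishes_on H D \<and> vanishes_on (\<lambda>z. G z * F z - \<pi> z ^ k * H z) Z))"

lemma uniformizerE:
  assumes "uniformizer a b Z D \<pi>" "bihom c d F" "\<not> vanishes_on F Z"
  obtains k p q p' q' G H where "bihom p q G" "bihom p' q' H" "p + c = k * a + p'" "q + d = k * b + q'"
    "\<not> vanishes_on G D" "\<not> vanishes_on H D"
    "\<And>x y. x \<noteq> 0 \<Longrightarrow> y \<noteq> 0 \<Longrightarrow> pt x y \<in> Z \<Longrightarrow> G (x, y) * F (x, y) = \<pi> (x, y) ^ k * H (x, y)"
proof -
  obtain k p q p' q' G H where *: "bihom p q G" "bihom p' q' H" "p + c = k * a + p'" "q + d = k * b + q'"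
    "\<not> vanishes_on G D" "\<not> vanishes_on H D" "vanishes_on (\<lambda>z. G z * F z - \<pi> z ^ k * H z) Z"
    using assms unfolding uniformizer_def by blast
  have "G (x, y) * F (x, y) = \<pi> (x, y) ^ k * H (x, y)" if "x \<noteq> 0" "y \<noteq> 0" "pt x y \<in> Z" for x y
    using *(7) that unfolding vanishes_on_def by simp
  with * show ?thesis by (intro that)
qed

lemma vanishes_onI:
  "(\<And>x y. x \<noteq> 0 \<Longrightarrow> y \<noteq> 0 \<Longrightarrow> pt x y \<in> Z \<Longrightarrow> F (x, y) = 0) \<Longrightarrow> vanishes_on F Z"
  unfolding vanishes_on_def by blast

lemma vanishes_onD:
  "vanishes_on F Z \<Longrightarrow> x \<noteq> 0 \<Longrightarrow> y \<noteq> 0 \<Longrightarrow> pt x y \<in> Z \<Longrightarrow> F (x, y) = 0"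
  unfolding vanishes_on_def by blast

lemma vanishes_on_power:
  assumes "vanishes_on (\<lambda>z. F z ^ k) Z" shows "vanishes_on F Z"
  using assms unfolding vanishes_on_def by simp

lemma vanishes_on_1: "subvariety D \<Longrightarrow> \<not> vanishes_on (\<lambda>_. 1) D"
  using one_not_vanishes[of D D] by blast

text \<open>Let \<open>Y\<close> lie strictly between. A form vanishing on \<open>Y\<close> but not
  on \<open>Z\<close> forces \<pi> to vanish on \<open>Y\<close>. A form vanishing on
  \<open>D\<close> but not on \<open>Y\<close> is divisible by \<pi> up to a unit along
  \<open>D\<close>, so it vanishes on \<open>Y\<close> after all.\<close>

lemma uniformizer_codim_one:
  assumes Z: "subvariety Z" and D: "subvariety D" and DZ: "D \<subseteq> Z" and u: "uniformizer a b Z D \<pi>"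
  shows "codim_one D Z"
proof -
  have \<pi>: "bihom a b \<pi>" "vanishes_on \<pi> D" "\<not> vanishes_on \<pi> Z" using u by (auto simp: uniformizer_def)
  have False if Y: "subvariety Y" "D \<subset> Y" "Y \<subset> Z" for Y
  proof -
    have "\<not> Z \<subseteq> Y" using Y by blast
    then obtain c d F where F: "bihom c d F" "vanishes_on F Y" "\<not> vanishes_on F Z"
      using closed_set_subsetI[OF subvariety_closed subvariety_closed] Y(1) Z by blast
    obtain k p q p' q' G H where GH: "bihom p q G" "bihom p' q' H" "\<not> vanishes_on G D" "\<not> vanishes_on H D"
      and e: "\<And>x y. x \<noteq> 0 \<Longrightarrow> y \<noteq> 0 \<Longrightarrow> pt x y \<in> Z \<Longrightarrow> G (x, y) * F (x, y) = \<pi> (x, y) ^ k * H (x, y)"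
      using uniformizerE[OF u F(1,3)] by metis
    have "vanishes_on (\<lambda>z. \<pi> z ^ k * H z) Y"
    proof (rule vanishes_onI)
      fix x y assume xy: "x \<noteq> 0" "y \<noteq> 0" "pt x y \<in> Y"
      then have "pt x y \<in> Z" using Y by blast
      then show "\<pi> (x, y) ^ k * H (x, y) = 0"
        using e[of x y] vanishes_onD[OF F(2)] xy by simp
    qed
    then have "vanishes_on (\<lambda>z. \<pi> z ^ k) Y \<or> vanishes_on H Y"
      by (rule vanishes_on_prod[OF Y(1) bihom_power[OF \<pi>(1)] GH(2)])
    then have \<pi>Y: "vanishes_on \<pi> Y"
      using GH(4) vanishes_on_subset[of D Y H] Y(2) vanishes_on_power by blast
    have "\<not> Y \<subseteq> D" using Y by blast
    then obtain c' d' F' where F': "bihom c' d' F'" "vanishes_on F' D" "\<not> vanishes_on F' Y"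
      using closed_set_subsetI[OF subvariety_closed subvariety_closed] Y(1) D by blast
    have F'Z: "\<not> vanishes_on F' Z" using F'(3) vanishes_on_subset[of Y Z F'] Y(3) by blast
    obtain k p q p' q' G H where GH: "bihom p q G" "bihom p' q' H" "\<not> vanishes_on G D" "\<not> vanishes_on H D"
      and e: "\<And>x y. x \<noteq> 0 \<Longrightarrow> y \<noteq> 0 \<Longrightarrow> pt x y \<in> Z \<Longrightarrow> G (x, y) * F' (x, y) = \<pi> (x, y) ^ k * H (x, y)"
      using uniformizerE[OF u F'(1) F'Z] by metis
    show False
    proof (cases "k = 0")
      case True
      have "vanishes_on H D"
      proof (rule vanishes_onI)
        fix x y assume xy: "x \<noteq> 0" "y \<noteq> 0" "pt x y \<in> D"
        then have "pt x y \<in> Z" using DZ by blast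
        then show "H (x, y) = 0" using e[of x y] vanishes_onD[OF F'(2)] xy True by simp
      qed
      then show False using GH by simp
    next
      case False
      have "vanishes_on (\<lambda>z. G z * F' z) Y"
      proof (rule vanishes_onI)
        fix x y assume xy: "x \<noteq> 0" "y \<noteq> 0" "pt x y \<in> Y"
        then have "pt x y \<in> Z" using Y by blast
        then show "G (x, y) * F' (x, y) = 0" using e[of x y] vanishes_onD[OF \<pi>Y] xy False by simp
      qed
      then have "vanishes_on G Y \<or> vanishes_on F' Y"
        by (rule vanishes_on_prod[OF Y(1) GH(1) F'(1)])
      then show False using F'(3) GH(3) vanishes_on_subset[of D Y G] Y(2) by blast
    qed
  qed
  moreover have "D \<noteq> Z" using \<pi> by blast
  ultimately show ?thesis using Z D DZ unfolding codim_one_def by blast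
qed

lemma ex_nonvanishing_form:
  assumes "subvariety D" shows "\<exists>G. bihom a b G \<and> \<not> vanishes_on G D"
proof -
  obtain x y where xy: "x \<noteq> 0" "y \<noteq> 0" "pt x y \<in> D" using subvariety_point[OF assms] .
  obtain \<phi> where \<phi>: "Vector_Spaces.linear scaleV (*) \<phi>" "\<phi> x = 1"
    using ex_linear_functional_nonzero[OF V.vector_space_axioms xy(1)] by blast
  obtain \<psi> where \<psi>: "Vector_Spaces.linear scaleW (*) \<psi>" "\<psi> y = 1"
    using ex_linear_functional_nonzero[OF W.vector_space_axioms xy(2)] by blast
  let ?G = "\<lambda>z. \<phi> (fst z) ^ a * \<psi> (snd z) ^ b"
  have "bihom a b ?G"
    using bihom_mult[OF bihom_power[OF bihom_fst[OF \<phi>(1)], of a] bihom_power[OF bihom_snd[OF \<psi>(1)], of b]]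
    by simp
  moreover have "\<not> vanishes_on ?G D" using vanishes_onD[OF _ xy, of ?G] \<phi> \<psi> by auto
  ultimately show ?thesis by blast
qed

context
  fixes Z D
  assumes Z: "subvariety Z" and D: "subvariety D" and DZ: "D \<subseteq> Z"
begin

lemma local_ring_one: "\<one>\<^bsub>local_ring Z D\<^esub> = frac_class Z D ((\<lambda>_. 1), (\<lambda>_. 1))"
  by (simp add: local_ring_def)

lemma frac_class_eq_iff:
  assumes "r \<in> fracs D" "s \<in> fracs D"
  shows "frac_class Z D r = frac_class Z D s \<longleftrightarrow>
    (\<forall>x y. x \<noteq> 0 \<longrightarrow> y \<noteq> 0 \<longrightarrow> pt x y \<in> Z \<longrightarrow> fst r (x,y) * snd s (x,y) = fst s (x,y) * snd r (x,y))"
  unfolding frac_class_def eq_equiv_class_iff[OF equiv_frac_rel[OF Z D DZ] assms]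
    frac_rel_iff[OF Z D DZ] using assms by blast

lemma ord_along_eq_0:
  assumes F: "bihom a b F" "\<not> vanishes_on F D"
  shows "ord_along Z D F = 0"
proof -
  define R where "R = local_ring Z D"
  define S where "S = {frac_class Z D (F, G) | G. (F, G) \<in> fracs D}"
  interpret R: cring R unfolding R_def by (rule cring_local_ring[OF Z D DZ])
  \<comment> \<open>\<open>F\<close> itself is an admissible denominator, which puts
    \<open>1\<close> into the generating set of the ideal.\<close>
  have FF: "(F, F) \<in> fracs D" using F by (auto simp: fracs_def)
  have "frac_class Z D (F, F) = \<one>\<^bsub>R\<^esub>"
    unfolding R_def local_ring_one
    by (rule frac_class_eqI[OF Z D DZ FF one_frac[OF Z D DZ]]) simp
  then have one: "\<one>\<^bsub>R\<^esub> \<in> S" using FF unfolding S_def by force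
  have S: "S \<subseteq> carrier R"
    unfolding R_def S_def carrier_local_ring[OF Z D DZ] by blast
  interpret I: ideal "Idl\<^bsub>R\<^esub> S" R by (rule R.genideal_ideal[OF S])
  have I: "Idl\<^bsub>R\<^esub> S = carrier R"
    using I.one_imp_carrier one R.genideal_self[OF S] by blast
  have "carrier (R Quot (Idl\<^bsub>R\<^esub> S)) = {Idl\<^bsub>R\<^esub> S}"
    using abelian_subgroup.a_rcos_const[OF abelian_subgroupI3[OF I.is_additive_subgroup R.is_abelian_group]]
      R.zero_closed unfolding I by (auto simp: FactRing_def A_RCOSETS_def')
  then show ?thesis
    unfolding ord_along_def Let_def R_def[symmetric] S_def[symmetric] by (rule ring_length_trivial)
qed

text \<open>The local equations of \<pi> generate the ideal \<open>M\<close> of all fractions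
  vanishing on \<open>D\<close>. A fraction outside \<open>M\<close> can be inverted, so
  \<open>M\<close> is maximal and the quotient is a field, of length one.\<close>

lemma ord_along_uniformizer:
  assumes u: "uniformizer a b Z D \<pi>"
  shows "ord_along Z D \<pi> = 1"
proof -
  have \<pi>: "bihom a b \<pi>" "vanishes_on \<pi> D" using u by (auto simp: uniformizer_def)
  define R where "R = local_ring Z D"
  define S where "S = {frac_class Z D (\<pi>, G) | G. (\<pi>, G) \<in> fracs D}"
  define M where "M = {frac_class Z D (F, G) | F G. (F, G) \<in> fracs D \<and> vanishes_on F D}"
  note cl = local_ring_mult_class[OF Z D DZ, folded R_def] local_ring_add_class[OF Z D DZ, folded R_def]
  note fm = fracs_mult[OF Z D DZ]
  interpret R: cring R unfolding R_def by (rule cring_local_ring[OF Z D DZ])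
  have carr: "carrier R = frac_class Z D ` fracs D"
    unfolding R_def by (rule carrier_local_ring[OF Z D DZ])
  have S: "S \<subseteq> carrier R" unfolding S_def carr by blast
  interpret I: ideal "Idl\<^bsub>R\<^esub> S" R by (rule R.genideal_ideal[OF S])
  have SI: "S \<subseteq> Idl\<^bsub>R\<^esub> S" by (rule R.genideal_self[OF S])
  have M_r: "x \<otimes>\<^bsub>R\<^esub> y \<in> M" if x: "x \<in> M" and y: "y \<in> carrier R" for x y
  proof -
    obtain F G where r: "x = frac_class Z D (F, G)" "(F, G) \<in> fracs D" "vanishes_on F D"
      using x unfolding M_def by blast
    obtain F' G' where s: "y = frac_class Z D (F', G')" "(F', G') \<in> fracs D"
      using y unfolding carr by auto
    have "vanishes_on (\<lambda>z. F z * F' z) D"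
      using r(3) unfolding vanishes_on_def by simp
    then show ?thesis
      using fm[OF r(2) s(2)] unfolding r(1) s(1) cl(1)[OF r(2) s(2)] M_def frac_mult_def by auto
  qed
  have M_carr: "M \<subseteq> carrier R" unfolding M_def carr by blast
  have Mideal: "ideal M R"
  proof (rule idealI)
    show "ring R" by (rule R.ring_axioms)
    show "x \<otimes>\<^bsub>R\<^esub> y \<in> M" if "x \<in> M" "y \<in> carrier R" for x y using M_r that .
    show "y \<otimes>\<^bsub>R\<^esub> x \<in> M" if "x \<in> M" "y \<in> carrier R" for x y
      using M_r[OF that] R.m_comm[of x y] that M_carr by auto
    show "subgroup M (add_monoid R)"
    proof (rule R.add.subgroupI[OF M_carr])
      have "frac_class Z D ((\<lambda>_. 0), (\<lambda>_. 1)) \<in> M"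
        unfolding M_def using one_frac[OF Z D DZ, of 0] by (fastforce simp: vanishes_on_def)
      then show "M \<noteq> {}" by blast
      show "\<ominus>\<^bsub>R\<^esub> x \<in> M" if "x \<in> M" for x
      proof -
        have "\<ominus>\<^bsub>R\<^esub> x = x \<otimes>\<^bsub>R\<^esub> (\<ominus>\<^bsub>R\<^esub> \<one>\<^bsub>R\<^esub>)"
          using that M_carr by (simp add: R.r_minus subset_iff)
        then show ?thesis using M_r[OF that] by simp
      qed
      fix x y assume "x \<in> M" "y \<in> M"
      then obtain F G F' G' where r: "x = frac_class Z D (F, G)" "(F, G) \<in> fracs D" "vanishes_on F D"
        and s: "y = frac_class Z D (F', G')" "(F', G') \<in> fracs D" "vanishes_on F' D"
        unfolding M_def by blast
      have "vanishes_on (\<lambda>z. F z * G' z + F' z * G z) D"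
        using r(3) s(3) unfolding vanishes_on_def by simp
      then show "x \<oplus>\<^bsub>R\<^esub> y \<in> M"
        using fracs_add[OF Z D DZ r(2) s(2)]
        unfolding r(1) s(1) cl(2)[OF r(2) s(2)] M_def frac_add_def by auto
    qed
  qed
  have "S \<subseteq> M" unfolding S_def M_def using \<pi>(2) by blast
  then have IM: "Idl\<^bsub>R\<^esub> S \<subseteq> M" by (rule R.genideal_minimal[OF Mideal])
  have mem_M: "vanishes_on F D" if FG: "(F, G) \<in> fracs D" and m: "frac_class Z D (F, G) \<in> M" for F G
  proof -
    obtain F' G' where s: "frac_class Z D (F, G) = frac_class Z D (F', G')" "(F', G') \<in> fracs D"
      "vanishes_on F' D" using m unfolding M_def by blast
    have "vanishes_on (\<lambda>z. F z * G' z) D"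
    proof (rule vanishes_onI)
      fix x y assume xy: "x \<noteq> 0" "y \<noteq> 0" "pt x y \<in> D"
      then have "pt x y \<in> Z" using DZ by blast
      then have "F (x, y) * G' (x, y) = F' (x, y) * G (x, y)"
        using s(1) xy unfolding frac_class_eq_iff[OF FG s(2)] by auto
      then show "F (x, y) * G' (x, y) = 0" using vanishes_onD[OF s(3) xy] by simp
    qed
    moreover obtain i j where "bihom i j F" using FG by (auto simp: fracs_def)
    moreover obtain i j where "bihom i j G'" "\<not> vanishes_on G' D" using s(2) by (auto simp: fracs_def)
    ultimately show ?thesis using vanishes_on_prod[OF D] by blast
  qed
  have MI: "x \<in> Idl\<^bsub>R\<^esub> S" if "x \<in> M" for x
  proof -
    obtain F G' where x: "x = frac_class Z D (F, G')" and FG': "(F, G') \<in> fracs D" and FD: "vanishes_on F D"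
      using \<open>x \<in> M\<close> unfolding M_def by blast
    obtain c d where h: "bihom c d F" "bihom c d G'" "\<not> vanishes_on G' D"
      using FG' by (auto simp: fracs_def)
    show ?thesis
    proof (cases "vanishes_on F Z")
      case True
      have "x = frac_class Z D ((\<lambda>_. 0), (\<lambda>_. 1))"
        unfolding x frac_class_eq_iff[OF FG' one_frac[OF Z D DZ]]
        using True unfolding vanishes_on_def by simp
      then have "x = \<zero>\<^bsub>R\<^esub>" by (simp add: R_def local_ring_def)
      then show ?thesis using I.zero_closed by simp
    next
      case False
      obtain k p q p' q' G H where GH: "bihom p q G" "bihom p' q' H" "p + c = k * a + p'" "q + d = k * b + q'"
        "\<not> vanishes_on G D" "\<not> vanishes_on H D"
        and e: "\<And>x y. x \<noteq> 0 \<Longrightarrow> y \<noteq> 0 \<Longrightarrow> pt x y \<in> Z \<Longrightarrow> G (x, y) * F (x, y) = \<pi> (x, y) ^ k * H (x, y)"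
        using uniformizerE[OF u h(1) False] by metis
      have "k \<noteq> 0"
      proof
        assume k: "k = 0"
        have "vanishes_on H D"
        proof (rule vanishes_onI)
          fix x y assume xy: "x \<noteq> 0" "y \<noteq> 0" "pt x y \<in> D"
          then have "pt x y \<in> Z" using DZ by blast
          then show "H (x, y) = 0" using e[of x y] vanishes_onD[OF FD] xy k by simp
        qed
        then show False using GH by simp
      qed
      then obtain l where k: "k = Suc l" using not0_implies_Suc by blast
      \<comment> \<open>\<open>G2\<close> supplies a denominator of the bidegree of \<pi>, so that
        one factor \<pi>\<open>/G2\<close> splits off from the fraction and leaves another element
        of the local ring.\<close>
      obtain G2 where G2: "bihom a b G2" "\<not> vanishes_on G2 D" using ex_nonvanishing_form[OF D] by blast
      have r: "(\<pi>, G2) \<in> fracs D" using \<pi> G2 by (auto simp: fracs_def)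
      have "bihom (a + (l * a + p')) (b + (l * b + q')) (\<lambda>z. G2 z * (\<pi> z ^ l * H z))"
        by (intro bihom_mult bihom_power G2 \<pi> GH)
      moreover have "bihom (p + c) (q + d) (\<lambda>z. G z * G' z)" by (intro bihom_mult GH h)
      moreover have "\<not> vanishes_on (\<lambda>z. G z * G' z) D"
        using vanishes_on_prod[OF D GH(1) h(2)] GH(5) h(3) by blast
      ultimately have s: "(\<lambda>z. G2 z * (\<pi> z ^ l * H z), \<lambda>z. G z * G' z) \<in> fracs D"
        using GH(3,4) k unfolding fracs_def by (auto simp: ac_simps)
      have "x = frac_class Z D (\<pi>, G2) \<otimes>\<^bsub>R\<^esub> frac_class Z D (\<lambda>z. G2 z * (\<pi> z ^ l * H z), \<lambda>z. G z * G' z)"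
        unfolding x cl(1)[OF r s] frac_class_eq_iff[OF FG' fm[OF r s]]
      proof (intro allI impI)
        fix x y assume xy: "x \<noteq> 0" "y \<noteq> 0" "pt x y \<in> Z"
        have "F (x, y) * (G2 (x, y) * (G (x, y) * G' (x, y))) = (G (x, y) * F (x, y)) * (G2 (x, y) * G' (x, y))"
          by (simp only: ac_simps)
        also have "\<dots> = \<pi> (x, y) * (G2 (x, y) * (\<pi> (x, y) ^ l * H (x, y))) * G' (x, y)"
          unfolding e[OF xy] k power_Suc by (simp only: ac_simps)
        finally show "fst (F, G') (x, y) * snd (frac_mult (\<pi>, G2) (\<lambda>z. G2 z * (\<pi> z ^ l * H z), \<lambda>z. G z * G' z)) (x, y)
           = fst (frac_mult (\<pi>, G2) (\<lambda>z. G2 z * (\<pi> z ^ l * H z), \<lambda>z. G z * G' z)) (x, y) * snd (F, G') (x, y)"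
          by (simp add: frac_mult_def)
      qed
      moreover have "frac_class Z D (\<pi>, G2) \<in> Idl\<^bsub>R\<^esub> S" using SI r unfolding S_def by blast
      moreover have "frac_class Z D (\<lambda>z. G2 z * (\<pi> z ^ l * H z), \<lambda>z. G z * G' z) \<in> carrier R"
        unfolding carr using s by blast
      ultimately show ?thesis using I.I_r_closed by simp
    qed
  qed
  have "maximalideal (Idl\<^bsub>R\<^esub> S) R"
  proof (rule maximalidealI[OF I.ideal_axioms])
    show "carrier R \<noteq> Idl\<^bsub>R\<^esub> S"
    proof
      assume "carrier R = Idl\<^bsub>R\<^esub> S"
      then have "\<one>\<^bsub>R\<^esub> \<in> M" using R.one_closed IM by blast
      then have "frac_class Z D ((\<lambda>_. 1), (\<lambda>_. 1)) \<in> M" by (simp only: R_def local_ring_one)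
      then have "vanishes_on (\<lambda>_. 1) D" by (rule mem_M[OF one_frac[OF Z D DZ]])
      then show False using vanishes_on_1[OF D] by simp
    qed
    fix J assume J: "ideal J R" "Idl\<^bsub>R\<^esub> S \<subseteq> J" "J \<subseteq> carrier R"
    show "J = Idl\<^bsub>R\<^esub> S \<or> J = carrier R"
    proof (cases "J \<subseteq> Idl\<^bsub>R\<^esub> S")
      case False
      then obtain x where x: "x \<in> J" "x \<notin> Idl\<^bsub>R\<^esub> S" by blast
      then obtain F G where FG: "x = frac_class Z D (F, G)" "(F, G) \<in> fracs D"
        using J(3) unfolding carr by auto
      have "\<not> vanishes_on F D" using MI x FG unfolding M_def by blast
      then have GF: "(G, F) \<in> fracs D" using FG(2) by (auto simp: fracs_def)
      have "x \<otimes>\<^bsub>R\<^esub> frac_class Z D (G, F) = \<one>\<^bsub>R\<^esub>"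
        unfolding FG(1) cl(1)[OF FG(2) GF] unfolding R_def local_ring_one
        by (rule frac_class_eqI[OF Z D DZ fm[OF FG(2) GF] one_frac[OF Z D DZ]]) (simp add: frac_mult_def)
      moreover have "frac_class Z D (G, F) \<in> carrier R" unfolding carr using GF by blast
      ultimately have "\<one>\<^bsub>R\<^esub> \<in> J" using ideal.I_r_closed[OF J(1) x(1)] by fastforce
      then show ?thesis using ideal.one_imp_carrier[OF J(1)] by blast
    qed (use J in blast)
  qed
  then have "field (R Quot (Idl\<^bsub>R\<^esub> S))"
    by (rule maximalideal.quotient_is_field[OF _ R.is_cring])
  then show ?thesis
    unfolding ord_along_def Let_def R_def[symmetric] S_def[symmetric] by (rule ring_length_field)
qed

end

text \<open>Splits the computation of a divisor into multiplicity one along the listed components,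
  by uniformizers, and the exclusion of all other codimension-one subvarieties on which \<pi>
  vanishes. Where \<pi> does not vanish the order is zero.\<close>

lemma div_form_eq:
  assumes Z: "subvariety Z" and \<pi>: "bihom a b \<pi>" and fin: "finite \<D>"
    and D: "\<And>D. D \<in> \<D> \<Longrightarrow> subvariety D \<and> D \<subseteq> Z \<and> uniformizer a b Z D \<pi>"
    and all: "\<And>D. codim_one D Z \<Longrightarrow> vanishes_on \<pi> D \<Longrightarrow> D \<in> \<D>"
  shows "div_form Z \<pi> = (\<Sum>D\<in>\<D>. frag_of D)"
proof -
  have ord1: "ord_along Z D \<pi> = 1" if "D \<in> \<D>" for D
    using ord_along_uniformizer[OF Z] D[OF that] by blast
  have "{D. codim_one D Z \<and> ord_along Z D \<pi> \<noteq> 0} = \<D>"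
  proof (intro equalityI subsetI)
    fix D' assume "D' \<in> {D. codim_one D Z \<and> ord_along Z D \<pi> \<noteq> 0}"
    then have c: "codim_one D' Z" "ord_along Z D' \<pi> \<noteq> 0" by auto
    then have "subvariety D'" "D' \<subseteq> Z" unfolding codim_one_def by auto
    then have "vanishes_on \<pi> D'"
      using ord_along_eq_0[OF Z _ _ \<pi>, of D'] c(2) by (metis (no_types))
    then show "D' \<in> \<D>" using all c by blast
  next
    fix D' assume "D' \<in> \<D>"
    then show "D' \<in> {D. codim_one D Z \<and> ord_along Z D \<pi> \<noteq> 0}"
      using uniformizer_codim_one[OF Z, of D' a b \<pi>] D[of D'] ord1[of D'] by simp
  qed
  then show ?thesis unfolding div_form_def using ord1 by (auto intro!: sum.cong)
qed

subsection \<open>Uniformizers on bicones\<close>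

text \<open>Charts produce arbitrary polynomial functions \<open>G\<close> and \<open>H\<close>;
  this allows the certificate to be checked with them instead of with forms.\<close>

lemma uniformizer_projI:
  assumes Z: "biconical Z" "integral_set Z" "nondegenerate Z"
    and D: "biconical D" "integral_set D" "nondegenerate D" and DZ: "D \<subseteq> zariski_closure Z"
    and \<pi>: "bihom a b \<pi>" "vanish \<pi> D" "\<not> vanish \<pi> Z"
    and u: "\<And>F. F \<in> poly_funs \<Longrightarrow> \<not> vanish F Z \<Longrightarrow>
      \<exists>k G H. G \<in> poly_funs \<and> H \<in> poly_funs \<and> \<not> vanish G D \<and> \<not> vanish H D \<and>
        (\<forall>z\<in>Z. G z * F z = \<pi> z ^ k * H z)"
  shows "uniformizer a b (proj Z) (proj D) \<pi>"
  unfolding uniformizer_def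
proof (intro conjI allI impI)
  note vZ = vanishes_on_proj[OF Z] and vD = vanishes_on_proj[OF D]
  note p = bihom_pf[OF \<pi>(1)]
  show "bihom a b \<pi>" "vanishes_on \<pi> (proj D)" "\<not> vanishes_on \<pi> (proj Z)"
    using \<pi> vZ vD p by auto
  fix c d F assume F: "bihom c d F" "\<not> vanishes_on F (proj Z)"
  note Fp = bihom_pf[OF F(1)]
  have FZ: "\<not> vanish F Z" using F(2) vZ[OF Fp] by simp
  obtain k G H where GH: "G \<in> poly_funs" "H \<in> poly_funs" "\<not> vanish G D" "\<not> vanish H D"
    "\<forall>z\<in>Z. G z * F z = \<pi> z ^ k * H z" using u[OF Fp FZ] by blast
  have ZD: "vanish Q D" if "Q \<in> poly_funs" "vanish Q Z" for Q
    using that DZ unfolding vanish_closure[OF that(1), of Z, symmetric] by (auto simp: vanish_def)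
  text \<open>Comparing bihomogeneous components turns \<open>G\<close>, \<open>H\<close> into forms.\<close>
  have *: "(if c \<le> i \<and> d \<le> j then F z * bicomp (i - c) (j - d) G z else 0) =
      (if k * a \<le> i \<and> k * b \<le> j then \<pi> z ^ k * bicomp (i - k * a) (j - k * b) H z else 0)"
    if "z \<in> Z" for i j z
  proof -
    let ?E = "\<lambda>z. F z * G z - \<pi> z ^ k * H z"
    have "?E \<in> poly_funs" by (intro pf_closed Fp p GH)
    moreover have "vanish ?E Z" using GH(5) by (simp add: vanish_def mult.commute)
    ultimately have "bicomp i j ?E z = 0" using vanish_bicomp[OF Z(1)] that by (auto simp: vanish_def)
    then show ?thesis
      by (simp add: bicomp_diff bicomp_bihom_mult[OF F(1)] bicomp_bihom_mult[OF bihom_power[OF \<pi>(1)]]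
          pf_closed Fp p GH)
  qed
  \<comment> \<open>The bidegrees of these two components are unrelated so far; the component of
    \<open>H\<close> that pairs with \<open>bicomp i j G\<close> is \<open>?H1\<close>
    below.\<close>
  obtain i j where G1: "\<not> vanish (bicomp i j G) D"
    using GH(1,3) bicomp_all_0 unfolding vanish_def by blast
  obtain r s where H2: "\<not> vanish (bicomp r s H) D"
    using GH(2,4) bicomp_all_0 unfolding vanish_def by blast
  note bG = bicomp_bihom[OF GH(1)] and bH = bicomp_bihom[OF GH(2)]
  note pG = bihom_pf[OF bG] and pH = bihom_pf[OF bH]
  \<comment> \<open>Otherwise the right-hand side has no component in this degree, and integrality
    makes \<open>bicomp i j G\<close> vanish on \<open>Z\<close>, hence on \<open>D\<close>.\<close>
  have le: "k * a \<le> i + c \<and> k * b \<le> j + d"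
  proof (rule ccontr)
    assume n: "\<not> (k * a \<le> i + c \<and> k * b \<le> j + d)"
    have "vanish (bicomp i j G) Z"
      by (rule integral_setD[OF Z(2) Fp pG _ FZ]) (use *[of _ "i + c" "j + d"] n in auto)
    then show False using ZD pG G1 by blast
  qed
  let ?H1 = "bicomp (i + c - k * a) (j + d - k * b) H"
  have e1: "F z * bicomp i j G z = \<pi> z ^ k * ?H1 z" if "z \<in> Z" for z
    using *[OF that, of "i + c" "j + d"] le by simp
  \<comment> \<open>Multiplying the identities for the two bidegrees crosswise and cancelling
    \<open>F\<close> and the power of \<pi> gives
    \<open>?G2 ?H1 = (bicomp i j G) (bicomp r s H)\<close> on \<open>Z\<close>, whose right-hand
    side does not vanish on \<open>D\<close>.\<close>
  have H1: "\<not> vanish ?H1 D"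
  proof
    assume H1: "vanish ?H1 D"
    show False
    proof (cases "c \<le> r + k * a \<and> d \<le> s + k * b")
      case False
      have "vanish (bicomp r s H) Z"
        by (rule integral_setD[OF Z(2) pf_power[OF p] pH, of k])
          (use *[of _ "r + k * a" "s + k * b"] False \<pi>(3) vanish_power in auto)
      then show False using ZD pH H2 by blast
    next
      case True
      let ?G2 = "bicomp (r + k * a - c) (s + k * b - d) G"
      have e2: "F z * ?G2 z = \<pi> z ^ k * bicomp r s H z" if "z \<in> Z" for z
        using *[OF that, of "r + k * a" "s + k * b"] True by simp
      have "vanish (\<lambda>z. ?G2 z * ?H1 z - bicomp i j G z * bicomp r s H z) Z"
      proof (rule integral_setD[OF Z(2) pf_power[OF p, of k]])
        show "(\<lambda>z. ?G2 z * ?H1 z - bicomp i j G z * bicomp r s H z) \<in> poly_funs"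
          by (intro pf_closed pG pH)
        show "\<not> vanish (\<lambda>z. \<pi> z ^ k) Z" using \<pi>(3) vanish_power by blast
        fix z assume z: "z \<in> Z"
        have "\<pi> z ^ k * (?G2 z * ?H1 z - bicomp i j G z * bicomp r s H z) =
          ?G2 z * (\<pi> z ^ k * ?H1 z) - bicomp i j G z * (\<pi> z ^ k * bicomp r s H z)"
          by (simp add: algebra_simps)
        then show "\<pi> z ^ k * (?G2 z * ?H1 z - bicomp i j G z * bicomp r s H z) = 0"
          unfolding e1[OF z, symmetric] e2[OF z, symmetric] by simp
      qed
      then have v: "vanish (\<lambda>z. ?G2 z * ?H1 z - bicomp i j G z * bicomp r s H z) D"
        by (intro ZD pf_closed pG pH)
      have "vanish (bicomp r s H) D"
        by (rule integral_setD[OF D(2) pG pH _ G1]) (use v H1 in \<open>auto simp: vanish_def\<close>)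
      then show False using H2 by blast
    qed
  qed
  have v: "vanishes_on (\<lambda>z. bicomp i j G z * F z - \<pi> z ^ k * ?H1 z) (proj Z)"
    unfolding vZ[OF pf_diff[OF poly_funs.mult[OF pG Fp] poly_funs.mult[OF pf_power[OF p] pH]]]
    using e1 by (simp add: vanish_def mult.commute)
  have nv: "\<not> vanishes_on (bicomp i j G) (proj D)" "\<not> vanishes_on ?H1 (proj D)"
    using G1 H1 vD[OF pG] vD[OF pH] by auto
  show "\<exists>k p q p' q' G H. bihom p q G \<and> bihom p' q' H \<and> p + c = k * a + p' \<and> q + d = k * b + q' \<and>
      \<not> vanishes_on G (proj D) \<and> \<not> vanishes_on H (proj D) \<and>
      vanishes_on (\<lambda>z. G z * F z - \<pi> z ^ k * H z) (proj Z)"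
  proof (rule exI[of _ k], rule exI[of _ i], rule exI[of _ j], rule exI[of _ "i + c - k * a"],
      rule exI[of _ "j + d - k * b"], rule exI[of _ "bicomp i j G"], rule exI[of _ ?H1], intro conjI)
    show "bihom i j (bicomp i j G)" "bihom (i + c - k * a) (j + d - k * b) ?H1" by (fact bG bH)+
    show "i + c = k * a + (i + c - k * a)" "j + d = k * b + (j + d - k * b)" using le by linarith+
  qed (fact nv v)+
qed

end

lemma poly_sum_bound:
  fixes p :: "complex poly"
  assumes "degree p \<le> d" shows "poly p x = (\<Sum>i\<le>d. coeff p i * x ^ i)"
  unfolding poly_altdef
  by (rule sum.mono_neutral_left) (use assms in \<open>auto simp: coeff_eq_0\<close>)

lemma poly_shift_factor:
  fixes p :: "complex poly"
  assumes "\<And>j. j < k \<Longrightarrow> coeff p j = 0" shows "poly p x = x ^ k * poly (poly_shift k p) x"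
proof -
  have "p = monom 1 k * poly_shift k p"
    by (rule poly_eqI) (use assms in \<open>auto simp: coeff_monom_mult coeff_poly_shift\<close>)
  then have "poly p x = poly (monom 1 k * poly_shift k p) x" by simp
  then show ?thesis by (simp add: poly_monom)
qed

lemma fundamental_cycle_simps [simp]:
  "fundamental_cycle {} = 0" "Z \<noteq> {} \<Longrightarrow> fundamental_cycle Z = frag_of Z"
  by (auto simp: fundamental_cycle_def)

context biprojective
begin

subsection \<open>Polynomial curves\<close>

definition poly_curve :: "(complex \<Rightarrow> 'v \<times> 'w) \<Rightarrow> bool" where
  "poly_curve \<gamma> \<longleftrightarrow>
     (\<forall>\<phi>. Vector_Spaces.linear scaleV (*) \<phi> \<longrightarrow> (\<exists>p. \<forall>t. \<phi> (fst (\<gamma> t)) = poly p t)) \<and>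
     (\<forall>\<psi>. Vector_Spaces.linear scaleW (*) \<psi> \<longrightarrow> (\<exists>p. \<forall>t. \<psi> (snd (\<gamma> t)) = poly p t))"

lemma poly_curve_pf:
  assumes "F \<in> poly_funs" "poly_curve \<gamma>" shows "\<exists>p. \<forall>t. F (\<gamma> t) = poly p t"
  using assms(1)
proof induction
  case (const c)
  show ?case by (rule exI[of _ "[:c:]"]) simp
next
  case (add F G)
  then obtain p q where "\<forall>t. F (\<gamma> t) = poly p t" "\<forall>t. G (\<gamma> t) = poly q t" by blast
  then show ?case by (intro exI[of _ "p + q"]) simp
next
  case (mult F G)
  then obtain p q where "\<forall>t. F (\<gamma> t) = poly p t" "\<forall>t. G (\<gamma> t) = poly q t" by blast
  then show ?case by (intro exI[of _ "p * q"]) simp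
qed (use assms(2) in \<open>simp_all add: poly_curve_def\<close>)

lemma poly_curve_closure:
  assumes "poly_curve \<gamma>" "finite A" "\<And>t. t \<notin> A \<Longrightarrow> \<gamma> t \<in> C"
  shows "\<gamma> s \<in> zariski_closure C"
  unfolding zariski_closure_def mem_Collect_eq
proof (intro ballI impI)
  fix F assume F: "F \<in> poly_funs" "\<forall>w\<in>C. F w = 0"
  obtain p where p: "\<forall>t. F (\<gamma> t) = poly p t" using poly_curve_pf[OF F(1) assms(1)] by blast
  have "p = 0" by (rule poly_eq_0_cofinite[OF assms(2)]) (metis F(2) assms(3) p)
  then show "F (\<gamma> s) = 0" using p by simp
qed

text \<open>Join a point with \<open>F \<noteq> 0\<close> to a point with
  \<open>G \<noteq> 0\<close> by a curve. The pullbacks of \<open>F\<close> and \<open>G\<close> are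
  nonzero polynomials in one variable, and so is their product.\<close>

lemma integral_set_curvesI:
  assumes "C \<noteq> {}"
    and "\<And>z w. z \<in> C \<Longrightarrow> w \<in> C \<Longrightarrow>
      \<exists>\<gamma> A. poly_curve \<gamma> \<and> \<gamma> 0 = z \<and> \<gamma> 1 = w \<and> finite A \<and> (\<forall>t. t \<notin> A \<longrightarrow> \<gamma> t \<in> C)"
  shows "integral_set C"
  unfolding integral_set_def
proof (intro conjI ballI impI)
  fix F G assume F: "F \<in> poly_funs" and G: "G \<in> poly_funs" and FG: "vanish (\<lambda>z. F z * G z) C"
  show "vanish F C \<or> vanish G C"
  proof (rule ccontr)
    assume "\<not> (vanish F C \<or> vanish G C)"
    then obtain z w where zw: "z \<in> C" "F z \<noteq> 0" "w \<in> C" "G w \<noteq> 0" unfolding vanish_def by blast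
    obtain \<gamma> A where \<gamma>: "poly_curve \<gamma>" "\<gamma> 0 = z" "\<gamma> 1 = w" "finite A" "\<forall>t. t \<notin> A \<longrightarrow> \<gamma> t \<in> C"
      using assms(2)[OF zw(1,3)] by blast
    obtain p where p: "\<forall>t. F (\<gamma> t) = poly p t" using poly_curve_pf[OF F \<gamma>(1)] by blast
    obtain q where q: "\<forall>t. G (\<gamma> t) = poly q t" using poly_curve_pf[OF G \<gamma>(1)] by blast
    have "p * q = 0"
    proof (rule poly_eq_0_cofinite[OF \<gamma>(4)])
      fix t assume "t \<notin> A"
      then have "F (\<gamma> t) * G (\<gamma> t) = 0" using FG \<gamma>(5) unfolding vanish_def by blast
      then show "poly (p * q) t = 0" using p q by simp
    qed
    moreover have "poly p 0 \<noteq> 0" "poly q 1 \<noteq> 0" using p q \<gamma>(2,3) zw by (metis, metis)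
    ultimately show False by auto
  qed
qed (fact assms(1))

subsection \<open>Charts by families of curves\<close>

text \<open>Polynomials in the parameter \<open>s\<close> over the polynomial functions with
  \<open>g\<close> inverted. The set \<open>T\<close> is where the formulas make sense, because
  division by zero yields zero.\<close>

definition regular_fun ::
    "('v \<times> 'w) set \<Rightarrow> ('v \<times> 'w \<Rightarrow> complex) \<Rightarrow> ('v \<times> 'w \<Rightarrow> complex \<Rightarrow> complex) \<Rightarrow> bool" where
  "regular_fun T g h \<longleftrightarrow> (\<exists>N. \<exists>p\<in>poly_family. \<forall>z\<in>T. \<forall>s. g z ^ N * h z s = poly (p z) s)"

lemma regular_funE:
  assumes "regular_fun T g h"
  obtains N p where "p \<in> poly_family" "\<And>z s. z \<in> T \<Longrightarrow> g z ^ N * h z s = poly (p z) s"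
  using assms unfolding regular_fun_def by blast

lemma regular_funI:
  assumes "p \<in> poly_family" "\<And>z s. z \<in> T \<Longrightarrow> g z ^ N * h z s = poly (p z) s"
  shows "regular_fun T g h"
  using assms unfolding regular_fun_def by blast

lemma regular_fun_pf: "F \<in> poly_funs \<Longrightarrow> regular_fun T g (\<lambda>z s. F z)"
  by (rule regular_funI[OF poly_family_const, of F _ _ 0]) auto

lemma regular_fun_const: "regular_fun T g (\<lambda>z s. c)"
  by (rule regular_fun_pf[OF poly_funs.const])

lemma regular_fun_param: "regular_fun T g (\<lambda>z s. s)"
proof (rule regular_funI[of _ _ _ 0])
  show "(\<lambda>z. [:0, 1:]) \<in> poly_family" by (intro poly_family_pCons poly_family_0 poly_funs.const)
qed simp

lemma regular_fun_cong:
  assumes "regular_fun T g h" "\<And>z s. z \<in> T \<Longrightarrow> h' z s = h z s" shows "regular_fun T g h'"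
  using assms unfolding regular_fun_def by simp

context
  fixes g assumes g: "g \<in> poly_funs"
begin

lemma regular_fun_add:
  assumes "regular_fun T g h" "regular_fun T g h'" shows "regular_fun T g (\<lambda>z s. h z s + h' z s)"
proof -
  obtain p N where p: "p \<in> poly_family" "\<And>z s. z \<in> T \<Longrightarrow> g z ^ N * h z s = poly (p z) s"
    using assms(1) unfolding regular_fun_def by blast
  obtain q M where q: "q \<in> poly_family" "\<And>z s. z \<in> T \<Longrightarrow> g z ^ M * h' z s = poly (q z) s"
    using assms(2) unfolding regular_fun_def by blast
  show ?thesis
  proof (rule regular_funI[of _ _ _ "N + M"])
    show "(\<lambda>z. [:g z ^ M:] * p z + [:g z ^ N:] * q z) \<in> poly_family"
      by (intro poly_family_add poly_family_mult poly_family_const pf_power g p q)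
    fix z s assume z: "z \<in> T"
    have "g z ^ (N + M) * (h z s + h' z s) = g z ^ M * (g z ^ N * h z s) + g z ^ N * (g z ^ M * h' z s)"
      by (simp add: power_add algebra_simps)
    then show "g z ^ (N + M) * (h z s + h' z s) = poly ([:g z ^ M:] * p z + [:g z ^ N:] * q z) s"
      by (simp add: p(2)[OF z] q(2)[OF z])
  qed
qed

lemma regular_fun_mult:
  assumes "regular_fun T g h" "regular_fun T g h'" shows "regular_fun T g (\<lambda>z s. h z s * h' z s)"
proof -
  obtain p N where p: "p \<in> poly_family" "\<And>z s. z \<in> T \<Longrightarrow> g z ^ N * h z s = poly (p z) s"
    using assms(1) unfolding regular_fun_def by blast
  obtain q M where q: "q \<in> poly_family" "\<And>z s. z \<in> T \<Longrightarrow> g z ^ M * h' z s = poly (q z) s"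
    using assms(2) unfolding regular_fun_def by blast
  show ?thesis
  proof (rule regular_funI[of _ _ _ "N + M"])
    show "(\<lambda>z. p z * q z) \<in> poly_family" by (rule poly_family_mult[OF p(1) q(1)])
    fix z s assume z: "z \<in> T"
    have "g z ^ (N + M) * (h z s * h' z s) = (g z ^ N * h z s) * (g z ^ M * h' z s)"
      by (simp add: power_add)
    then show "g z ^ (N + M) * (h z s * h' z s) = poly (p z * q z) s"
      by (simp add: p(2)[OF z] q(2)[OF z])
  qed
qed

lemma regular_fun_uminus: "regular_fun T g h \<Longrightarrow> regular_fun T g (\<lambda>z s. - h z s)"
  using regular_fun_mult[OF regular_fun_const[of T g "-1"], of h] by simp

lemma regular_fun_diff:
  "regular_fun T g h \<Longrightarrow> regular_fun T g h' \<Longrightarrow> regular_fun T g (\<lambda>z s. h z s - h' z s)"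
  using regular_fun_add[OF _ regular_fun_uminus, of T h h'] by simp

lemma regular_fun_sum:
  "(\<And>i. i \<in> I \<Longrightarrow> regular_fun T g (h i)) \<Longrightarrow> regular_fun T g (\<lambda>z s. \<Sum>i\<in>I. h i z s)"
  by (induction I rule: infinite_finite_induct) (auto intro: regular_fun_const regular_fun_add)

lemma regular_fun_divide:
  assumes h: "regular_fun T g h" and q: "q' \<in> poly_funs" "\<And>z. z \<in> T \<Longrightarrow> q z \<noteq> 0 \<and> g z = q z * q' z"
  shows "regular_fun T g (\<lambda>z s. h z s / q z)"
proof -
  obtain p N where p: "p \<in> poly_family" "\<And>z s. z \<in> T \<Longrightarrow> g z ^ N * h z s = poly (p z) s"
    using h unfolding regular_fun_def by blast
  show ?thesis
  proof (rule regular_funI[of _ _ _ "Suc N"])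
    show "(\<lambda>z. [:q' z:] * p z) \<in> poly_family"
      by (intro poly_family_mult poly_family_const q p)
    fix z s assume z: "z \<in> T"
    have "g z ^ Suc N * (h z s / q z) = (g z / q z) * (g z ^ N * h z s)" by simp
    also have "g z / q z = q' z" using q(2)[OF z] by simp
    finally show "g z ^ Suc N * (h z s / q z) = poly ([:q' z:] * p z) s" by (simp add: p(2)[OF z])
  qed
qed

end

definition regular_curves ::
    "('v \<times> 'w) set \<Rightarrow> ('v \<times> 'w \<Rightarrow> complex) \<Rightarrow> ('v \<times> 'w \<Rightarrow> complex \<Rightarrow> 'v \<times> 'w) \<Rightarrow> bool" where
  "regular_curves T g \<gamma> \<longleftrightarrow> g \<in> poly_funs \<and>
     (\<forall>\<phi>. Vector_Spaces.linear scaleV (*) \<phi> \<longrightarrow> regular_fun T g (\<lambda>z s. \<phi> (fst (\<gamma> z s)))) \<and>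
     (\<forall>\<psi>. Vector_Spaces.linear scaleW (*) \<psi> \<longrightarrow> regular_fun T g (\<lambda>z s. \<psi> (snd (\<gamma> z s))))"

lemma regular_curves_pf:
  assumes "F \<in> poly_funs" "regular_curves T g \<gamma>"
  shows "regular_fun T g (\<lambda>z s. F (\<gamma> z s))"
proof -
  have g: "g \<in> poly_funs" using assms(2) by (simp add: regular_curves_def)
  show ?thesis
    using assms(1)
    by induction (use assms(2) g in \<open>auto simp: regular_curves_def
        intro: regular_fun_const regular_fun_add regular_fun_mult\<close>)
qed

lemma poly_family_eval:
  assumes p: "p \<in> poly_family" and u: "u \<in> poly_funs" shows "(\<lambda>z. poly (p z) (u z)) \<in> poly_funs"
proof -
  obtain d where "\<forall>z. degree (p z) \<le> d" using p unfolding poly_family_def by blast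
  then have "(\<lambda>z. poly (p z) (u z)) = (\<lambda>z. \<Sum>i\<le>d. coeff (p z) i * u z ^ i)"
    using poly_sum_bound by blast
  then show ?thesis by (simp add: pf_sum pf_power poly_funs.mult poly_family_coeff p u)
qed

lemma poly_family_shift:
  assumes p: "p \<in> poly_family" shows "(\<lambda>z. poly_shift k (p z)) \<in> poly_family"
proof -
  obtain d where d: "\<forall>z. degree (p z) \<le> d" using p unfolding poly_family_def by blast
  have "degree (poly_shift k (p z)) \<le> d" for z
    by (rule degree_le) (use d in \<open>auto simp: coeff_poly_shift intro!: coeff_eq_0 le_less_trans[OF spec[OF d]]\<close>)
  then have "\<exists>d. \<forall>z. degree (poly_shift k (p z)) \<le> d" by blast
  then show ?thesis using p unfolding poly_family_def by (simp add: coeff_poly_shift)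
qed

text \<open>
  \<open>u\<close> is the parameter on the curves \<open>\<gamma> z\<close>, which start in \<open>D\<close> and sweep out \<open>Z\<close>. Expanding \<open>F\<close>
  along them gives \<open>F\<close> as a power of \<open>u\<close> times a unit at \<open>D\<close>.
\<close>

lemma curve_chart:
  assumes Z: "integral_set Z"
    and \<gamma>: "regular_curves T g \<gamma>"
    and q: "q \<in> poly_funs" "\<not> vanish q Z"
    and pts: "\<And>z. z \<in> Z \<Longrightarrow> q z \<noteq> 0 \<Longrightarrow> z \<in> T \<and> \<gamma> z 0 \<in> D \<and> \<gamma> z 0 \<in> T \<and> g z \<noteq> 0 \<and> g (\<gamma> z 0) \<noteq> 0 \<and>
      \<gamma> z (u z) = z \<and> (\<forall>s. \<gamma> (\<gamma> z 0) s = \<gamma> z s)"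
    and u: "u \<in> poly_funs" "vanish u D" and g: "\<not> vanish g D"
    and F: "F \<in> poly_funs" "\<not> vanish F Z"
  shows "\<exists>k G H. G \<in> poly_funs \<and> H \<in> poly_funs \<and> \<not> vanish G D \<and> \<not> vanish H D \<and>
        (\<forall>z\<in>Z. G z * F z = u z ^ k * H z)"
proof -
  have gp: "g \<in> poly_funs" using \<gamma> by (simp add: regular_curves_def)
  obtain N p where p: "p \<in> poly_family" "\<forall>z\<in>T. \<forall>s. g z ^ N * F (\<gamma> z s) = poly (p z) s"
    using regular_curves_pf[OF F(1) \<gamma>] unfolding regular_fun_def by blast
  \<comment> \<open>\<open>z\<close> and its foot \<gamma>\<open>z 0\<close> lie on the same curve,
    so their expansions agree up to the cleared denominators. A coefficient that vanishes on
    \<open>D\<close> therefore vanishes on the dense part of \<open>Z\<close>.\<close>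
  have proportional: "smult (g z ^ N) (p (\<gamma> z 0)) = smult (g (\<gamma> z 0) ^ N) (p z)"
    if z: "z \<in> Z" "q z \<noteq> 0" for z
  proof (rule poly_all_eq_imp_eq)
    fix s
    show "poly (smult (g z ^ N) (p (\<gamma> z 0))) s = poly (smult (g (\<gamma> z 0) ^ N) (p z)) s"
      using p(2) pts[OF z] by (simp flip: p(2))
  qed
  have coeff0: "coeff (p z) j = 0"
    if v: "vanish (\<lambda>z. coeff (p z) j) D" and z: "z \<in> Z" "q z \<noteq> 0" for z j
  proof -
    have "coeff (smult (g (\<gamma> z 0) ^ N) (p z)) j = 0"
      unfolding proportional[OF z, symmetric] using v pts[OF z] by (simp add: vanish_def)
    then show ?thesis using pts[OF z] by simp
  qed
  have Fz: "g z ^ N * F z = poly (p z) (u z)" if z: "z \<in> Z" "q z \<noteq> 0" for z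
    using p(2) pts[OF z] by metis
  have "\<exists>k. \<not> vanish (\<lambda>z. coeff (p z) k) D"
  proof (rule ccontr)
    assume "\<not> (\<exists>k. \<not> vanish (\<lambda>z. coeff (p z) k) D)"
    then have p0: "p z = 0" if "z \<in> Z" "q z \<noteq> 0" for z
      using coeff0 that by (intro poly_eqI) auto
    have "vanish F Z"
      by (rule integral_setD[OF Z q(1) F(1) _ q(2)]) (metis Fz p0 pts poly_0 mult_eq_0_iff power_not_zero)
    then show False using F(2) by simp
  qed
  \<comment> \<open>The order of \<open>F\<close> along \<open>D\<close>: all lower coefficients
    vanish on \<open>Z\<close>, and the coefficient \<open>k\<close> is the value of the unit
    \<open>H\<close> on \<open>D\<close>.\<close>
  define k where "k = (LEAST k. \<not> vanish (\<lambda>z. coeff (p z) k) D)"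
  have k: "\<not> vanish (\<lambda>z. coeff (p z) k) D"
    unfolding k_def by (rule LeastI_ex) fact
  have j: "vanish (\<lambda>z. coeff (p z) j) D" if "j < k" for j
    using not_less_Least that unfolding k_def by blast
  define H where "H = (\<lambda>z. poly (poly_shift k (p z)) (u z))"
  have H: "H \<in> poly_funs" unfolding H_def by (intro poly_family_eval poly_family_shift p u)
  have "H z = coeff (p z) k" if "z \<in> D" for z
    using u(2) that by (simp add: H_def vanish_def poly_0_coeff_0 coeff_poly_shift)
  then have HD: "\<not> vanish H D" using k by (simp add: vanish_def)
  have "vanish (\<lambda>z. g z ^ N * F z - u z ^ k * H z) Z"
  proof (rule integral_setD[OF Z q(1) _ _ q(2)])
    show "(\<lambda>z. g z ^ N * F z - u z ^ k * H z) \<in> poly_funs" by (intro pf_closed gp F u H)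
    fix z assume z: "z \<in> Z"
    show "q z * (g z ^ N * F z - u z ^ k * H z) = 0"
    proof (cases "q z = 0")
      case False
      have "poly (p z) (u z) = u z ^ k * H z"
        unfolding H_def by (rule poly_shift_factor) (use coeff0 j z False in blast)
      then show ?thesis using Fz[OF z False] by simp
    qed simp
  qed
  then have "\<forall>z\<in>Z. g z ^ N * F z = u z ^ k * H z" by (simp add: vanish_def)
  moreover have "\<not> vanish (\<lambda>z. g z ^ N) D" using g vanish_power by blast
  moreover have "(\<lambda>z. g z ^ N) \<in> poly_funs" by (rule pf_power[OF gp])
  ultimately show ?thesis using H HD by blast
qed

lemma closureD: "z \<in> zariski_closure C \<Longrightarrow> F \<in> poly_funs \<Longrightarrow> vanish F C \<Longrightarrow> F z = 0"
  unfolding zariski_closure_def vanish_def by blast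

lemma closureI: "(\<And>F. F \<in> poly_funs \<Longrightarrow> vanish F C \<Longrightarrow> F z = 0) \<Longrightarrow> z \<in> zariski_closure C"
  unfolding zariski_closure_def vanish_def by blast

lemma integral_set_mult:
  assumes "integral_set C" "F \<in> poly_funs" "G \<in> poly_funs" "vanish (\<lambda>z. F z * G z) C"
  shows "vanish F C \<or> vanish G C"
  using assms unfolding integral_set_def by blast

lemma proj_degenerate:
  assumes "\<not> nondegenerate C" shows "proj C = {}"
proof -
  have False if xy: "x \<noteq> 0" "y \<noteq> 0" "(x, y) \<in> zariski_closure C" for x y
  proof -
    obtain \<phi> where \<phi>: "Vector_Spaces.linear scaleV (*) \<phi>" "\<phi> x = 1"
      using ex_linear_functional_nonzero[OF V.vector_space_axioms xy(1)] by blast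
    obtain \<psi> where \<psi>: "Vector_Spaces.linear scaleW (*) \<psi>" "\<psi> y = 1"
      using ex_linear_functional_nonzero[OF W.vector_space_axioms xy(2)] by blast
    let ?F = "\<lambda>z. \<phi> (fst z) * \<psi> (snd z)"
    have F: "?F \<in> poly_funs" by (intro pf_closed \<phi> \<psi>)
    have "vanish ?F C"
      unfolding vanish_def
    proof
      fix z assume "z \<in> C"
      then have "fst z = 0 \<or> snd z = 0" using assms unfolding nondegenerate_def by (metis prod.collapse)
      then show "?F z = 0" using linear_functional_simps(3)[OF \<phi>(1)] linear_functional_simps(3)[OF \<psi>(1)] by auto
    qed
    then have "vanish ?F (zariski_closure C)" using vanish_closure[OF F] by simp
    then have "?F (x, y) = 0" using xy(3) unfolding vanish_def by blast
    then show False using \<phi> \<psi> by simp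
  qed
  then show ?thesis unfolding proj_def proj_image_def by blast
qed

lemma uniformizer_subset_proper:
  assumes "uniformizer a b Z D \<pi>" "D \<subseteq> Z" shows "D \<subset> Z"
  using assms unfolding uniformizer_def by blast

lemma codim_one_eqI:
  assumes "codim_one D Z" "subvariety Y" "D \<subseteq> Y" "Y \<subset> Z" shows "D = Y"
  using assms unfolding codim_one_def by blast

subsection \<open>Linear sections of cones\<close>

text \<open>Translation by \<open>(e1, e2)\<close> splits \<open>C\<close> as a product of its zero
  locus of \<psi> with a line on which \<psi> is the coordinate. Hence the section is integral,
  \<psi> is a uniformizer along it, and no other component occurs.\<close>

lemma cone_section:
  assumes C: "biconical C" "integral_set C" "nondegenerate C" and \<psi>: "bihom a b \<psi>"
    and \<psi>e: "\<And>x y s. \<psi> (x + scaleV s e1, y + scaleW s e2) = \<psi> (x, y) + s"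
    and Ce: "\<And>x y s. (x, y) \<in> C \<Longrightarrow> (x + scaleV s e1, y + scaleW s e2) \<in> C"
  shows "\<not> vanishes_on \<psi> (proj C)"
    and "div_form (proj C) \<psi> = fundamental_cycle (proj {z\<in>C. \<psi> z = 0})"
    and "integral_set {z\<in>C. \<psi> z = 0}" and "biconical {z\<in>C. \<psi> z = 0}"
proof -
  define D where "D = {z\<in>C. \<psi> z = 0}"
  define \<gamma> where "\<gamma> z s = (fst z + scaleV (s - \<psi> z) e1, snd z + scaleW (s - \<psi> z) e2)" for z s
  have p: "\<psi> \<in> poly_funs" by (rule bihom_pf[OF \<psi>])
  have \<psi>\<gamma>: "\<psi> (\<gamma> z s) = s" for z s by (simp add: \<gamma>_def \<psi>e)
  have \<gamma>C: "\<gamma> z s \<in> C" if "z \<in> C" for z s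
    using Ce[of "fst z" "snd z"] that by (simp add: \<gamma>_def)
  have \<gamma>\<psi>: "\<gamma> z (\<psi> z) = z" for z by (simp add: \<gamma>_def)
  have \<gamma>\<gamma>: "\<gamma> (\<gamma> z s) t = \<gamma> z t" for z s t
  proof -
    have "\<gamma> (\<gamma> z s) t = (fst (\<gamma> z s) + scaleV (t - s) e1, snd (\<gamma> z s) + scaleW (t - s) e2)"
      by (simp only: \<gamma>_def[of "\<gamma> z s" t] \<psi>\<gamma>)
    then show ?thesis
      by (simp add: \<gamma>_def V.scale_left_diff_distrib W.scale_left_diff_distrib algebra_simps)
  qed
  have reg: "regular_curves UNIV (\<lambda>_. 1) \<gamma>"
    unfolding regular_curves_def
  proof (intro conjI allI impI)
    show "(\<lambda>_. 1) \<in> poly_funs" by (rule poly_funs.const)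
    have \<psi>': "regular_fun UNIV (\<lambda>_. 1) (\<lambda>z s. (s - \<psi> z) * c)" for c
      by (intro regular_fun_mult regular_fun_diff regular_fun_param regular_fun_pf p poly_funs.const)
    fix \<phi> assume \<phi>: "Vector_Spaces.linear scaleV (*) \<phi>"
    show "regular_fun UNIV (\<lambda>_. 1) (\<lambda>z s. \<phi> (fst (\<gamma> z s)))"
      unfolding \<gamma>_def fst_conv linear_functional_simps[OF \<phi>]
      by (intro regular_fun_add \<psi>' regular_fun_pf poly_funs.fst \<phi> poly_funs.const)
  next
    have \<psi>': "regular_fun UNIV (\<lambda>_. 1) (\<lambda>z s. (s - \<psi> z) * c)" for c
      by (intro regular_fun_mult regular_fun_diff regular_fun_param regular_fun_pf p poly_funs.const)
    fix \<phi> assume \<phi>: "Vector_Spaces.linear scaleW (*) \<phi>"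
    show "regular_fun UNIV (\<lambda>_. 1) (\<lambda>z s. \<phi> (snd (\<gamma> z s)))"
      unfolding \<gamma>_def snd_conv linear_functional_simps[OF \<phi>]
      by (intro regular_fun_add \<psi>' regular_fun_pf poly_funs.snd \<phi> poly_funs.const)
  qed
  \<comment> \<open>Composition with the retraction of \<open>C\<close> onto \<open>D\<close> keeps
    functions polynomial; this transfers integrality to \<open>D\<close> and closure points of
    \<open>C\<close> with \<psi>\<open>= 0\<close> to the closure of \<open>D\<close>.\<close>
  have pull: "(\<lambda>z. F (\<gamma> z 0)) \<in> poly_funs" if F: "F \<in> poly_funs" for F
  proof -
    obtain q where q: "q \<in> poly_family" "\<forall>z s. F (\<gamma> z s) = poly (q z) s"
      using regular_curves_pf[OF F reg] by (auto elim: regular_funE)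
    then have "(\<lambda>z. F (\<gamma> z 0)) = (\<lambda>z. coeff (q z) 0)" by (simp add: poly_0_coeff_0)
    then show ?thesis using poly_family_coeff[OF q(1)] by simp
  qed
  have \<gamma>D: "\<gamma> z 0 \<in> D" if "z \<in> C" for z using \<gamma>C[OF that] \<psi>\<gamma> by (simp add: D_def)
  have D\<gamma>: "\<gamma> z 0 = z" if "\<psi> z = 0" for z using \<gamma>\<psi>[of z] that by simp
  obtain z0 where z0: "z0 \<in> C" using C(2) by (auto simp: integral_set_def)
  have D: "integral_set D"
    unfolding integral_set_def
  proof (intro conjI ballI impI)
    show "D \<noteq> {}" using \<gamma>D[OF z0] by blast
    fix F G assume FG: "F \<in> poly_funs" "G \<in> poly_funs" "vanish (\<lambda>z. F z * G z) D"
    have "vanish (\<lambda>z. F (\<gamma> z 0) * G (\<gamma> z 0)) C"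
      using FG(3) \<gamma>D unfolding vanish_def by blast
    then have "vanish (\<lambda>z. F (\<gamma> z 0)) C \<or> vanish (\<lambda>z. G (\<gamma> z 0)) C"
      by (rule integral_set_mult[OF C(2) pull[OF FG(1)] pull[OF FG(2)]])
    moreover have "vanish F D" if "vanish (\<lambda>z. F (\<gamma> z 0)) C" for F
      using that D\<gamma> by (auto simp: vanish_def D_def)
    ultimately show "vanish F D \<or> vanish G D" by blast
  qed
  then show "integral_set {z\<in>C. \<psi> z = 0}" by (simp add: D_def)
  have Db: "biconical D"
    using C(1) bihom_scale[OF \<psi>] unfolding biconical_def D_def by simp
  then show "biconical {z\<in>C. \<psi> z = 0}" by (simp add: D_def)
  have \<psi>C: "\<not> vanish \<psi> C" using \<gamma>C[OF z0, of 1] \<psi>\<gamma>[of z0 1] unfolding vanish_def by (metis zero_neq_one)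
  then show \<psi>Z: "\<not> vanishes_on \<psi> (proj C)" using vanishes_on_proj[OF C p] by simp
  have Z: "subvariety (proj C)" by (rule subvariety_proj[OF C])
  have sub: "D \<subseteq> zariski_closure C" using closure_subset[of C] by (auto simp: D_def)
  have DC: "proj D \<subseteq> proj C" by (rule proj_mono[OF sub])
  have unif: "uniformizer a b (proj C) (proj D) \<psi>" if nd: "nondegenerate D"
  proof (rule uniformizer_projI[OF C Db D nd sub \<psi> _ \<psi>C])
    show "vanish \<psi> D" by (simp add: vanish_def D_def)
    fix F assume F: "F \<in> poly_funs" "\<not> vanish F C"
    show "\<exists>k G H. G \<in> poly_funs \<and> H \<in> poly_funs \<and> \<not> vanish G D \<and> \<not> vanish H D \<and>
        (\<forall>z\<in>C. G z * F z = \<psi> z ^ k * H z)"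
    proof (rule curve_chart[OF C(2) reg poly_funs.const[of 1] _ _ p _ _ F])
      show "\<not> vanish (\<lambda>_. 1) C" "\<not> vanish (\<lambda>_. 1) D"
        using z0 \<gamma>D[OF z0] unfolding vanish_def by (metis one_neq_zero)+
      show "vanish \<psi> D" by (simp add: vanish_def D_def)
    qed (auto simp: \<gamma>\<gamma> \<gamma>\<psi> \<gamma>D)
  qed
  have inD: "D' \<subseteq> proj D" if D': "D' \<subseteq> proj C" "subvariety D'" "vanishes_on \<psi> D'" for D'
  proof
    fix pp assume pp: "pp \<in> D'"
    then obtain x y where xy: "pp = pt x y" "x \<noteq> 0" "y \<noteq> 0"
      using D'(2) unfolding subvariety_def closed_set_def proj_image_def by auto
    have cl: "(x, y) \<in> zariski_closure C" using pt_in_proj[OF C(1) xy(2,3)] D'(1) pp xy(1) by blast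
    have \<psi>0: "\<psi> (x, y) = 0" using vanishes_onD[OF D'(3) xy(2,3)] pp xy(1) by simp
    have "F (x, y) = 0" if F: "F \<in> poly_funs" "vanish F D" for F
    proof -
      have "vanish (\<lambda>z. F (\<gamma> z 0)) C" using F(2) \<gamma>D by (simp add: vanish_def)
      then have "F (\<gamma> (x, y) 0) = 0" using closureD[OF cl pull[OF F(1)]] by simp
      then show ?thesis using D\<gamma>[OF \<psi>0] by simp
    qed
    then have "(x, y) \<in> zariski_closure D" by (rule closureI)
    then show "pp \<in> proj D" using pt_in_proj[OF Db xy(2,3)] xy(1) by simp
  qed
  have "div_form (proj C) \<psi> = fundamental_cycle (proj D)"
  proof (cases "nondegenerate D")
    case True
    have sD: "subvariety (proj D)" by (rule subvariety_proj[OF Db D True])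
    have "div_form (proj C) \<psi> = (\<Sum>D\<in>{proj D}. frag_of D)"
    proof (rule div_form_eq[OF Z \<psi>])
      show "finite {proj D}" by simp
      fix D' show "D' \<in> {proj D} \<Longrightarrow> subvariety D' \<and> D' \<subseteq> proj C \<and> uniformizer a b (proj C) D' \<psi>"
        using sD DC unif[OF True] by simp
      assume D': "codim_one D' (proj C)" "vanishes_on \<psi> D'"
      then have "D' \<subseteq> proj D" by (intro inD) (auto simp: codim_one_def)
      then have "D' = proj D"
        using codim_one_eqI[OF D'(1) sD] uniformizer_subset_proper[OF unif[OF True] DC] by blast
      then show "D' \<in> {proj D}" by simp
    qed
    then show ?thesis using proj_nonempty[OF True] by simp
  next
    \<comment> \<open>The section is empty in the product of projective spaces, so no component
      exists and both sides are zero.\<close>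
    case False
    have "div_form (proj C) \<psi> = (\<Sum>D\<in>{}. frag_of D)"
    proof (rule div_form_eq[OF Z \<psi>])
      fix D' assume D': "codim_one D' (proj C)" "vanishes_on \<psi> D'"
      then have "D' \<subseteq> proj D" by (intro inD) (auto simp: codim_one_def)
      then have "D' = {}" using proj_degenerate[OF False] by simp
      then show "D' \<in> {}" using D'(1) by (simp add: codim_one_def subvariety_def)
    qed auto
    then show ?thesis using proj_degenerate[OF False] by simp
  qed
  then show "div_form (proj C) \<psi> = fundamental_cycle (proj {z\<in>C. \<psi> z = 0})" by (simp add: D_def)
qed

subsection \<open>Rational equivalence\<close>

text \<open>Only the difference has to be a cycle, so relations can be added and chained freely;
  membership in the cycle group is checked once, in \<open>chow_class_eqI\<close>.\<close>

definition rat_eq :: "(('v set \<times> 'w set) set \<Rightarrow>\<^sub>0 int) \<Rightarrow> (('v set \<times> 'w set) set \<Rightarrow>\<^sub>0 int) \<Rightarrow> bool" where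
  "rat_eq c c' \<longleftrightarrow> c - c' \<in> rat_equiv_zero"

lemma cycle_group_simps [simp]: "c \<otimes>\<^bsub>cycle_group\<^esub> c' = c + c'" "\<one>\<^bsub>cycle_group\<^esub> = 0"
  by (simp_all add: cycle_group_def free_Abelian_group_def)

lemma cycle_group_inv [simp]: "c \<in> carrier cycle_group \<Longrightarrow> inv\<^bsub>cycle_group\<^esub> c = - c"
  by (simp add: cycle_group_def)

lemma rat_subgroup: "subgroup rat_equiv_zero cycle_group"
  using rat_equiv_zero_normal by (rule normal_imp_subgroup)

lemma rat_eq_refl [simp]: "rat_eq c c"
  using subgroup.one_closed[OF rat_subgroup] by (simp add: rat_eq_def)

lemma rat_eq_sym: "rat_eq c c' \<Longrightarrow> rat_eq c' c"
  using subgroup.m_inv_closed[OF rat_subgroup, of "c - c'"] subgroup.mem_carrier[OF rat_subgroup, of "c - c'"]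
  by (simp add: rat_eq_def)

lemma rat_eq_add: "rat_eq c c' \<Longrightarrow> rat_eq d d' \<Longrightarrow> rat_eq (c + d) (c' + d')"
  using subgroup.m_closed[OF rat_subgroup, of "c - c'" "d - d'"] by (simp add: rat_eq_def algebra_simps)

lemma rat_eq_trans [trans]: "rat_eq c c' \<Longrightarrow> rat_eq c' c'' \<Longrightarrow> rat_eq c c''"
  using subgroup.m_closed[OF rat_subgroup, of "c - c'" "c' - c''"] by (simp add: rat_eq_def)

lemma rat_eq_div_form:
  assumes "subvariety Z" "bihom a b F" "bihom a b G" "\<not> vanishes_on F Z" "\<not> vanishes_on G Z"
  shows "rat_eq (div_form Z F) (div_form Z G)"
  unfolding rat_eq_def rat_equiv_zero_def by (rule generate.incl) (use assms in blast)

lemma chow_class_eqI: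
  assumes "c \<in> carrier cycle_group" "rat_eq c c'" shows "chow_class c = chow_class c'"
proof -
  interpret group cycle_group
    unfolding cycle_group_def by (rule comm_group.axioms(2)[OF abelian_free_Abelian_group])
  have "c' - c \<in> rat_equiv_zero" using rat_eq_sym[OF assms(2)] by (simp add: rat_eq_def)
  then have "c' \<in> rat_equiv_zero #>\<^bsub>cycle_group\<^esub> c"
    unfolding r_coset_def by force
  then show ?thesis
    unfolding chow_class_def using repr_independence assms(1) rat_subgroup by blast
qed

lemma fundamental_cycle_carrier:
  assumes "biconical C" "integral_set C"
  shows "fundamental_cycle (proj C) \<in> carrier cycle_group"
proof (cases "nondegenerate C")
  case True
  then show ?thesis
    using subvariety_proj[OF assms True] proj_nonempty[OF True] by (simp add: cycle_group_def)
next
  case False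
  then show ?thesis using proj_degenerate by (simp add: cycle_group_def)
qed

end

section \<open>Hyperplane sections of subspaces, and exchange of basis vectors\<close>

lemma span_insert_Int_kernel:
  fixes s :: "complex \<Rightarrow> 'a::ab_group_add \<Rightarrow> 'a"
  assumes V: "vector_space s" and A: "module.subspace s A" and \<phi>: "Vector_Spaces.linear s (*) \<phi>"
    and 0: "\<And>x. x \<in> A \<Longrightarrow> \<phi> x = 0" and 1: "\<phi> a = 1"
  shows "module.span s (insert a A) \<inter> {x. \<phi> x = 0} = A"
proof -
  interpret V: vector_space s by fact
  have "x \<in> A" if x: "x \<in> V.span (insert a A)" and x0: "\<phi> x = 0" for x
  proof -
    obtain k where k: "x - s k a \<in> V.span A" using x unfolding V.span_insert by blast
    then have "x - s k a \<in> A" unfolding V.span_eq_iff[THEN iffD2, OF A] .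
    moreover from 0[OF this] have "k = 0"
      using x0 1 by (simp add: linear_functional_simps[OF \<phi>])
    ultimately show ?thesis by simp
  qed
  then show ?thesis using 0 V.span_superset[of "insert a A"] by auto
qed

lemma span_insert_kernel_eq:
  fixes s :: "complex \<Rightarrow> 'a::ab_group_add \<Rightarrow> 'a"
  assumes V: "vector_space s" and A: "module.subspace s A" and \<phi>: "Vector_Spaces.linear s (*) \<phi>"
    and a: "a \<in> A" "\<phi> a = 1"
  shows "module.subspace s (A \<inter> {x. \<phi> x = 0})" "module.span s (insert a (A \<inter> {x. \<phi> x = 0})) = A"
proof -
  interpret V: vector_space s by fact
  show sub: "V.subspace (A \<inter> {x. \<phi> x = 0})"
    using A by (auto simp: V.subspace_def linear_functional_simps[OF \<phi>])
  show "V.span (insert a (A \<inter> {x. \<phi> x = 0})) = A"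
  proof
    show "V.span (insert a (A \<inter> {x. \<phi> x = 0})) \<subseteq> A"
      by (rule V.span_minimal) (use a A in auto)
    show "A \<subseteq> V.span (insert a (A \<inter> {x. \<phi> x = 0}))"
    proof
      fix x assume x: "x \<in> A"
      have "x - s (\<phi> x) a \<in> A \<inter> {x. \<phi> x = 0}"
        using x a A by (auto simp: linear_functional_simps[OF \<phi>] intro: V.subspace_diff V.subspace_scale)
      from V.span_base[OF this] show "x \<in> V.span (insert a (A \<inter> {x. \<phi> x = 0}))"
        unfolding V.span_insert by blast
    qed
  qed
qed

lemma dim_kernel_section:
  fixes s :: "complex \<Rightarrow> 'a::ab_group_add \<Rightarrow> 'a"
  assumes V: "finite_dimensional_vector_space s Bs" and A: "module.subspace s A"
    and \<phi>: "Vector_Spaces.linear s (*) \<phi>" and a: "a \<in> A" "\<phi> a = 1"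
  shows "Suc (vector_space.dim s (A \<inter> {x. \<phi> x = 0})) = vector_space.dim s A"
proof -
  interpret V: finite_dimensional_vector_space s Bs by fact
  note * = span_insert_kernel_eq[OF V.vector_space_axioms A \<phi> a]
  have "a \<notin> V.span (A \<inter> {x. \<phi> x = 0})" unfolding V.span_eq_iff[THEN iffD2, OF *(1)] using a by simp
  then have "V.dim (insert a (A \<inter> {x. \<phi> x = 0})) = V.dim (A \<inter> {x. \<phi> x = 0}) + 1"
    by (simp add: V.dim_insert)
  then show ?thesis using *(2) V.dim_span[of "insert a (A \<inter> {x. \<phi> x = 0})"] by simp
qed

text \<open>Subspaces of equal dimension are connected by exchanging one basis vector at a time.\<close>

lemma equal_dim_induct:
  fixes s :: "complex \<Rightarrow> 'a::ab_group_add \<Rightarrow> 'a"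
  assumes V: "finite_dimensional_vector_space s Bs"
    and sub: "module.subspace s A" "module.subspace s A'"
    and dim: "vector_space.dim s A = vector_space.dim s A'"
    and refl: "\<And>A. R A A" and trans: "\<And>A B C. R A B \<Longrightarrow> R B C \<Longrightarrow> R A C"
    and step: "\<And>A a a'. module.subspace s A \<Longrightarrow> a \<notin> A \<Longrightarrow> a' \<notin> A \<Longrightarrow>
      R (module.span s (insert a A)) (module.span s (insert a' A))"
  shows "R A A'"
  using sub(1) dim
proof (induction "vector_space.dim s A - vector_space.dim s (A \<inter> A')" arbitrary: A rule: less_induct)
  case less
  interpret V: finite_dimensional_vector_space s Bs by fact
  show ?case
  proof (cases "A \<subseteq> A'")
    case True
    then have "A = A'" using V.subspace_dim_equal[OF less(2) sub(2)] less(3) by simp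
    then show ?thesis using refl by simp
  next
    case False
    then obtain a where a: "a \<in> A" "a \<notin> A'" by blast
    have "\<not> A' \<subseteq> A" using V.subspace_dim_equal[OF sub(2) less(2)] less(3) False by auto
    then obtain a' where a': "a' \<in> A'" "a' \<notin> A" by blast
    have I: "V.subspace (A \<inter> A')" using less(2) sub(2) by (rule V.subspace_inter)
    \<comment> \<open>The kernel \<open>A0\<close> of \<phi> is a hyperplane of \<open>A\<close>
      that contains \<open>A \<inter> A'\<close> but not \<open>a\<close>. Replacing
      \<open>a\<close> by \<open>a'\<close> keeps the dimension and enlarges the intersection with
      \<open>A'\<close>.\<close>
    obtain \<phi> where \<phi>: "Vector_Spaces.linear s (*) \<phi>" "\<forall>x\<in>A \<inter> A'. \<phi> x = 0" "\<phi> a = 1"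
      using ex_linear_functional[OF V.vector_space_axioms I, of a] a by blast
    define A0 where "A0 = A \<inter> {x. \<phi> x = 0}"
    note A0 = span_insert_kernel_eq[OF V.vector_space_axioms less(2) \<phi>(1) a(1) \<phi>(3), folded A0_def]
    have aA0: "a \<notin> A0" "a' \<notin> A0" using \<phi>(3) a' by (auto simp: A0_def)
    define A2 where "A2 = V.span (insert a' A0)"
    have A2: "V.subspace A2" unfolding A2_def by simp
    have dims: "V.dim (insert b A0) = V.dim A0 + 1" if "b \<notin> A0" for b
      using that unfolding V.dim_insert V.span_eq_iff[THEN iffD2, OF A0(1)] by simp
    have dA: "V.dim A = V.dim A0 + 1" using dims[OF aA0(1)] A0(2) V.dim_span[of "insert a A0"] by simp
    have d2: "V.dim A2 = V.dim A0 + 1" using dims[OF aA0(2)] unfolding A2_def by simp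
    have "insert a' (A \<inter> A') \<subseteq> A2 \<inter> A'"
      using \<phi>(2) a' V.span_base[of _ "insert a' A0"] by (auto simp: A2_def A0_def)
    then have "V.dim (insert a' (A \<inter> A')) \<le> V.dim (A2 \<inter> A')" by (rule V.dim_subset)
    moreover have "a' \<notin> V.span (A \<inter> A')" unfolding V.span_eq_iff[THEN iffD2, OF I] using a' by simp
    ultimately have lt: "V.dim (A \<inter> A') < V.dim (A2 \<inter> A')" by (simp add: V.dim_insert)
    have le: "V.dim (A2 \<inter> A') \<le> V.dim A2" by (rule V.dim_subset) simp
    have "R A2 A'"
      by (rule less(1)[OF _ A2]) (use lt le dA d2 less(3) in auto)
    moreover have "R A A2" using step[OF A0(1) aA0] unfolding A0(2) A2_def .
    ultimately show ?thesis using trans by blast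
  qed
qed

text \<open>Different subspaces that exchange one basis vector are both hyperplanes of their sum
  \<open>T\<close>. Each is the zero locus on \<open>T\<close> of a linear form, and two such forms
  give a rational function relating the sections.\<close>

lemma pencil_induct:
  fixes s :: "complex \<Rightarrow> 'a::ab_group_add \<Rightarrow> 'a"
  assumes V: "finite_dimensional_vector_space s Bs"
    and sub: "module.subspace s A" "module.subspace s A'"
    and dim: "vector_space.dim s A = vector_space.dim s A'"
    and refl: "\<And>A. R A A" and trans: "\<And>A B C. R A B \<Longrightarrow> R B C \<Longrightarrow> R A C"
    and pencil: "\<And>T \<phi> \<phi>' e e'. module.subspace s T \<Longrightarrow>
      Vector_Spaces.linear s (*) \<phi> \<Longrightarrow> e \<in> T \<Longrightarrow> \<phi> e = 1 \<Longrightarrow>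
      Vector_Spaces.linear s (*) \<phi>' \<Longrightarrow> e' \<in> T \<Longrightarrow> \<phi>' e' = 1 \<Longrightarrow>
      R (T \<inter> {x. \<phi> x = 0}) (T \<inter> {x. \<phi>' x = 0})"
  shows "R A A'"
proof (rule equal_dim_induct[OF V sub dim])
  interpret V: finite_dimensional_vector_space s Bs by fact
  fix A a a' assume A: "V.subspace A" "a \<notin> A" "a' \<notin> A"
  define S S' where "S = V.span (insert a A)" and "S' = V.span (insert a' A)"
  have S: "V.subspace S" "V.subspace S'" by (simp_all add: S_def S'_def)
  have AS: "insert a A \<subseteq> S" "insert a' A \<subseteq> S'" unfolding S_def S'_def by (rule V.span_superset)+
  have nspan: "a \<notin> V.span A" "a' \<notin> V.span A"
    unfolding V.span_eq_iff[THEN iffD2, OF A(1)] using A(2,3) by simp_all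
  show "R (V.span (insert a A)) (V.span (insert a' A))"
    unfolding S_def[symmetric] S'_def[symmetric]
  proof (cases "a' \<in> S")
    case True
    then have "a \<in> S'" using V.in_span_insert[of a' a A] nspan by (simp add: S_def S'_def)
    then have "S = S'" using True AS unfolding S_def S'_def V.span_eq by blast
    then show "R S S'" using refl by simp
  next
    case False
    then have aS': "a \<notin> S'" using V.in_span_insert[of a a' A] nspan by (auto simp: S_def S'_def)
    define T where "T = V.span (insert a' S)"
    have T: "V.subspace T" by (simp add: T_def)
    have "S \<subseteq> V.span (insert a S')" unfolding S_def
      by (rule V.span_minimal) (use AS(2) V.span_superset[of "insert a S'"] in auto)
    moreover have "S' \<subseteq> V.span (insert a' S)" unfolding S'_def
      by (rule V.span_minimal) (use AS(1) V.span_superset[of "insert a' S"] in auto)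
    ultimately have "insert a' S \<subseteq> V.span (insert a S')" "insert a S' \<subseteq> V.span (insert a' S)"
      using AS V.span_superset[of "insert a S'"] V.span_superset[of "insert a' S"] by auto
    then have T': "T = V.span (insert a S')" unfolding T_def V.span_eq by blast
    obtain \<phi> where \<phi>: "Vector_Spaces.linear s (*) \<phi>" "\<forall>x\<in>S. \<phi> x = 0" "\<phi> a' = 1"
      using ex_linear_functional[OF V.vector_space_axioms S(1) False] by blast
    obtain \<phi>' where \<phi>': "Vector_Spaces.linear s (*) \<phi>'" "\<forall>x\<in>S'. \<phi>' x = 0" "\<phi>' a = 1"
      using ex_linear_functional[OF V.vector_space_axioms S(2) aS'] by blast
    have k: "T \<inter> {x. \<phi> x = 0} = S" unfolding T_def
      by (rule span_insert_Int_kernel[OF V.vector_space_axioms S(1) \<phi>(1) _ \<phi>(3)]) (use \<phi>(2) in blast)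
    have k': "T \<inter> {x. \<phi>' x = 0} = S'" unfolding T'
      by (rule span_insert_Int_kernel[OF V.vector_space_axioms S(2) \<phi>'(1) _ \<phi>'(3)]) (use \<phi>'(2) in blast)
    have "a' \<in> T" "a \<in> T" unfolding T_def using V.span_superset[of "insert a' S"] AS by auto
    then show "R S S'" using pencil[OF T \<phi>(1) _ \<phi>(3) \<phi>'(1) _ \<phi>'(3)] unfolding k k' by blast
  qed
qed (fact refl trans)+

lemma linear_functionalI:
  fixes s :: "complex \<Rightarrow> 'a::ab_group_add \<Rightarrow> 'a"
  assumes "vector_space s" "\<And>x y. \<phi> (x + y) = \<phi> x + \<phi> y" "\<And>c x. \<phi> (s c x) = c * \<phi> x"
  shows "Vector_Spaces.linear s (*) \<phi>"
proof -
  interpret V: vector_space s by fact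
  show ?thesis by unfold_locales (use assms in \<open>auto simp: algebra_simps\<close>)
qed

context biprojective
begin

subsection \<open>Linear forms\<close>

text \<open>For products this is the Leibniz rule: the linear coefficient involves the values at
  \<open>(0, y)\<close>, which do not depend on \<open>x\<close>.\<close>

lemma vcomp_1_add:
  assumes "F \<in> poly_funs"
  shows "vcomp 1 F (x + x', y) = vcomp 1 F (x, y) + vcomp 1 F (x', y)"
  using assms
proof induction
  case (const c)
  have "vpoly (\<lambda>_. c) z = [:c:]" for z by (rule vpoly_eqI) simp
  then show ?case by (simp add: vcomp_def)
next
  case (fst \<phi>)
  have "vpoly (\<lambda>z. \<phi> (fst z)) z = [:0, \<phi> (fst z):]" for z
    by (rule vpoly_eqI) (simp add: linear_functional_simps[OF fst])
  then show ?case by (simp add: vcomp_def linear_functional_simps[OF fst])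
next
  case (snd \<psi>)
  have "vpoly (\<lambda>z. \<psi> (snd z)) z = [:\<psi> (snd z):]" for z by (rule vpoly_eqI) simp
  then show ?case by (simp add: vcomp_def)
next
  case (add F G)
  have "vpoly (\<lambda>z. F z + G z) z = vpoly F z + vpoly G z" for z
    by (rule vpoly_eqI) (simp add: vpoly(2) add)
  then show ?case using add by (simp add: vcomp_def)
next
  case (mult F G)
  have 0: "coeff (vpoly F (x, y)) 0 = F (0, y)" if "F \<in> poly_funs" for F x
    using vpoly(2)[OF that, of "(x, y)" 0] by (simp add: poly_0_coeff_0)
  have "vpoly (\<lambda>z. F z * G z) z = vpoly F z * vpoly G z" for z
    by (rule vpoly_eqI) (simp add: vpoly(2) mult)
  then show ?case using mult 0[OF mult(1)] 0[OF mult(2)]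
    by (simp add: vcomp_def coeff_mult algebra_simps)
qed

lemma wcomp_1_add:
  assumes "F \<in> poly_funs"
  shows "wcomp 1 F (x, y + y') = wcomp 1 F (x, y) + wcomp 1 F (x, y')"
  using assms
proof induction
  case (const c)
  have "wpoly (\<lambda>_. c) z = [:c:]" for z by (rule wpoly_eqI) simp
  then show ?case by (simp add: wcomp_def)
next
  case (snd \<phi>)
  have "wpoly (\<lambda>z. \<phi> (snd z)) z = [:0, \<phi> (snd z):]" for z
    by (rule wpoly_eqI) (simp add: linear_functional_simps[OF snd])
  then show ?case by (simp add: wcomp_def linear_functional_simps[OF snd])
next
  case (fst \<psi>)
  have "wpoly (\<lambda>z. \<psi> (fst z)) z = [:\<psi> (fst z):]" for z by (rule wpoly_eqI) simp
  then show ?case by (simp add: wcomp_def)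
next
  case (add F G)
  have "wpoly (\<lambda>z. F z + G z) z = wpoly F z + wpoly G z" for z
    by (rule wpoly_eqI) (simp add: wpoly(2) add)
  then show ?case using add by (simp add: wcomp_def)
next
  case (mult F G)
  have 0: "coeff (wpoly F (x, y)) 0 = F (x, 0)" if "F \<in> poly_funs" for F y
    using wpoly(2)[OF that, of "(x, y)" 0] by (simp add: poly_0_coeff_0)
  have "wpoly (\<lambda>z. F z * G z) z = wpoly F z * wpoly G z" for z
    by (rule wpoly_eqI) (simp add: wpoly(2) mult)
  then show ?case using mult 0[OF mult(1)] 0[OF mult(2)]
    by (simp add: wcomp_def coeff_mult algebra_simps)
qed

text \<open>The section used by \<open>chern_cap\<close> is an arbitrary form of this bidegree; to
  compute its divisor on a linear subspace it has to be recognised as a linear functional.\<close>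

lemma bihom_1_0E:
  assumes F: "bihom 1 0 F"
  obtains \<phi> where "Vector_Spaces.linear scaleV (*) \<phi>" "F = (\<lambda>z. \<phi> (fst z))"
proof
  have sc: "F (scaleV c x, y) = c * F (x, y)" for c x y
    using bihom_scale[OF F, of c x 1 y] by simp
  have "vpoly F z = monom (F z) 1" for z
    by (rule vpoly_eqI) (simp add: poly_monom sc)
  then have v: "vcomp 1 F z = F z" for z by (simp add: vcomp_def)
  have "F (x, y) = F (x, 0)" for x y using bihom_scale[OF F, of 1 x 0 y] by simp
  then show "F = (\<lambda>z. F (fst z, 0))" by (metis prod.collapse)
  show "Vector_Spaces.linear scaleV (*) (\<lambda>x. F (x, 0))"
    using vcomp_1_add[OF bihom_pf[OF F], of _ _ 0]
    by (intro linear_functionalI V.vector_space_axioms) (auto simp: v sc simp del: One_nat_def)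
qed

lemma bihom_0_1E:
  assumes F: "bihom 0 1 F"
  obtains \<psi> where "Vector_Spaces.linear scaleW (*) \<psi>" "F = (\<lambda>z. \<psi> (snd z))"
proof
  have sc: "F (x, scaleW c y) = c * F (x, y)" for c x y
    using bihom_scale[OF F, of 1 x c y] by simp
  have "wpoly F z = monom (F z) 1" for z
    by (rule wpoly_eqI) (simp add: poly_monom sc)
  then have v: "wcomp 1 F z = F z" for z by (simp add: wcomp_def)
  have "F (x, y) = F (0, y)" for x y using bihom_scale[OF F, of 0 x 1 y] by simp
  then show "F = (\<lambda>z. F (0, snd z))" by (metis prod.collapse)
  show "Vector_Spaces.linear scaleW (*) (\<lambda>x. F (0, x))"
    using wcomp_1_add[OF bihom_pf[OF F], of 0]
    by (intro linear_functionalI W.vector_space_axioms) (auto simp: v sc simp del: One_nat_def)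
qed

subsection \<open>Products of linear subspaces\<close>

lemma poly_curve_affine: "poly_curve (\<lambda>t. (x + scaleV t u, y + scaleW t v))"
  unfolding poly_curve_def
proof (intro conjI allI impI)
  fix \<phi> assume \<phi>: "Vector_Spaces.linear scaleV (*) \<phi>"
  show "\<exists>p. \<forall>t. \<phi> (fst (x + scaleV t u, y + scaleW t v)) = poly p t"
    by (rule exI[of _ "[:\<phi> x, \<phi> u:]"]) (simp add: linear_functional_simps[OF \<phi>])
next
  fix \<phi> assume \<phi>: "Vector_Spaces.linear scaleW (*) \<phi>"
  show "\<exists>p. \<forall>t. \<phi> (snd (x + scaleV t u, y + scaleW t v)) = poly p t"
    by (rule exI[of _ "[:\<phi> y, \<phi> v:]"]) (simp add: linear_functional_simps[OF \<phi>])
qed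

context
  fixes A B assumes A: "V.subspace A" and B: "W.subspace B"
begin

lemma linear_biconical: "biconical (A \<times> B)"
  using A B by (auto simp: biconical_def V.subspace_scale W.subspace_scale)

lemma linear_integral: "integral_set (A \<times> B)"
proof (rule integral_set_curvesI)
  show "A \<times> B \<noteq> {}" using V.subspace_0[OF A] W.subspace_0[OF B] by blast
  fix z w assume z: "z \<in> A \<times> B" and w: "w \<in> A \<times> B"
  let ?\<gamma> = "\<lambda>t. (fst z + scaleV t (fst w - fst z), snd z + scaleW t (snd w - snd z))"
  have "?\<gamma> t \<in> A \<times> B" for t
    using z w A B by (auto intro!: V.subspace_add V.subspace_scale V.subspace_diff
        W.subspace_add W.subspace_scale W.subspace_diff)
  then show "\<exists>\<gamma> F. poly_curve \<gamma> \<and> \<gamma> 0 = z \<and> \<gamma> 1 = w \<and> finite F \<and> (\<forall>t. t \<notin> F \<longrightarrow> \<gamma> t \<in> A \<times> B)"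
    by (intro exI[of _ ?\<gamma>] exI[of _ "{}"] conjI poly_curve_affine) auto
qed

lemma linear_nondegenerate: "nondegenerate (A \<times> B) \<longleftrightarrow> A \<noteq> {0} \<and> B \<noteq> {0}"
  using V.subspace_0[OF A] W.subspace_0[OF B] by (auto simp: nondegenerate_def)

lemma linear_section_fst:
  assumes B0: "B \<noteq> {0}" and \<phi>: "Vector_Spaces.linear scaleV (*) \<phi>" and e: "e \<in> A" "\<phi> e = 1"
  shows "subvariety (proj (A \<times> B))" "\<not> vanishes_on (\<lambda>z. \<phi> (fst z)) (proj (A \<times> B))"
    and "div_form (proj (A \<times> B)) (\<lambda>z. \<phi> (fst z)) =
      fundamental_cycle (proj ((A \<inter> {x. \<phi> x = 0}) \<times> B))"
proof -
  have "A \<noteq> {0}" using e linear_functional_simps(3)[OF \<phi>] by auto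
  then have nd: "nondegenerate (A \<times> B)" using B0 linear_nondegenerate by simp
  show "subvariety (proj (A \<times> B))" by (rule subvariety_proj[OF linear_biconical linear_integral nd])
  have eq: "{z \<in> A \<times> B. \<phi> (fst z) = 0} = (A \<inter> {x. \<phi> x = 0}) \<times> B" by auto
  have *: "\<phi> (fst (x + scaleV s e, y + scaleW s 0)) = \<phi> (fst (x, y)) + s" for x y s
    by (simp add: linear_functional_simps[OF \<phi>] e)
  have **: "(x + scaleV s e, y + scaleW s 0) \<in> A \<times> B" if "(x, y) \<in> A \<times> B" for x y s
    using that A e by (auto intro: V.subspace_add V.subspace_scale)
  note c = cone_section[OF linear_biconical linear_integral nd bihom_fst[OF \<phi>] * **]
  show "\<not> vanishes_on (\<lambda>z. \<phi> (fst z)) (proj (A \<times> B))" by (rule c(1))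
  show "div_form (proj (A \<times> B)) (\<lambda>z. \<phi> (fst z)) = fundamental_cycle (proj ((A \<inter> {x. \<phi> x = 0}) \<times> B))"
    using c(2) unfolding eq .
qed

lemma linear_section_snd:
  assumes A0: "A \<noteq> {0}" and \<psi>: "Vector_Spaces.linear scaleW (*) \<psi>" and e: "e \<in> B" "\<psi> e = 1"
  shows "subvariety (proj (A \<times> B))" "\<not> vanishes_on (\<lambda>z. \<psi> (snd z)) (proj (A \<times> B))"
    and "div_form (proj (A \<times> B)) (\<lambda>z. \<psi> (snd z)) =
      fundamental_cycle (proj (A \<times> (B \<inter> {y. \<psi> y = 0})))"
proof -
  have "B \<noteq> {0}" using e linear_functional_simps(3)[OF \<psi>] by auto
  then have nd: "nondegenerate (A \<times> B)" using A0 linear_nondegenerate by simp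
  show "subvariety (proj (A \<times> B))" by (rule subvariety_proj[OF linear_biconical linear_integral nd])
  have eq: "{z \<in> A \<times> B. \<psi> (snd z) = 0} = A \<times> (B \<inter> {y. \<psi> y = 0})" by auto
  have *: "\<psi> (snd (x + scaleV s 0, y + scaleW s e)) = \<psi> (snd (x, y)) + s" for x y s
    by (simp add: linear_functional_simps[OF \<psi>] e)
  have **: "(x + scaleV s 0, y + scaleW s e) \<in> A \<times> B" if "(x, y) \<in> A \<times> B" for x y s
    using that B e by (auto intro: W.subspace_add W.subspace_scale)
  note c = cone_section[OF linear_biconical linear_integral nd bihom_snd[OF \<psi>] * **]
  show "\<not> vanishes_on (\<lambda>z. \<psi> (snd z)) (proj (A \<times> B))" by (rule c(1))
  show "div_form (proj (A \<times> B)) (\<lambda>z. \<psi> (snd z)) = fundamental_cycle (proj (A \<times> (B \<inter> {y. \<psi> y = 0})))"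
    using c(2) unfolding eq .
qed

lemma proj_linear_degenerate: "A = {0} \<or> B = {0} \<Longrightarrow> proj (A \<times> B) = {}"
  by (rule proj_degenerate) (use linear_nondegenerate in blast)

end

section \<open>Cycles attached to polynomials in the hyperplane classes\<close>

definition hk_cycle :: "int poly poly \<Rightarrow> ('v set \<times> 'w set) set \<Rightarrow>\<^sub>0 int" where
  "hk_cycle P = (\<Sum>j\<le>degree P. \<Sum>i\<le>degree (coeff P j).
     frag_cmul (coeff (coeff P j) i) (hyperplane_monomial i j))"

lemma hk_class_eq: "hk_class P = chow_class (hk_cycle P)"
  by (simp add: hk_class_def hk_cycle_def)

text \<open>With one bound for several polynomials, additivity becomes a termwise statement.\<close>

lemma hk_cycle_bound:
  assumes "degree P \<le> N" "\<And>j. degree (coeff P j) \<le> M"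
  shows "hk_cycle P = (\<Sum>j\<le>N. \<Sum>i\<le>M. frag_cmul (coeff (coeff P j) i) (hyperplane_monomial i j))"
proof -
  have "hk_cycle P = (\<Sum>j\<le>degree P. \<Sum>i\<le>M. frag_cmul (coeff (coeff P j) i) (hyperplane_monomial i j))"
    unfolding hk_cycle_def
    by (intro sum.cong refl sum.mono_neutral_left) (use assms(2) in \<open>auto simp: coeff_eq_0\<close>)
  also have "\<dots> = (\<Sum>j\<le>N. \<Sum>i\<le>M. frag_cmul (coeff (coeff P j) i) (hyperplane_monomial i j))"
    by (intro sum.mono_neutral_left) (use assms(1) in \<open>auto simp: coeff_eq_0\<close>)
  finally show ?thesis .
qed

lemma degree_coeff_bound: "\<exists>M. \<forall>j. degree (coeff P j) \<le> M" for P :: "int poly poly"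
proof -
  have "degree (coeff P j) \<le> (MAX j\<in>{..degree P}. degree (coeff P j))" for j
    by (cases "j \<le> degree P") (auto simp: coeff_eq_0)
  then show ?thesis by blast
qed

lemma hk_cycle_add: "hk_cycle (P + Q) = hk_cycle P + hk_cycle Q"
proof -
  obtain M1 M2 where M: "\<And>j. degree (coeff P j) \<le> M1" "\<And>j. degree (coeff Q j) \<le> M2"
    using degree_coeff_bound[of P] degree_coeff_bound[of Q] by blast
  let ?N = "max (degree P) (degree Q)" and ?M = "max M1 M2"
  have "degree (P + Q) \<le> ?N" by (rule degree_add_le_max)
  moreover have "degree (coeff (P + Q) j) \<le> ?M" for j
    unfolding coeff_add using M[of j] by (intro degree_add_le) auto
  moreover have "degree (coeff P j) \<le> ?M" "degree (coeff Q j) \<le> ?M" for j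
    using M[of j] by auto
  ultimately show ?thesis
    by (simp add: hk_cycle_bound[of _ ?N ?M] frag_cmul_distrib sum.distrib)
qed

lemma hk_cycle_monomial: "hk_cycle (h_var ^ i * k_var ^ j) = hyperplane_monomial i j"
proof -
  have h: "h_var ^ i = [:monom 1 i:]"
    by (induction i) (simp_all add: monom_Suc one_pCons monom_0)
  have k: "k_var ^ j = monom (1 :: int poly) j"
    by (induction j) (simp_all add: monom_Suc monom_0)
  have e: "h_var ^ i * k_var ^ j = monom (monom 1 i) j"
    unfolding h k by (simp add: smult_monom)
  have "degree (coeff (h_var ^ i * k_var ^ j) l) \<le> i" for l
    unfolding e by (simp add: degree_monom_eq)
  moreover have "degree (h_var ^ i * k_var ^ j) \<le> j" unfolding e by (rule degree_monom_le)
  ultimately have "hk_cycle (h_var ^ i * k_var ^ j) = (\<Sum>l\<le>j. \<Sum>r\<le>i.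
      frag_cmul (coeff (coeff (h_var ^ i * k_var ^ j) l) r) (hyperplane_monomial r l))"
    by (intro hk_cycle_bound)
  also have "\<dots> = (\<Sum>l\<le>j. \<Sum>r\<le>i. if l = j then if r = i then hyperplane_monomial i j else 0 else 0)"
    unfolding e by (intro sum.cong refl) auto
  also have "\<dots> = (\<Sum>l\<le>j. if l = j then hyperplane_monomial i j else 0)"
    by (intro sum.cong) auto
  also have "\<dots> = hyperplane_monomial i j" by simp
  finally show ?thesis .
qed

end

locale biprojective_fd =
  V: finite_dimensional_vector_space scaleV BV + W: finite_dimensional_vector_space scaleW BW +
  biprojective scaleV scaleW
  for scaleV :: "complex \<Rightarrow> 'v::ab_group_add \<Rightarrow> 'v" and BV
    and scaleW :: "complex \<Rightarrow> 'w::ab_group_add \<Rightarrow> 'w" and BW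
begin

lemma chern_cap_snd:
  assumes A: "V.subspace A" and B: "W.subspace B" "B \<noteq> {0}"
  obtains B' where "W.subspace B'" "Suc (W.dim B') = W.dim B"
    "chern_cap 0 1 (fundamental_cycle (proj (A \<times> B))) = fundamental_cycle (proj (A \<times> B'))"
proof (cases "A = {0}")
  \<comment> \<open>The product has empty image and cycle \<open>0\<close>, so any hyperplane of
    \<open>B\<close> will do; it only has to keep the dimension count.\<close>
  case True
  obtain e where e: "e \<in> B" "e \<noteq> 0" using B W.subspace_0 by blast
  obtain \<psi> where \<psi>: "Vector_Spaces.linear scaleW (*) \<psi>" "\<psi> e = 1"
    using ex_linear_functional_nonzero[OF W.vector_space_axioms e(2)] by blast
  show ?thesis
  proof (rule that[OF span_insert_kernel_eq(1)[OF W.vector_space_axioms B(1) \<psi>(1) e(1) \<psi>(2)]])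
    show "Suc (W.dim (B \<inter> {x. \<psi> x = 0})) = W.dim B"
      by (rule dim_kernel_section[OF W.finite_dimensional_vector_space_axioms B(1) \<psi>(1) e(1) \<psi>(2)])
    show "chern_cap 0 1 (fundamental_cycle (proj (A \<times> B))) =
      fundamental_cycle (proj (A \<times> (B \<inter> {x. \<psi> x = 0})))"
      using proj_linear_degenerate[OF A] True B
        span_insert_kernel_eq(1)[OF W.vector_space_axioms B(1) \<psi>(1) e(1) \<psi>(2)]
      by (simp add: chern_cap_def)
  qed
next
  case False
  let ?Z = "proj (A \<times> B)"
  have nd: "nondegenerate (A \<times> B)" using linear_nondegenerate[OF A B(1)] False B by simp
  note ndZ = linear_biconical[OF A B(1)] linear_integral[OF A B(1)] nd
  have Z: "subvariety ?Z" by (rule subvariety_proj[OF ndZ])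
  define F where "F = (SOME F. bihom 0 1 F \<and> \<not> vanishes_on F ?Z)"
  have F: "bihom 0 1 F" "\<not> vanishes_on F ?Z"
    using someI_ex[OF ex_nonvanishing_form[OF Z, of 0 1]] unfolding F_def by auto
  obtain \<psi> where \<psi>: "Vector_Spaces.linear scaleW (*) \<psi>" "F = (\<lambda>z. \<psi> (snd z))"
    using bihom_0_1E[OF F(1)] .
  obtain b where b: "b \<in> B" "\<psi> b \<noteq> 0"
    using F(2) vanishes_on_proj[OF ndZ bihom_pf[OF F(1)]] unfolding \<psi>(2) vanish_def by auto
  define e where "e = scaleW (1 / \<psi> b) b"
  have e: "e \<in> B" "\<psi> e = 1"
    using b B(1) by (auto simp: e_def linear_functional_simps[OF \<psi>(1)] W.subspace_scale)
  show ?thesis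
  proof (rule that[OF span_insert_kernel_eq(1)[OF W.vector_space_axioms B(1) \<psi>(1) e]])
    show "Suc (W.dim (B \<inter> {x. \<psi> x = 0})) = W.dim B"
      by (rule dim_kernel_section[OF W.finite_dimensional_vector_space_axioms B(1) \<psi>(1) e])
    show "chern_cap 0 1 (fundamental_cycle ?Z) = fundamental_cycle (proj (A \<times> (B \<inter> {x. \<psi> x = 0})))"
      using linear_section_snd(3)[OF A B(1) False \<psi>(1) e] proj_nonempty[OF nd]
      by (simp del: One_nat_def add: chern_cap_def F_def[symmetric] \<psi>(2)[symmetric])
  qed
qed

lemma chern_cap_fst:
  assumes A: "V.subspace A" "A \<noteq> {0}" and B: "W.subspace B"
  obtains A' where "V.subspace A'" "Suc (V.dim A') = V.dim A"
    "chern_cap 1 0 (fundamental_cycle (proj (A \<times> B))) = fundamental_cycle (proj (A' \<times> B))"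
proof (cases "B = {0}")
  case True
  obtain e where e: "e \<in> A" "e \<noteq> 0" using A V.subspace_0 by blast
  obtain \<psi> where \<psi>: "Vector_Spaces.linear scaleV (*) \<psi>" "\<psi> e = 1"
    using ex_linear_functional_nonzero[OF V.vector_space_axioms e(2)] by blast
  show ?thesis
  proof (rule that[OF span_insert_kernel_eq(1)[OF V.vector_space_axioms A(1) \<psi>(1) e(1) \<psi>(2)]])
    show "Suc (V.dim (A \<inter> {x. \<psi> x = 0})) = V.dim A"
      by (rule dim_kernel_section[OF V.finite_dimensional_vector_space_axioms A(1) \<psi>(1) e(1) \<psi>(2)])
    show "chern_cap 1 0 (fundamental_cycle (proj (A \<times> B))) =
      fundamental_cycle (proj ((A \<inter> {x. \<psi> x = 0}) \<times> B))"
      using proj_linear_degenerate[OF _ B] True A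
        span_insert_kernel_eq(1)[OF V.vector_space_axioms A(1) \<psi>(1) e(1) \<psi>(2)]
      by (simp add: chern_cap_def)
  qed
next
  case False
  let ?Z = "proj (A \<times> B)"
  have nd: "nondegenerate (A \<times> B)" using linear_nondegenerate[OF A(1) B] False A by simp
  note ndZ = linear_biconical[OF A(1) B] linear_integral[OF A(1) B] nd
  have Z: "subvariety ?Z" by (rule subvariety_proj[OF ndZ])
  define F where "F = (SOME F. bihom 1 0 F \<and> \<not> vanishes_on F ?Z)"
  have F: "bihom 1 0 F" "\<not> vanishes_on F ?Z"
    using someI_ex[OF ex_nonvanishing_form[OF Z, of 1 0]] unfolding F_def by auto
  obtain \<psi> where \<psi>: "Vector_Spaces.linear scaleV (*) \<psi>" "F = (\<lambda>z. \<psi> (fst z))"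
    using bihom_1_0E[OF F(1)] .
  obtain b where b: "b \<in> A" "\<psi> b \<noteq> 0"
    using F(2) vanishes_on_proj[OF ndZ bihom_pf[OF F(1)]] unfolding \<psi>(2) vanish_def by auto
  define e where "e = scaleV (1 / \<psi> b) b"
  have e: "e \<in> A" "\<psi> e = 1"
    using b A(1) by (auto simp: e_def linear_functional_simps[OF \<psi>(1)] V.subspace_scale)
  show ?thesis
  proof (rule that[OF span_insert_kernel_eq(1)[OF V.vector_space_axioms A(1) \<psi>(1) e]])
    show "Suc (V.dim (A \<inter> {x. \<psi> x = 0})) = V.dim A"
      by (rule dim_kernel_section[OF V.finite_dimensional_vector_space_axioms A(1) \<psi>(1) e])
    show "chern_cap 1 0 (fundamental_cycle ?Z) = fundamental_cycle (proj ((A \<inter> {x. \<psi> x = 0}) \<times> B))"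
      using linear_section_fst(3)[OF A(1) B False \<psi>(1) e] proj_nonempty[OF nd]
      by (simp del: One_nat_def add: chern_cap_def F_def[symmetric] \<psi>(2)[symmetric])
  qed
qed

text \<open>Every section chosen by \<open>chern_cap\<close> is linear, so the cut remains a product
  of subspaces. When \<open>i\<close> reaches the full dimension, \<open>A\<close> is zero and so is
  the cycle: this is the relation \<open>h^m = 0\<close>.\<close>

lemma hyperplane_monomial_linear:
  assumes "i \<le> V.dim UNIV" "j \<le> W.dim UNIV"
  shows "\<exists>A B. V.subspace A \<and> W.subspace B \<and> V.dim A + i = V.dim UNIV \<and> W.dim B + j = W.dim UNIV \<and>
    hyperplane_monomial i j = fundamental_cycle (proj (A \<times> B))"
  using assms(1)
proof (induction i)
  case 0
  show ?case
    using assms(2)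
  proof (induction j)
    case 0
    have "zariski_closure UNIV = UNIV" using closure_subset[of UNIV] by auto
    then have "hyperplane_monomial 0 0 = fundamental_cycle (proj (UNIV \<times> UNIV))"
      by (simp add: hyperplane_monomial_def proj_def UNIV_Times_UNIV)
    then show ?case by (intro exI[of _ UNIV]) simp
  next
    case (Suc j)
    then obtain A B where AB: "V.subspace A" "W.subspace B" "V.dim A + 0 = V.dim UNIV"
      "W.dim B + j = W.dim UNIV" "hyperplane_monomial 0 j = fundamental_cycle (proj (A \<times> B))" by auto
    have "B \<noteq> {0}" using AB(4) Suc(2) by auto
    then obtain B' where B': "W.subspace B'" "Suc (W.dim B') = W.dim B"
      "chern_cap 0 1 (fundamental_cycle (proj (A \<times> B))) = fundamental_cycle (proj (A \<times> B'))"
      using chern_cap_snd[OF AB(1,2)] by blast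
    have "hyperplane_monomial 0 (Suc j) = fundamental_cycle (proj (A \<times> B'))"
      using AB(5) B'(3) by (simp add: hyperplane_monomial_def)
    then show ?case using AB B' by (intro exI[of _ A] exI[of _ B']) simp
  qed
next
  case (Suc i)
  then obtain A B where AB: "V.subspace A" "W.subspace B" "V.dim A + i = V.dim UNIV"
    "W.dim B + j = W.dim UNIV" "hyperplane_monomial i j = fundamental_cycle (proj (A \<times> B))" by auto
  have "A \<noteq> {0}" using AB(3) Suc(2) by auto
  then obtain A' where A': "V.subspace A'" "Suc (V.dim A') = V.dim A"
    "chern_cap 1 0 (fundamental_cycle (proj (A \<times> B))) = fundamental_cycle (proj (A' \<times> B))"
    using chern_cap_fst[OF AB(1) _ AB(2)] by blast
  have "hyperplane_monomial (Suc i) j = fundamental_cycle (proj (A' \<times> B))"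
    using AB(5) A'(3) by (simp add: hyperplane_monomial_def)
  then show ?case using AB A' by (intro exI[of _ A'] exI[of _ B]) simp
qed

lemma linear_exchange_fst:
  assumes A: "V.subspace A" "V.subspace A'" "V.dim A = V.dim A'" and B: "W.subspace B"
  shows "rat_eq (fundamental_cycle (proj (A \<times> B))) (fundamental_cycle (proj (A' \<times> B)))"
proof (rule pencil_induct[OF V.finite_dimensional_vector_space_axioms A])
  fix T \<phi> \<phi>' e e'
  assume T: "V.subspace T" and \<phi>: "Vector_Spaces.linear scaleV (*) \<phi>" "e \<in> T" "\<phi> e = 1"
    and \<phi>': "Vector_Spaces.linear scaleV (*) \<phi>'" "e' \<in> T" "\<phi>' e' = 1"
  show "rat_eq (fundamental_cycle (proj ((T \<inter> {x. \<phi> x = 0}) \<times> B)))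
      (fundamental_cycle (proj ((T \<inter> {x. \<phi>' x = 0}) \<times> B)))"
  proof (cases "B = {0}")
    case True
    then show ?thesis
      using proj_linear_degenerate[OF span_insert_kernel_eq(1)[OF V.vector_space_axioms T \<phi>] B]
        proj_linear_degenerate[OF span_insert_kernel_eq(1)[OF V.vector_space_axioms T \<phi>'] B] by simp
  next
    case False
    note sec = linear_section_fst[OF T B False \<phi>] and sec' = linear_section_fst[OF T B False \<phi>']
    show ?thesis
      unfolding sec(3)[symmetric] sec'(3)[symmetric]
      by (rule rat_eq_div_form[OF sec(1) bihom_fst[OF \<phi>(1)] bihom_fst[OF \<phi>'(1)] sec(2) sec'(2)])
  qed
qed (auto intro: rat_eq_trans)

lemma linear_exchange_snd:
  assumes B: "W.subspace B" "W.subspace B'" "W.dim B = W.dim B'" and A: "V.subspace A"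
  shows "rat_eq (fundamental_cycle (proj (A \<times> B))) (fundamental_cycle (proj (A \<times> B')))"
proof (rule pencil_induct[OF W.finite_dimensional_vector_space_axioms B])
  fix T \<psi> \<psi>' e e'
  assume T: "W.subspace T" and \<psi>: "Vector_Spaces.linear scaleW (*) \<psi>" "e \<in> T" "\<psi> e = 1"
    and \<psi>': "Vector_Spaces.linear scaleW (*) \<psi>'" "e' \<in> T" "\<psi>' e' = 1"
  show "rat_eq (fundamental_cycle (proj (A \<times> (T \<inter> {x. \<psi> x = 0}))))
      (fundamental_cycle (proj (A \<times> (T \<inter> {x. \<psi>' x = 0}))))"
  proof (cases "A = {0}")
    case True
    then show ?thesis
      using proj_linear_degenerate[OF A span_insert_kernel_eq(1)[OF W.vector_space_axioms T \<psi>]]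
        proj_linear_degenerate[OF A span_insert_kernel_eq(1)[OF W.vector_space_axioms T \<psi>']] by simp
  next
    case False
    note sec = linear_section_snd[OF A T False \<psi>] and sec' = linear_section_snd[OF A T False \<psi>']
    show ?thesis
      unfolding sec(3)[symmetric] sec'(3)[symmetric]
      by (rule rat_eq_div_form[OF sec(1) bihom_snd[OF \<psi>(1)] bihom_snd[OF \<psi>'(1)] sec(2) sec'(2)])
  qed
qed (auto intro: rat_eq_trans)

text \<open>The subspaces behind a hyperplane monomial depend on choices; up to rational equivalence
  only the dimensions of the two factors matter.\<close>

theorem linear_rat_eq_monomial:
  assumes A: "V.subspace A" "V.dim A + i = V.dim UNIV" and B: "W.subspace B" "W.dim B + j = W.dim UNIV"
  shows "rat_eq (fundamental_cycle (proj (A \<times> B))) (hyperplane_monomial i j)"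
proof -
  have "i \<le> V.dim UNIV" "j \<le> W.dim UNIV" using A(2) B(2) by linarith+
  then obtain A' B' where *: "V.subspace A'" "W.subspace B'" "V.dim A' + i = V.dim UNIV"
    "W.dim B' + j = W.dim UNIV" "hyperplane_monomial i j = fundamental_cycle (proj (A' \<times> B'))"
    using hyperplane_monomial_linear by blast
  have "rat_eq (fundamental_cycle (proj (A \<times> B))) (fundamental_cycle (proj (A' \<times> B)))"
    by (rule linear_exchange_fst[OF A(1) *(1) _ B(1)]) (use A *(3) in simp)
  also have "rat_eq (fundamental_cycle (proj (A' \<times> B))) (fundamental_cycle (proj (A' \<times> B')))"
    by (rule linear_exchange_snd[OF B(1) *(2) _ *(1)]) (use B *(4) in simp)
  finally show ?thesis unfolding *(5) .
qed

end

section \<open>Coordinates, linear relations among functionals, and the arrangement\<close>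

lemma linear_coordinate: "Vector_Spaces.linear (*s) (*) (\<lambda>y :: complex ^ 'n. y $ j)"
  by (rule linear_functionalI[OF vec.vector_space_axioms]) auto

lemma linear_vec_expansion:
  fixes \<psi> :: "complex ^ 'n \<Rightarrow> complex"
  assumes "Vector_Spaces.linear (*s) (*) \<psi>"
  shows "\<psi> y = (\<Sum>j\<in>UNIV. y $ j * \<psi> (axis j 1))"
proof -
  interpret Vector_Spaces.linear "(*s) :: complex \<Rightarrow> complex ^ 'n \<Rightarrow> complex ^ 'n" "(*)" \<psi> by fact
  have "\<psi> y = \<psi> (\<Sum>j\<in>UNIV. y $ j *s axis j 1)" by (simp add: basis_expansion)
  also have "\<dots> = (\<Sum>j\<in>UNIV. y $ j * \<psi> (axis j 1))" by (simp add: sum scale)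
  finally show ?thesis .
qed

text \<open>Induction on \<open>J\<close>: on the kernel of \<open>f i\<close> the remaining
  functionals suffice, and the coefficient \<open>d\<close> of \<open>f i\<close> is the error of
  that combination at a vector \<open>e\<close> with \<open>f i e = 1\<close>.\<close>

lemma linear_combination_of_functionals:
  fixes s :: "complex \<Rightarrow> 'a::ab_group_add \<Rightarrow> 'a"
  assumes V: "vector_space s" and fin: "finite J" and U: "module.subspace s U"
    and b: "Vector_Spaces.linear s (*) b"
    and f: "\<And>j. j \<in> J \<Longrightarrow> Vector_Spaces.linear s (*) (f j)"
    and 0: "\<And>u. u \<in> U \<Longrightarrow> (\<And>j. j \<in> J \<Longrightarrow> f j u = 0) \<Longrightarrow> b u = 0"
  shows "\<exists>c. \<forall>u\<in>U. b u = (\<Sum>j\<in>J. c j * f j u)"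
  using fin U f 0
proof (induction J arbitrary: U rule: finite_induct)
  case empty
  then show ?case by simp
next
  case (insert i J)
  interpret V: vector_space s by fact
  note fl = insert.prems(2) and li = linear_functional_simps[OF insert.prems(2)[of i, simplified]]
  let ?U = "U \<inter> {x. f i x = 0}"
  have "V.subspace ?U"
    using insert.prems(1) by (auto simp: V.subspace_def li)
  then have "\<exists>c. \<forall>u\<in>?U. b u = (\<Sum>j\<in>J. c j * f j u)"
    by (rule insert.IH) (use insert.prems in auto)
  then obtain c where c: "\<And>u. u \<in> U \<Longrightarrow> f i u = 0 \<Longrightarrow> b u = (\<Sum>j\<in>J. c j * f j u)" by blast
  show ?case
  proof (cases "\<exists>e\<in>U. f i e \<noteq> 0")
    case False
    then have "\<forall>u\<in>U. b u = (\<Sum>j\<in>insert i J. c j * f j u)" using c insert.hyps by simp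
    then show ?thesis by blast
  next
    case True
    then obtain e0 where e0: "e0 \<in> U" "f i e0 \<noteq> 0" by blast
    define e where "e = s (1 / f i e0) e0"
    have e: "e \<in> U" "f i e = 1"
      using e0 insert.prems(1) by (auto simp: e_def li V.subspace_scale)
    define d where "d = b e - (\<Sum>j\<in>J. c j * f j e)"
    define c' where "c' = (\<lambda>j. if j = i then d else c j)"
    have "b u = (\<Sum>j\<in>insert i J. c' j * f j u)" if u: "u \<in> U" for u
    proof -
      have "u - s (f i u) e \<in> U" using u e insert.prems(1) by (intro V.subspace_diff V.subspace_scale)
      moreover have "f i (u - s (f i u) e) = 0" using e by (simp add: li)
      ultimately have "b (u - s (f i u) e) = (\<Sum>j\<in>J. c j * f j (u - s (f i u) e))" by (rule c)
      also have "\<dots> = (\<Sum>j\<in>J. c j * f j u - f i u * (c j * f j e))"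
        by (intro sum.cong refl)
          (simp add: linear_functional_simps[OF fl] algebra_simps)
      also have "\<dots> = (\<Sum>j\<in>J. c j * f j u) - f i u * (\<Sum>j\<in>J. c j * f j e)"
        by (simp add: sum_subtractf sum_distrib_left)
      finally have "b u = f i u * d + (\<Sum>j\<in>J. c j * f j u)"
        by (simp add: d_def linear_functional_simps[OF b] algebra_simps)
      moreover have "(\<Sum>j\<in>J. c' j * f j u) = (\<Sum>j\<in>J. c j * f j u)"
        by (intro sum.cong refl) (use insert.hyps in \<open>auto simp: c'_def\<close>)
      ultimately show ?thesis using insert.hyps by (simp add: c'_def mult.commute)
    qed
    then show ?thesis by blast
  qed
qed

lemma ex_linear_projection:
  fixes s :: "complex \<Rightarrow> 'a::ab_group_add \<Rightarrow> 'a"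
  assumes "vector_space s" "module.subspace s Y"
  shows "\<exists>P. Vector_Spaces.linear s s P \<and> (\<forall>x. P x \<in> Y) \<and> (\<forall>y\<in>Y. P y = y)"
proof -
  interpret V: vector_space s by fact
  interpret vector_space_pair s s ..
  obtain B where B: "B \<subseteq> Y" "V.independent B" "V.span B = Y"
    using V.basis_exists[of Y] assms(2) V.span_subspace[of _ Y] by metis
  obtain P where P: "Vector_Spaces.linear s s P" "\<forall>x\<in>B. P x = id x" "range P = V.span (id ` B)"
    using linear_independent_extend_subspace[OF B(2), of id] by blast
  have "P y = id y" if "y \<in> Y" for y
    by (rule linear_eq_on[OF P(1) V.linear_id, of y B]) (use that B P in auto)
  then show ?thesis using P B by auto
qed

locale arrangement =
  biprojective_fd scaleV BV "(*s) :: complex \<Rightarrow> complex ^ 'n \<Rightarrow> complex ^ 'n" cart_basis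
  for scaleV :: "complex \<Rightarrow> 'v::ab_group_add \<Rightarrow> 'v" and BV +
  fixes f :: "'n::finite \<Rightarrow> 'v \<Rightarrow> complex" and n0 :: 'n
  assumes f_linear: "\<And>i. Vector_Spaces.linear scaleV (*) (f i)"
begin

lemmas f_simps [simp] = linear_functional_simps[OF f_linear]

lemma pf_f: "(\<lambda>z. f j (fst z)) \<in> poly_funs"
  by (rule poly_funs.fst[OF f_linear])

lemma pf_coordinate: "(\<lambda>z. snd z $ j) \<in> poly_funs"
  by (rule poly_funs.snd[OF linear_coordinate])

lemma bihom_f: "bihom 1 0 (\<lambda>z. f j (fst z))"
  by (rule bihom_fst[OF f_linear])

lemma bihom_coordinate: "bihom 0 1 (\<lambda>z. snd z $ j)"
  by (rule bihom_snd[OF linear_coordinate])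

lemma poly_curve_vecI:
  assumes "\<And>\<phi>. Vector_Spaces.linear scaleV (*) \<phi> \<Longrightarrow> \<exists>p. \<forall>t. \<phi> (fst (\<gamma> t)) = poly p t"
    and "\<And>j. \<exists>p. \<forall>t. snd (\<gamma> t) $ j = poly p t"
  shows "poly_curve \<gamma>"
  unfolding poly_curve_def
proof (intro conjI allI impI)
  fix \<psi> :: "complex ^ 'n \<Rightarrow> complex" assume \<psi>: "Vector_Spaces.linear (*s) (*) \<psi>"
  obtain p where p: "\<And>j t. snd (\<gamma> t) $ j = poly (p j) t" using assms(2) by metis
  show "\<exists>p. \<forall>t. \<psi> (snd (\<gamma> t)) = poly p t"
    by (rule exI[of _ "\<Sum>j\<in>UNIV. smult (\<psi> (axis j 1)) (p j)"])
      (auto simp: poly_sum p[symmetric] mult.commute intro!: linear_vec_expansion[OF \<psi>, THEN trans])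
qed (fact assms(1))

lemma regular_curves_vecI:
  assumes "g \<in> poly_funs"
    and "\<And>\<phi>. Vector_Spaces.linear scaleV (*) \<phi> \<Longrightarrow> regular_fun T g (\<lambda>z s. \<phi> (fst (\<gamma> z s)))"
    and "\<And>j. regular_fun T g (\<lambda>z s. snd (\<gamma> z s) $ j)"
  shows "regular_curves T g \<gamma>"
  unfolding regular_curves_def
proof (intro conjI allI impI)
  fix \<psi> :: "complex ^ 'n \<Rightarrow> complex" assume \<psi>: "Vector_Spaces.linear (*s) (*) \<psi>"
  have "regular_fun T g (\<lambda>z s. \<Sum>j\<in>UNIV. snd (\<gamma> z s) $ j * \<psi> (axis j 1))"
    by (intro regular_fun_sum regular_fun_mult assms regular_fun_const)
  then show "regular_fun T g (\<lambda>z s. \<psi> (snd (\<gamma> z s)))"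
    by (rule regular_fun_cong) (rule linear_vec_expansion[OF \<psi>])
qed (fact assms)+

lemma finite_roots_f: "f j x \<noteq> 0 \<Longrightarrow> finite {t. f j (x + scaleV t u) = 0}"
proof -
  assume "f j x \<noteq> 0"
  then have "finite {t. poly [:f j x, f j u:] t = 0}" by (intro poly_roots_finite) simp
  then show ?thesis by simp
qed

lemma finite_roots_all:
  assumes "\<And>j. j \<in> J \<Longrightarrow> f j x \<noteq> 0" shows "finite {t. \<exists>j\<in>J. f j (x + scaleV t u) = 0}"
proof -
  have "{t. \<exists>j\<in>J. f j (x + scaleV t u) = 0} = (\<Union>j\<in>J. {t. f j (x + scaleV t u) = 0})" by blast
  then show ?thesis using assms finite_roots_f by simp
qed

subsection \<open>Critical sets and their strata\<close>

text \<open>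
  For a subspace \<open>X\<close>, the hyperplanes \<open>f j\<close> (\<open>j \<in> S\<close>) and the hyperplane \<open>f n0\<close> at infinity: the
  logarithmic form vanishes along the directions of \<open>X\<close> parallel to infinity, the coordinates in \<open>K\<close>
  are free, and the remaining ones vanish.
\<close>

definition crit :: "'v set \<Rightarrow> 'n set \<Rightarrow> 'n set \<Rightarrow> ('v \<times> (complex ^ 'n)) set" where
  "crit X S K = {(x, l). x \<in> X \<and> (\<forall>j\<in>insert n0 S. f j x \<noteq> 0) \<and>
     (\<forall>u\<in>X. f n0 u = 0 \<longrightarrow> (\<Sum>j\<in>S. l $ j * (f j u / f j x)) = 0) \<and> (\<forall>j. j \<notin> S \<union> K \<longrightarrow> l $ j = 0)}"

text \<open>
  The part of the closure of \<open>crit X S K\<close> over the points \<open>y\<close> at which exactly the \<open>f j\<close> with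
  \<open>j \<in> J\<close> vanish: \<open>\<nu>\<close> is the direction in which \<open>y\<close> is approached.
\<close>

definition stratum_data :: "'v set \<Rightarrow> 'n set \<Rightarrow> 'n set \<Rightarrow> 'n set \<Rightarrow> 'v \<Rightarrow> 'v \<Rightarrow> complex ^ 'n \<Rightarrow> bool" where
  "stratum_data X S K J y \<nu> r \<longleftrightarrow> y \<in> X \<and> \<nu> \<in> X \<and> (\<forall>j\<in>J. f j y = 0 \<and> f j \<nu> \<noteq> 0) \<and>
     (\<forall>j\<in>insert n0 S - J. f j y \<noteq> 0) \<and>
     (\<forall>u\<in>X. f n0 u = 0 \<longrightarrow> (\<forall>j\<in>J. f j u = 0) \<longrightarrow> (\<Sum>j\<in>S - J. r $ j * f j u) = 0) \<and>
     (\<forall>u\<in>X. f n0 u = 0 \<longrightarrow> (\<Sum>j\<in>S \<inter> J. r $ j * f j u) = 0) \<and> (\<forall>j. j \<notin> S \<union> K \<longrightarrow> r $ j = 0)"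

text \<open>The parameters \<open>r\<close> are the coordinates divided by \<open>f j y\<close> off
  \<open>J\<close> and by \<open>f j \<nu>\<close> on \<open>J\<close>. In terms of \<open>r\<close>
  the conditions are linear and do not involve \<open>y\<close> and \<nu>, and passing back to
  coordinates needs no denominators.\<close>

definition stratum_vec :: "'n set \<Rightarrow> 'n set \<Rightarrow> 'v \<Rightarrow> 'v \<Rightarrow> complex ^ 'n \<Rightarrow> complex ^ 'n" where
  "stratum_vec S J y \<nu> r =
     (\<chi> j. if j \<in> S - J then f j y * r $ j else if j \<in> S then f j \<nu> * r $ j else r $ j)"

definition stratum :: "'v set \<Rightarrow> 'n set \<Rightarrow> 'n set \<Rightarrow> 'n set \<Rightarrow> ('v \<times> (complex ^ 'n)) set" where
  "stratum X S K J = {(y, stratum_vec S J y \<nu> r) | y \<nu> r. stratum_data X S K J y \<nu> r}"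

text \<open>For \<open>J = {}\<close> no limit is taken and the only condition on \<nu> is to lie in
  \<open>X\<close>, so the point itself serves as \<nu>. Statements about strata thus cover
  \<open>crit\<close>.\<close>

lemma crit_eq_stratum: "crit X S K = stratum X S K {}"
proof
  show "crit X S K \<subseteq> stratum X S K {}"
  proof
    fix z assume "z \<in> crit X S K"
    then obtain x l where z: "z = (x, l)" and x: "x \<in> X" "\<forall>j\<in>insert n0 S. f j x \<noteq> 0"
      and l: "\<forall>u\<in>X. f n0 u = 0 \<longrightarrow> (\<Sum>j\<in>S. l $ j * (f j u / f j x)) = 0" "\<forall>j. j \<notin> S \<union> K \<longrightarrow> l $ j = 0"
      unfolding crit_def by auto
    define r :: "complex ^ 'n" where "r = (\<chi> j. if j \<in> S then l $ j / f j x else l $ j)"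
    have "(\<Sum>j\<in>S. r $ j * f j u) = (\<Sum>j\<in>S. l $ j * (f j u / f j x))" for u
      by (intro sum.cong) (auto simp: r_def)
    then have "stratum_data X S K {} x x r"
      using x l by (auto simp: stratum_data_def r_def)
    moreover have "l = stratum_vec S {} x x r"
      using x by (auto simp: vec_eq_iff stratum_vec_def r_def)
    ultimately show "z \<in> stratum X S K {}" unfolding z stratum_def by blast
  qed
  show "stratum X S K {} \<subseteq> crit X S K"
  proof
    fix z assume "z \<in> stratum X S K {}"
    then obtain y \<nu> r where z: "z = (y, stratum_vec S {} y \<nu> r)" and d: "stratum_data X S K {} y \<nu> r"
      unfolding stratum_def by blast
    have "(\<Sum>j\<in>S. stratum_vec S {} y \<nu> r $ j * (f j u / f j y)) = (\<Sum>j\<in>S. r $ j * f j u)" for u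
      by (intro sum.cong) (use d in \<open>auto simp: stratum_vec_def stratum_data_def\<close>)
    then show "z \<in> crit X S K"
      using d by (auto simp: z crit_def stratum_data_def stratum_vec_def)
  qed
qed

context
  fixes X :: "'v set" and S K :: "'n set"
  assumes X: "V.subspace X"
begin

lemma stratum_biconical: "biconical (stratum X S K J)"
  unfolding biconical_def
proof (intro allI impI)
  fix x l and c d :: complex assume xl: "(x, l) \<in> stratum X S K J" and cd: "c \<noteq> 0" "d \<noteq> 0"
  then obtain \<nu> r where l: "l = stratum_vec S J x \<nu> r" and dd: "stratum_data X S K J x \<nu> r"
    unfolding stratum_def by blast
  \<comment> \<open>Off \<open>J\<close> the factor \<open>f j y\<close> already scales with
    \<open>c\<close>, hence the division; on \<open>J\<close> the direction \<nu> stays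
    fixed.\<close>
  define r' :: "complex ^ 'n" where "r' = (\<chi> j. if j \<in> S - J then d / c * r $ j else d * r $ j)"
  have s1: "(\<Sum>j\<in>S - J. r' $ j * f j u) = d / c * (\<Sum>j\<in>S - J. r $ j * f j u)" for u
    unfolding sum_distrib_left by (intro sum.cong) (auto simp: r'_def)
  have s2: "(\<Sum>j\<in>S \<inter> J. r' $ j * f j u) = d * (\<Sum>j\<in>S \<inter> J. r $ j * f j u)" for u
    unfolding sum_distrib_left by (intro sum.cong) (auto simp: r'_def)
  have "stratum_data X S K J (scaleV c x) \<nu> r'"
    using dd cd X unfolding stratum_data_def s1 s2 by (auto simp: r'_def V.subspace_scale)
  moreover have "d *s l = stratum_vec S J (scaleV c x) \<nu> r'"
    using cd by (auto simp: l vec_eq_iff stratum_vec_def r'_def)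
  ultimately show "(scaleV c x, d *s l) \<in> stratum X S K J" unfolding stratum_def by blast
qed

lemma poly_curve_stratum:
  "poly_curve (\<lambda>t. (y + scaleV t u, stratum_vec S J (y + scaleV t u) (\<nu> + scaleV t v) (r + t *s q)))"
proof (rule poly_curve_vecI, goal_cases)
  case (1 \<phi>)
  show ?case
    by (rule exI[of _ "[:\<phi> y, \<phi> u:]"]) (simp add: linear_functional_simps[OF 1])
next
  case (2 j)
  let ?p = "if j \<in> S - J then [:f j y, f j u:] else if j \<in> S then [:f j \<nu>, f j v:] else 1"
  show ?case
    by (rule exI[of _ "?p * [:r $ j, q $ j:]"]) (auto simp: stratum_vec_def algebra_simps)
qed

text \<open>In the parameters \<open>(y, \<nu>, r)\<close> the conditions are linear equations
  together with finitely many forms being nonzero. A straight line between two parameter points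
  violates the latter at only finitely many places.\<close>

lemma stratum_integral:
  assumes "stratum X S K J \<noteq> {}" shows "integral_set (stratum X S K J)"
proof (rule integral_set_curvesI[OF assms])
  fix z w assume "z \<in> stratum X S K J" "w \<in> stratum X S K J"
  then obtain y \<nu> r y' \<nu>' r' where z: "z = (y, stratum_vec S J y \<nu> r)" "stratum_data X S K J y \<nu> r"
    and w: "w = (y', stratum_vec S J y' \<nu>' r')" "stratum_data X S K J y' \<nu>' r'"
    unfolding stratum_def by blast
  let ?Y = "\<lambda>t. y + scaleV t (y' - y)" and ?N = "\<lambda>t. \<nu> + scaleV t (\<nu>' - \<nu>)" and ?R = "\<lambda>t. r + t *s (r' - r)"
  let ?\<gamma> = "\<lambda>t. (?Y t, stratum_vec S J (?Y t) (?N t) (?R t))"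
  let ?A = "{t. \<exists>j\<in>insert n0 S - J. f j (?Y t) = 0} \<union> {t. \<exists>j\<in>J. f j (?N t) = 0}"
  have fin: "finite ?A"
    using z(2) by (intro finite_UnI finite_roots_all) (auto simp: stratum_data_def)
  have sum: "(\<Sum>j\<in>I. ?R t $ j * f j u) = (1 - t) * (\<Sum>j\<in>I. r $ j * f j u) + t * (\<Sum>j\<in>I. r' $ j * f j u)" for t u I
    unfolding sum_distrib_left sum.distrib[symmetric]
    by (intro sum.cong) (auto simp: algebra_simps)
  have Xl: "?Y t \<in> X \<and> ?N t \<in> X" for t
    using z(2) w(2) X unfolding stratum_data_def
    by (intro conjI V.subspace_add V.subspace_scale V.subspace_diff) auto
  have J0: "f j (?Y t) = 0" if "j \<in> J" for j t
    using z(2) w(2) that by (auto simp: stratum_data_def)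
  have "stratum_data X S K J (?Y t) (?N t) (?R t)" if t: "t \<notin> ?A" for t
    unfolding stratum_data_def sum
  proof (intro conjI ballI allI impI)
    show "?R t $ j = 0" if "j \<notin> S \<union> K" for j using z(2) w(2) that by (auto simp: stratum_data_def)
  qed (use Xl J0 t z(2) w(2) in \<open>auto simp: stratum_data_def\<close>)
  then have in_stratum: "?\<gamma> t \<in> stratum X S K J" if "t \<notin> ?A" for t
    using that unfolding stratum_def by blast
  show "\<exists>\<gamma> A. poly_curve \<gamma> \<and> \<gamma> 0 = z \<and> \<gamma> 1 = w \<and> finite A \<and>
      (\<forall>t. t \<notin> A \<longrightarrow> \<gamma> t \<in> stratum X S K J)"
  proof (rule exI[of _ ?\<gamma>], rule exI[of _ ?A], intro conjI allI impI)
    show "?\<gamma> 0 = z" "?\<gamma> 1 = w" by (simp_all add: z(1) w(1))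
  qed (fact poly_curve_stratum fin in_stratum | rule in_stratum, assumption)+
qed

text \<open>
  Move from \<open>y\<close> in the direction \<open>\<nu>\<close>; the coefficients in \<open>J\<close> are corrected by bounded terms \<open>c\<close>
  that cancel the contribution of the other hyperplanes.
\<close>

lemma stratum_subset_closure:
  assumes J: "J \<subseteq> insert n0 S"
  shows "stratum X S K J \<subseteq> zariski_closure (crit X S K)"
proof
  fix z assume "z \<in> stratum X S K J"
  then obtain y \<nu> r where z: "z = (y, stratum_vec S J y \<nu> r)" and d: "stratum_data X S K J y \<nu> r"
    unfolding stratum_def by blast
  define U where "U = X \<inter> {u. f n0 u = 0}"
  have U: "V.subspace U" using X by (auto simp: U_def V.subspace_def)
  let ?b = "\<lambda>u. \<Sum>j\<in>S - J. r $ j * f j u"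
  have b: "Vector_Spaces.linear scaleV (*) ?b"
    by (rule linear_functionalI[OF V.vector_space_axioms])
      (simp_all add: sum.distrib sum_distrib_left algebra_simps)
  \<comment> \<open>On directions annihilated by all of \<open>J\<close> the contribution
    \<open>?b\<close> is zero, by the first sum condition of \<open>stratum_data\<close>; so it is a
    combination of the \<open>f j\<close> in \<open>J\<close>.\<close>
  have "\<exists>c. \<forall>u\<in>U. ?b u = (\<Sum>j\<in>S \<inter> J. c j * f j u)"
  proof (rule linear_combination_of_functionals[OF V.vector_space_axioms _ U b f_linear])
    fix u assume u: "u \<in> U" "\<And>j. j \<in> S \<inter> J \<Longrightarrow> f j u = 0"
    then have "\<forall>j\<in>J. f j u = 0" using J by (auto simp: U_def)
    then show "?b u = 0" using d u(1) by (simp add: stratum_data_def U_def)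
  qed simp
  then obtain c where c: "\<forall>u\<in>U. ?b u = (\<Sum>j\<in>S \<inter> J. c j * f j u)" by blast
  let ?x = "\<lambda>t. y + scaleV t \<nu>"
  \<comment> \<open>On \<open>J\<close> the quotient of the coordinate by \<open>f j (?x t)\<close>
    is \<open>r $ j / t - c j\<close>. The polar part sums to zero by the condition on
    \<open>S \<inter> J\<close>, and the rest cancels \<open>?b\<close>.\<close>
  let ?l = "\<lambda>t. (\<chi> j. if j \<in> S - J then f j (?x t) * r $ j
    else if j \<in> S then f j \<nu> * (r $ j - t * c j) else r $ j) :: complex ^ 'n"
  let ?A = "insert 0 {t. \<exists>j\<in>insert n0 S - J. f j (?x t) = 0}"
  have fin: "finite ?A"
    using d by (intro finite.insertI finite_roots_all) (auto simp: stratum_data_def)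
  have curve: "poly_curve (\<lambda>t. (?x t, ?l t))"
  proof (rule poly_curve_vecI, goal_cases)
    case (1 \<phi>)
    show ?case
      by (rule exI[of _ "[:\<phi> y, \<phi> \<nu>:]"]) (simp add: linear_functional_simps[OF 1])
  next
    case (2 j)
    let ?p = "if j \<in> S - J then [:f j y, f j \<nu>:] * [:r $ j:]
      else if j \<in> S then [:f j \<nu>:] * [:r $ j, - c j:] else [:r $ j:]"
    show ?case by (rule exI[of _ ?p]) (auto simp: algebra_simps)
  qed
  have "(?x t, ?l t) \<in> crit X S K" if t: "t \<notin> ?A" for t
  proof -
    have xJ: "f j (?x t) = t * f j \<nu>" "f j \<nu> \<noteq> 0" if "j \<in> J" for j
      using d that by (auto simp: stratum_data_def)
    have t0: "t \<noteq> 0" using t by simp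
    have "(\<Sum>j\<in>S. ?l t $ j * (f j u / f j (?x t))) = 0" if u: "u \<in> X" "f n0 u = 0" for u
    proof -
      have "(\<Sum>j\<in>S. ?l t $ j * (f j u / f j (?x t))) =
        (\<Sum>j\<in>S - J. ?l t $ j * (f j u / f j (?x t))) + (\<Sum>j\<in>S \<inter> J. ?l t $ j * (f j u / f j (?x t)))"
        by (subst sum.union_disjoint[symmetric]) (auto intro: sum.cong)
      also have "(\<Sum>j\<in>S - J. ?l t $ j * (f j u / f j (?x t))) = ?b u"
        by (intro sum.cong) (use t in auto)
      also have "(\<Sum>j\<in>S \<inter> J. ?l t $ j * (f j u / f j (?x t))) =
          (\<Sum>j\<in>S \<inter> J. 1 / t * (r $ j * f j u) - c j * f j u)"
      proof (intro sum.cong refl)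
        fix j assume j: "j \<in> S \<inter> J"
        then show "?l t $ j * (f j u / f j (?x t)) = 1 / t * (r $ j * f j u) - c j * f j u"
          using xJ[of j] t0 by (simp add: field_simps)
      qed
      also have "\<dots> = 1 / t * (\<Sum>j\<in>S \<inter> J. r $ j * f j u) - (\<Sum>j\<in>S \<inter> J. c j * f j u)"
        by (simp add: sum_subtractf sum_distrib_left)
      also have "(\<Sum>j\<in>S \<inter> J. r $ j * f j u) = 0" using d u by (simp add: stratum_data_def)
      also have "(\<Sum>j\<in>S \<inter> J. c j * f j u) = ?b u" using c u by (simp add: U_def)
      finally show ?thesis by simp
    qed
    moreover have "f j (?x t) \<noteq> 0" if "j \<in> insert n0 S" for j
      using t t0 xJ[of j] that by (cases "j \<in> J") auto
    moreover have "?x t \<in> X" using d X by (auto simp: stratum_data_def intro: V.subspace_add V.subspace_scale)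
    moreover have "?l t $ j = 0" if "j \<notin> S \<union> K" for j using d that by (auto simp: stratum_data_def)
    ultimately show ?thesis unfolding crit_def by blast
  qed
  then have "(?x 0, ?l 0) \<in> zariski_closure (crit X S K)"
    by (intro poly_curve_closure[OF curve fin])
  moreover have "?l 0 = stratum_vec S J y \<nu> r" by (auto simp: vec_eq_iff stratum_vec_def)
  ultimately show "z \<in> zariski_closure (crit X S K)" unfolding z by simp
qed

text \<open>
  Conversely, the rational map \<open>\<theta>\<close> below retracts \<open>crit X S K\<close> onto the stratum and fixes the limit
  points lying over it.
\<close>

lemma closure_crit_in_stratum:
  assumes J: "J \<subseteq> insert n0 S" and cl: "(x0, l0) \<in> zariski_closure (crit X S K)"
    and x0: "x0 \<in> X" "\<And>j. j \<in> J \<Longrightarrow> f j x0 = 0" "\<And>j. j \<in> insert n0 S - J \<Longrightarrow> f j x0 \<noteq> 0"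
  shows "(x0, l0) \<in> zariski_closure (stratum X S K J)"
proof (rule closureI)
  fix F assume F: "F \<in> poly_funs" "vanish F (stratum X S K J)"
  define U where "U = X \<inter> {u. f n0 u = 0}"
  define Y where "Y = X \<inter> {u. \<forall>j\<in>J. f j u = 0}"
  have sub: "V.subspace U" "V.subspace Y" "V.subspace (U \<inter> Y)"
    using X by (auto simp: U_def Y_def V.subspace_def)
  obtain P where P: "Vector_Spaces.linear scaleV scaleV P" "\<And>x. P x \<in> Y" "\<And>y. y \<in> Y \<Longrightarrow> P y = y"
    using ex_linear_projection[OF V.vector_space_axioms sub(2)] by blast
  obtain P' where P': "Vector_Spaces.linear scaleV scaleV P'" "\<And>x. P' x \<in> U \<inter> Y" "\<And>y. y \<in> U \<inter> Y \<Longrightarrow> P' y = y"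
    using ex_linear_projection[OF V.vector_space_axioms sub(3)] by blast
  \<comment> \<open>\<open>u - P' u\<close> vanishes on directions lying in \<open>Y\<close>. The
    coefficients found here transfer the contribution of a hyperplane outside \<open>J\<close> to
    the hyperplanes in \<open>J\<close>.\<close>
  have "\<exists>c. \<forall>u\<in>U. f i (u - P' u) = (\<Sum>j\<in>S \<inter> J. c j * f j u)" for i
  proof (rule linear_combination_of_functionals[OF V.vector_space_axioms _ sub(1) _ f_linear])
    have fP': "Vector_Spaces.linear scaleV (*) (\<lambda>u. f i (P' u))"
      using Vector_Spaces.linear_compose[OF P'(1) f_linear[of i]] by (simp add: o_def)
    show "Vector_Spaces.linear scaleV (*) (\<lambda>u. f i (u - P' u))"
      by (rule linear_functionalI[OF V.vector_space_axioms])
        (simp_all add: linear_functional_simps[OF fP'] algebra_simps)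
    fix u assume u: "u \<in> U" "\<And>j. j \<in> S \<inter> J \<Longrightarrow> f j u = 0"
    then have "u \<in> U \<inter> Y" using J by (auto simp: U_def Y_def)
    then show "f i (u - P' u) = 0" using P'(3) by simp
  qed simp
  then obtain c where c: "\<And>i u. u \<in> U \<Longrightarrow> f i (u - P' u) = (\<Sum>j\<in>S \<inter> J. c i j * f j u)" by metis
  \<comment> \<open>\<sigma> is the correction after which the coefficients in \<open>J\<close>
    satisfy their own relation. The image of \<theta> has parameters \<nu>\<open>= x\<close> and
    \<open>r\<close> equal to \<open>l $ j / f j x\<close>, plus \<sigma> for \<open>j\<close> in
    \<open>S \<inter> J\<close>.\<close>
  define \<sigma> where "\<sigma> x l j = (\<Sum>i\<in>S - J. c i j * (l $ i / f i x))" for x :: 'v and l :: "complex ^ 'n" and j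
  define \<theta> where "\<theta> z = (P (fst z), (\<chi> j. if j \<in> S - J then f j (P (fst z)) * snd z $ j / f j (fst z)
     else if j \<in> S then snd z $ j + f j (fst z) * \<sigma> (fst z) (snd z) j else snd z $ j) :: complex ^ 'n)" for z
  define g where "g = (\<lambda>z :: 'v \<times> (complex ^ 'n). \<Prod>i\<in>S - J. f i (fst z))"
  define T where "T = {z :: 'v \<times> (complex ^ 'n). \<forall>i\<in>S - J. f i (fst z) \<noteq> 0}"
  have g: "g \<in> poly_funs" unfolding g_def by (intro pf_prod pf_f)
  have fP: "Vector_Spaces.linear scaleV (*) (\<lambda>x. \<phi> (P x))" if "Vector_Spaces.linear scaleV (*) \<phi>" for \<phi>
    using Vector_Spaces.linear_compose[OF P(1) that] by (simp add: o_def)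
  have div: "regular_fun T g (\<lambda>z s. h z s / f i (fst z))" if "regular_fun T g h" "i \<in> S - J" for h i
  proof (rule regular_fun_divide[OF g that(1)])
    show "(\<lambda>z. \<Prod>j\<in>S - J - {i}. f j (fst z)) \<in> poly_funs" by (intro pf_prod pf_f)
    show "f i (fst z) \<noteq> 0 \<and> g z = f i (fst z) * (\<Prod>j\<in>S - J - {i}. f j (fst z))" if "z \<in> T" for z
      using that \<open>i \<in> S - J\<close> by (auto simp: T_def g_def intro!: prod.remove)
  qed
  have reg: "regular_curves T g (\<lambda>z s. \<theta> z)"
  proof (rule regular_curves_vecI[OF g], goal_cases)
    case (1 \<phi>)
    show ?case unfolding \<theta>_def fst_conv by (intro regular_fun_pf poly_funs.fst fP 1)
  next
    case (2 j)
    have \<sigma>: "regular_fun T g (\<lambda>z s. \<sigma> (fst z) (snd z) k)" for k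
      unfolding \<sigma>_def
      by (intro regular_fun_sum[OF g] regular_fun_mult[OF g] regular_fun_const div regular_fun_pf pf_coordinate)
    have "regular_fun T g (\<lambda>z s. f j (P (fst z)) * snd z $ j / f j (fst z))" if "j \<in> S - J"
      by (intro div regular_fun_mult[OF g] regular_fun_pf pf_coordinate poly_funs.fst fP f_linear that)
    moreover have "regular_fun T g (\<lambda>z s. snd z $ j + f j (fst z) * \<sigma> (fst z) (snd z) j)"
      by (intro regular_fun_add[OF g] regular_fun_mult[OF g] regular_fun_pf pf_coordinate pf_f \<sigma>)
    moreover have "regular_fun T g (\<lambda>z s. snd z $ j)" by (intro regular_fun_pf pf_coordinate)
    ultimately show ?case unfolding \<theta>_def snd_conv vec_lambda_beta
      by (cases "j \<in> S - J"; cases "j \<in> S") simp_all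
  qed
  obtain N p where p: "p \<in> poly_family" "\<And>z s. z \<in> T \<Longrightarrow> g z ^ N * F (\<theta> z) = poly (p z) s"
    using regular_curves_pf[OF F(1) reg] unfolding regular_fun_def by blast
  \<comment> \<open>The coefficient clears the denominators of \<theta>; the product discards the
    points whose projection \<open>P x\<close> meets a hyperplane outside \<open>J\<close>, where
    \<theta> leaves the stratum.\<close>
  define G where "G = (\<lambda>z :: 'v \<times> (complex ^ 'n). coeff (p z) 0 * (\<Prod>j\<in>insert n0 S - J. f j (P (fst z))))"
  have G: "G \<in> poly_funs"
    unfolding G_def by (intro poly_funs.mult poly_family_coeff p pf_prod poly_funs.fst fP f_linear)
  have pc: "coeff (p z) 0 = g z ^ N * F (\<theta> z)" if "z \<in> T" for z
    using p(2)[OF that, of 0] by (simp add: poly_0_coeff_0)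
  have \<theta>_stratum: "\<theta> z \<in> stratum X S K J"
    if z: "z \<in> crit X S K" and nz: "\<And>j. j \<in> insert n0 S - J \<Longrightarrow> f j (P (fst z)) \<noteq> 0" for z
  proof -
    obtain x l where xl: "z = (x, l)" by (cases z)
    have cr: "x \<in> X" "\<forall>j\<in>insert n0 S. f j x \<noteq> 0" "\<forall>j. j \<notin> S \<union> K \<longrightarrow> l $ j = 0"
      "\<And>u. u \<in> X \<Longrightarrow> f n0 u = 0 \<Longrightarrow> (\<Sum>j\<in>S. l $ j * (f j u / f j x)) = 0"
      using z unfolding xl crit_def by auto
    define r :: "complex ^ 'n" where "r = (\<chi> j. if j \<in> S - J then l $ j / f j x
      else if j \<in> S then l $ j / f j x + \<sigma> x l j else l $ j)"
    have split: "(\<Sum>j\<in>S - J. l $ j * (f j u / f j x)) + (\<Sum>j\<in>S \<inter> J. l $ j * (f j u / f j x)) = 0"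
      if "u \<in> U" for u
    proof -
      have "(\<Sum>j\<in>S - J. l $ j * (f j u / f j x)) + (\<Sum>j\<in>S \<inter> J. l $ j * (f j u / f j x)) =
        (\<Sum>j\<in>S. l $ j * (f j u / f j x))"
        by (subst sum.union_disjoint[symmetric]) (auto intro: sum.cong)
      then show ?thesis using cr(4)[of u] that by (simp add: U_def)
    qed
    have out: "(\<Sum>j\<in>S - J. l $ j * (f j u / f j x)) = 0" if u: "u \<in> U" "\<forall>j\<in>J. f j u = 0" for u
    proof -
      have "(\<Sum>j\<in>S \<inter> J. l $ j * (f j u / f j x)) = 0" by (intro sum.neutral) (use u in auto)
      then show ?thesis using split[OF u(1)] by simp
    qed
    have inn: "(\<Sum>j\<in>S \<inter> J. r $ j * f j u) = 0" if u: "u \<in> U" for u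
    proof -
      have "(\<Sum>j\<in>S \<inter> J. \<sigma> x l j * f j u) = (\<Sum>i\<in>S - J. l $ i / f i x * (\<Sum>j\<in>S \<inter> J. c i j * f j u))"
        unfolding \<sigma>_def sum_distrib_right sum_distrib_left
        by (subst sum.swap) (intro sum.cong refl, simp)
      also have "\<dots> = (\<Sum>i\<in>S - J. l $ i / f i x * (f i u - f i (P' u)))"
        using c[OF u] by simp
      also have "\<dots> = (\<Sum>i\<in>S - J. l $ i * (f i u / f i x)) - (\<Sum>i\<in>S - J. l $ i * (f i (P' u) / f i x))"
        unfolding sum_subtractf[symmetric] by (intro sum.cong refl) (simp add: algebra_simps diff_divide_distrib)
      also have "(\<Sum>i\<in>S - J. l $ i * (f i (P' u) / f i x)) = 0"
        using P'(2)[of u] by (intro out) (auto simp: Y_def)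
      finally have "(\<Sum>j\<in>S \<inter> J. \<sigma> x l j * f j u) = (\<Sum>i\<in>S - J. l $ i * (f i u / f i x))" by simp
      moreover have "(\<Sum>j\<in>S \<inter> J. r $ j * f j u) =
          (\<Sum>j\<in>S \<inter> J. l $ j * (f j u / f j x)) + (\<Sum>j\<in>S \<inter> J. \<sigma> x l j * f j u)"
        unfolding sum.distrib[symmetric] by (intro sum.cong refl) (auto simp: r_def algebra_simps)
      ultimately show ?thesis using split[OF u] by (simp add: add.commute)
    qed
    have "(\<Sum>j\<in>S - J. r $ j * f j u) = (\<Sum>j\<in>S - J. l $ j * (f j u / f j x))" for u
      by (intro sum.cong) (auto simp: r_def)
    then have "stratum_data X S K J (P x) x r"
      unfolding stratum_data_def
      using P(2)[of x] cr J nz inn out by (auto simp: Y_def U_def xl r_def)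
    moreover have "snd (\<theta> z) = stratum_vec S J (P x) x r"
      using cr(2) by (auto simp: vec_eq_iff \<theta>_def stratum_vec_def xl r_def algebra_simps)
    moreover have "fst (\<theta> z) = P x" by (simp add: \<theta>_def xl)
    ultimately show ?thesis unfolding stratum_def by (metis (mono_tags, lifting) mem_Collect_eq prod.collapse)
  qed
  have "vanish G (crit X S K)"
    unfolding vanish_def
  proof
    fix z assume z: "z \<in> crit X S K"
    show "G z = 0"
    proof (cases "\<forall>j\<in>insert n0 S - J. f j (P (fst z)) \<noteq> 0")
      case True
      then have "F (\<theta> z) = 0" using \<theta>_stratum[OF z] F(2) by (simp add: vanish_def)
      moreover have "z \<in> T" using z by (auto simp: T_def crit_def)
      ultimately show ?thesis using pc by (simp add: G_def)
    next
      case False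
      then have "(\<Prod>j\<in>insert n0 S - J. f j (P (fst z))) = 0" by (intro prod_zero) auto
      then show ?thesis by (simp add: G_def)
    qed
  qed
  then have G0: "G (x0, l0) = 0" by (rule closureD[OF cl G])
  have Px0: "P x0 = x0" using P(3) x0 by (simp add: Y_def)
  have T0: "(x0, l0) \<in> T" using x0(3) by (auto simp: T_def)
  \<comment> \<open>\<open>P\<close> fixes \<open>x0\<close>, and the correction \<sigma> carries
    the factor \<open>f j x0\<close>, which is zero on \<open>J\<close>.\<close>
  have "\<theta> (x0, l0) = (x0, l0)" using x0 by (auto simp: \<theta>_def Px0 vec_eq_iff)
  moreover have "(\<Prod>j\<in>insert n0 S - J. f j (P x0)) \<noteq> 0" using x0(3) by (simp add: Px0)
  moreover have "g (x0, l0) \<noteq> 0" using x0(3) by (simp add: g_def)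
  ultimately show "F (x0, l0) = 0" using G0 pc[OF T0] by (simp add: G_def)
qed

end

end

section \<open>Tests on dense open parts, and change of local parameter\<close>

context biprojective
begin

text \<open>If \<open>F\<close> vanishes on \<open>C\<close>, then \<open>F h\<close> vanishes on
  \<open>D\<close>, and irreducibility of \<open>D\<close> removes \<open>h\<close>. So inclusion
  need only be checked where \<open>h\<close> is nonzero.\<close>

lemma subvariety_subset_projI:
  assumes D: "subvariety D" and h: "bihom a b h" "\<not> vanishes_on h D" and C: "biconical C"
    and in_C: "\<And>x y. x \<noteq> 0 \<Longrightarrow> y \<noteq> 0 \<Longrightarrow> pt x y \<in> D \<Longrightarrow> h (x, y) \<noteq> 0 \<Longrightarrow> (x, y) \<in> zariski_closure C"
  shows "D \<subseteq> proj C"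
proof
  fix p assume p: "p \<in> D"
  then obtain x y where xy: "p = pt x y" "x \<noteq> 0" "y \<noteq> 0"
    using D unfolding subvariety_def closed_set_def proj_image_def by auto
  have "(x, y) \<in> zariski_closure C"
  proof (rule closure_biconicalI[OF C])
    fix c d F assume F: "bihom c d F" "vanish F C"
    have "vanishes_on (\<lambda>z. F z * h z) D"
    proof (rule vanishes_onI)
      fix x y assume xy: "x \<noteq> 0" "y \<noteq> 0" "pt x y \<in> D"
      show "F (x, y) * h (x, y) = 0"
        using closureD[OF in_C[OF xy] bihom_pf[OF F(1)] F(2)] by (cases "h (x, y) = 0") auto
    qed
    then have "vanishes_on F D" using vanishes_on_prod[OF D F(1) h(1)] h(2) by blast
    then show "F (x, y) = 0" by (rule vanishes_onD) (use xy p in auto)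
  qed
  then show "p \<in> proj C" using pt_in_proj[OF C xy(2,3)] xy(1) by simp
qed

text \<open>Parameters that differ by a quotient of units along \<open>D\<close> certify the same
  valuation. Along the restriction the natural parameter is \<open>f i\<close>, while the section in
  question is a coordinate.\<close>

lemma chart_change_parameter:
  assumes D: "integral_set D" and w: "w \<in> poly_funs" "\<not> vanish w D" and w': "w' \<in> poly_funs" "\<not> vanish w' D"
    and e: "\<And>z. z \<in> Z \<Longrightarrow> w z * \<pi> z = w' z * u z"
    and ex: "\<exists>k G H. G \<in> poly_funs \<and> H \<in> poly_funs \<and> \<not> vanish G D \<and> \<not> vanish H D \<and>
        (\<forall>z\<in>Z. G z * F z = u z ^ k * H z)"
  shows "\<exists>k G H. G \<in> poly_funs \<and> H \<in> poly_funs \<and> \<not> vanish G D \<and> \<not> vanish H D \<and>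
        (\<forall>z\<in>Z. G z * F z = \<pi> z ^ k * H z)"
proof -
  obtain k G H where GH: "G \<in> poly_funs" "H \<in> poly_funs" "\<not> vanish G D" "\<not> vanish H D"
    "\<forall>z\<in>Z. G z * F z = u z ^ k * H z" using ex by blast
  have "w' z ^ k * G z * F z = \<pi> z ^ k * (w z ^ k * H z)" if z: "z \<in> Z" for z
  proof -
    have "w' z ^ k * G z * F z = (w' z * u z) ^ k * H z"
      using GH(5) z by (simp add: power_mult_distrib)
    also have "\<dots> = \<pi> z ^ k * (w z ^ k * H z)"
      unfolding e[OF z, symmetric] by (simp add: power_mult_distrib)
    finally show ?thesis .
  qed
  moreover have "(\<lambda>z. w' z ^ k * G z) \<in> poly_funs" "(\<lambda>z. w z ^ k * H z) \<in> poly_funs"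
    by (intro poly_funs.mult pf_power w w' GH)+
  moreover have "\<not> vanish (\<lambda>z. w' z ^ k * G z) D"
    using integral_set_mult[OF D pf_power[OF w'(1)] GH(1), of k] GH(3) w'(2) vanish_power by blast
  moreover have "\<not> vanish (\<lambda>z. w z ^ k * H z) D"
    using integral_set_mult[OF D pf_power[OF w(1)] GH(2), of k] GH(4) w(2) vanish_power by blast
  ultimately show ?thesis
    by (intro exI[of _ k] exI[of _ "\<lambda>z. w' z ^ k * G z"] exI[of _ "\<lambda>z. w z ^ k * H z"]) simp
qed

end

context arrangement
begin

lemma crit_integral: "V.subspace X \<Longrightarrow> crit X S K \<noteq> {} \<Longrightarrow> integral_set (crit X S K)"
  unfolding crit_eq_stratum by (rule stratum_integral)

lemma crit_biconical: "V.subspace X \<Longrightarrow> biconical (crit X S K)"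
  unfolding crit_eq_stratum by (rule stratum_biconical)

lemma closure_crit_subspace:
  assumes X: "V.subspace X" and cl: "(x, l) \<in> zariski_closure (crit X S K)"
  shows "x \<in> X"
proof (rule ccontr)
  assume "x \<notin> X"
  then obtain \<phi> where \<phi>: "Vector_Spaces.linear scaleV (*) \<phi>" "\<forall>x\<in>X. \<phi> x = 0" "\<phi> x = 1"
    using ex_linear_functional[OF V.vector_space_axioms X] by blast
  have "vanish (\<lambda>z. \<phi> (fst z)) (crit X S K)" using \<phi>(2) by (auto simp: vanish_def crit_def)
  then have "\<phi> (fst (x, l)) = 0" by (rule closureD[OF cl poly_funs.fst[OF \<phi>(1)]])
  then show False using \<phi>(3) by simp
qed

text \<open>Multiplied by the product of all \<open>f k\<close>, the equations of
  \<open>crit\<close> are polynomial and pass to the closure; off the hyperplanes the factor can be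
  removed again.\<close>

lemma crit_closed_in_complement:
  assumes X: "V.subspace X" and cl: "(x, l) \<in> zariski_closure (crit X S K)"
    and x: "\<And>j. j \<in> insert n0 S \<Longrightarrow> f j x \<noteq> 0"
  shows "(x, l) \<in> crit X S K"
proof -
  have "(\<Sum>j\<in>S. l $ j * (f j u / f j x)) = 0" if u: "u \<in> X" "f n0 u = 0" for u
  proof -
    let ?G = "\<lambda>z :: 'v \<times> (complex ^ 'n). \<Sum>j\<in>S. snd z $ j * f j u * (\<Prod>k\<in>S - {j}. f k (fst z))"
    have e: "?G (x, l) = (\<Prod>k\<in>S. f k x) * (\<Sum>j\<in>S. l $ j * (f j u / f j x))"
      if "\<And>j. j \<in> S \<Longrightarrow> f j x \<noteq> 0" for x l
      unfolding sum_distrib_left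
    proof (intro sum.cong refl)
      fix j assume j: "j \<in> S"
      have "(\<Prod>k\<in>S. f k x) = f j x * (\<Prod>k\<in>S - {j}. f k x)" by (rule prod.remove) (use j in auto)
      then show "snd (x, l) $ j * f j u * (\<Prod>k\<in>S - {j}. f k (fst (x, l))) =
          (\<Prod>k\<in>S. f k x) * (l $ j * (f j u / f j x))" using that[OF j] by simp
    qed
    have "?G \<in> poly_funs" by (intro pf_sum poly_funs.mult pf_prod pf_f pf_coordinate poly_funs.const)
    moreover have "vanish ?G (crit X S K)"
      unfolding vanish_def
    proof
      fix z assume "z \<in> crit X S K"
      then obtain x l where z: "z = (x, l)" "\<forall>j\<in>S. f j x \<noteq> 0" "(\<Sum>j\<in>S. l $ j * (f j u / f j x)) = 0"
        using u by (auto simp: crit_def)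
      show "?G z = 0" unfolding z(1) using e[of x l] z(2,3) by simp
    qed
    ultimately have "?G (x, l) = 0" by (rule closureD[OF cl])
    moreover have "(\<Prod>k\<in>S. f k x) \<noteq> 0" using x by simp
    ultimately show ?thesis using e[of x l] x by simp
  qed
  moreover have "l $ j = 0" if "j \<notin> S \<union> K" for j
  proof -
    have "vanish (\<lambda>z. snd z $ j) (crit X S K)" using that by (auto simp: vanish_def crit_def)
    then have "snd (x, l) $ j = 0" by (rule closureD[OF cl pf_coordinate])
    then show ?thesis by simp
  qed
  ultimately show ?thesis
    using closure_crit_subspace[OF X cl] x by (auto simp: crit_def)
qed

lemma prod_f_nonvanishing:
  assumes "subvariety D" "\<And>j. j \<in> J \<Longrightarrow> \<not> vanishes_on (\<lambda>z. f j (fst z)) D"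
  shows "bihom (card J) 0 (\<lambda>z. \<Prod>j\<in>J. f j (fst z)) \<and> \<not> vanishes_on (\<lambda>z. \<Prod>j\<in>J. f j (fst z)) D"
proof -
  have "finite J" by simp
  then show ?thesis
    using assms(2)
  proof (induction J)
    case empty
    then show ?case using bihom_const vanishes_on_1[OF assms(1)] by simp
  next
    case (insert i J)
    have IH: "bihom (card J) 0 (\<lambda>z. \<Prod>j\<in>J. f j (fst z))" "\<not> vanishes_on (\<lambda>z. \<Prod>j\<in>J. f j (fst z)) D"
      using insert by auto
    have "bihom (1 + card J) (0 + 0) (\<lambda>z. f i (fst z) * (\<Prod>j\<in>J. f j (fst z)))"
      by (rule bihom_mult[OF bihom_f IH(1)])
    moreover have "\<not> vanishes_on (\<lambda>z. f i (fst z) * (\<Prod>j\<in>J. f j (fst z))) D"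
      using vanishes_on_prod[OF assms(1) bihom_f IH(1)] IH(2) insert.prems by blast
    ultimately show ?case using insert.hyps by simp
  qed
qed

subsection \<open>The divisor of a coordinate\<close>

context
  fixes X :: "'v set" and S K :: "'n set" and i :: 'n and x0 u0 :: 'v and \<rho> :: "complex ^ 'n"
  assumes X: "V.subspace X" and x0: "x0 \<in> X" "\<And>j. j \<in> insert n0 S \<Longrightarrow> f j x0 \<noteq> 0"
    and i: "i \<in> S" "i \<notin> K" "n0 \<notin> S"
    and u0: "u0 \<in> X" "f n0 u0 = 0" "f i u0 = 1"
    and \<rho>: "\<And>u. u \<in> X \<Longrightarrow> f n0 u = 0 \<Longrightarrow> (\<Sum>j\<in>S. \<rho> $ j * f j u) = 0" "\<And>j. j \<notin> S \<Longrightarrow> \<rho> $ j = 0" "\<rho> $ i = 1"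
begin

abbreviation Xi :: "'v set" where "Xi \<equiv> X \<inter> {x. f i x = 0}"
abbreviation crit_del :: "('v \<times> (complex ^ 'n)) set" where "crit_del \<equiv> crit X (S - {i}) K"
abbreviation crit_res :: "('v \<times> (complex ^ 'n)) set" where "crit_res \<equiv> crit Xi (S - {i}) K"

lemma Xi: "V.subspace Xi"
  using X by (auto simp: V.subspace_def)

lemma sum_remove_i: "(\<Sum>j\<in>S. h j) = h i + (\<Sum>j\<in>S - {i}. h j)" for h :: "'n \<Rightarrow> complex"
  by (rule sum.remove) (use i in auto)

text \<open>The relation \<rho> among the \<open>f j\<close> on directions parallel to infinity
  gives a tangent direction of the fibre of \<open>crit X S K\<close> over \<open>x\<close>. It
  moves coordinate \<open>i\<close> by \<open>f i x\<close>, since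
  \<rho>\<open>$ i = 1\<close>.\<close>

definition relation_vec :: "'v \<Rightarrow> complex ^ 'n" where
  "relation_vec x = (\<chi> j. f j x * \<rho> $ j)"

lemma crit_add_relation:
  assumes "(x, l) \<in> crit X S K" shows "(x, l + c *s relation_vec x) \<in> crit X S K"
proof -
  have x: "x \<in> X" "\<forall>j\<in>insert n0 S. f j x \<noteq> 0" "\<forall>j. j \<notin> S \<union> K \<longrightarrow> l $ j = 0"
    "\<And>u. u \<in> X \<Longrightarrow> f n0 u = 0 \<Longrightarrow> (\<Sum>j\<in>S. l $ j * (f j u / f j x)) = 0"
    using assms by (auto simp: crit_def)
  have "(\<Sum>j\<in>S. (l + c *s relation_vec x) $ j * (f j u / f j x)) = 0" if u: "u \<in> X" "f n0 u = 0" for u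
  proof -
    have "(\<Sum>j\<in>S. (l + c *s relation_vec x) $ j * (f j u / f j x)) =
        (\<Sum>j\<in>S. l $ j * (f j u / f j x) + c * (\<rho> $ j * f j u))"
      by (intro sum.cong refl) (use x in \<open>auto simp: relation_vec_def field_simps\<close>)
    also have "\<dots> = 0"
      using x(4)[OF u] \<rho>(1)[OF u] by (simp add: sum.distrib flip: sum_distrib_left)
    finally show ?thesis .
  qed
  then show ?thesis using x \<rho>(2) by (auto simp: crit_def relation_vec_def)
qed

lemma crit_zero: "(x0, 0) \<in> crit X S K"
  using x0 by (auto simp: crit_def)

lemma crit_nonempty: "crit X S K \<noteq> {}"
  using crit_zero by blast

lemma crit_relation: "(x0, relation_vec x0) \<in> crit X S K"
  using crit_add_relation[OF crit_zero, of 1] by simp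

lemma crit_nondegenerate: "nondegenerate (crit X S K)"
proof -
  have "relation_vec x0 $ i \<noteq> 0" using x0 i \<rho>(3) by (simp add: relation_vec_def)
  then have "relation_vec x0 \<noteq> 0" by auto
  moreover have "x0 \<noteq> 0" using x0(2)[of n0] by auto
  ultimately show ?thesis using crit_relation unfolding nondegenerate_def by blast
qed

lemmas crit_props = crit_biconical[OF X, of S K] crit_integral[OF X crit_nonempty] crit_nondegenerate

lemma coordinate_not_vanish: "\<not> vanish (\<lambda>z. snd z $ i) (crit X S K)"
proof
  assume "vanish (\<lambda>z. snd z $ i) (crit X S K)"
  then have "relation_vec x0 $ i = 0" using crit_relation by (force simp: vanish_def)
  then show False using x0 i \<rho>(3) by (simp add: relation_vec_def)
qed

lemma del_zero: "(x0, 0) \<in> crit_del"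
  using x0 by (auto simp: crit_def)

lemma del_integral: "integral_set crit_del"
  using crit_integral[OF X] del_zero by blast

lemma del_i_0: "z \<in> crit_del \<Longrightarrow> snd z $ i = 0"
  using i by (auto simp: crit_def)

lemma del_in_crit: "z \<in> crit_del \<Longrightarrow> f i (fst z) \<noteq> 0 \<Longrightarrow> z \<in> crit X S K"
  using i by (auto simp: crit_def sum_remove_i)

lemma crit_in_del:
  assumes "z \<in> crit X S K" "snd z $ i = 0" shows "z \<in> crit_del"
  using assms i by (auto simp: crit_def sum_remove_i)

text \<open>The deletion also has points over the hyperplane \<open>i\<close>; its part off this
  hyperplane is dense and consists of points of \<open>crit X S K\<close>.\<close>

lemma del_subset_closure: "crit_del \<subseteq> zariski_closure (crit X S K)"
proof -
  have nv: "\<not> vanish (\<lambda>z. f i (fst z)) crit_del"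
    using del_zero x0(2)[of i] i by (force simp: vanish_def)
  have "{z\<in>crit_del. f i (fst z) \<noteq> 0} \<subseteq> zariski_closure (crit X S K)"
    using del_in_crit closure_subset[of "crit X S K"] by blast
  then have "zariski_closure {z\<in>crit_del. f i (fst z) \<noteq> 0} \<subseteq> zariski_closure (crit X S K)"
    by (rule closure_minimal)
  then show ?thesis using closure_open_subset[OF del_integral pf_f nv] by blast
qed

lemma uniformizer_del:
  assumes nd: "nondegenerate crit_del"
  shows "uniformizer 0 1 (proj (crit X S K)) (proj crit_del) (\<lambda>z. snd z $ i)"
proof (rule uniformizer_projI[OF crit_props crit_biconical[OF X] del_integral nd del_subset_closure
      bihom_coordinate _ coordinate_not_vanish])
  show van: "vanish (\<lambda>z. snd z $ i) crit_del" unfolding vanish_def using del_i_0 by blast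
  fix F assume F: "F \<in> poly_funs" "\<not> vanish F (crit X S K)"
  \<comment> \<open>Moves inside the fibre over the same \<open>x\<close> along the relation,
    normalised so that coordinate \<open>i\<close> becomes \<open>s\<close>. The denominator
    \<open>f i\<close> is a unit along the deletion.\<close>
  define \<gamma> where "\<gamma> z s = (fst z, snd z + ((s - snd z $ i) / f i (fst z)) *s relation_vec (fst z))"
    for z :: "'v \<times> (complex ^ 'n)" and s
  define T where "T = {z :: 'v \<times> (complex ^ 'n). f i (fst z) \<noteq> 0}"
  have \<gamma>i: "snd (\<gamma> z s) $ i = s" if "f i (fst z) \<noteq> 0" for z s
    using that \<rho>(3) by (simp add: \<gamma>_def relation_vec_def)
  have reg: "regular_curves T (\<lambda>z. f i (fst z)) \<gamma>"
  proof (rule regular_curves_vecI[OF pf_f], goal_cases)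
    case (1 \<phi>)
    show ?case unfolding \<gamma>_def fst_conv by (intro regular_fun_pf poly_funs.fst 1)
  next
    case (2 j)
    have "regular_fun T (\<lambda>z. f i (fst z)) (\<lambda>z s. (s - snd z $ i) / f i (fst z))"
    proof (rule regular_fun_divide[OF pf_f _ poly_funs.const[of 1]])
      show "regular_fun T (\<lambda>z. f i (fst z)) (\<lambda>z s. s - snd z $ i)"
        by (intro regular_fun_diff[OF pf_f] regular_fun_param regular_fun_pf pf_coordinate)
    qed (auto simp: T_def)
    then have "regular_fun T (\<lambda>z. f i (fst z))
      (\<lambda>z s. snd z $ j + (s - snd z $ i) / f i (fst z) * (f j (fst z) * \<rho> $ j))"
      by (intro regular_fun_add[OF pf_f] regular_fun_mult[OF pf_f] regular_fun_pf pf_coordinate pf_f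
          poly_funs.const)
    then show ?case by (simp add: \<gamma>_def relation_vec_def)
  qed
  show "\<exists>k G H. G \<in> poly_funs \<and> H \<in> poly_funs \<and> \<not> vanish G crit_del \<and> \<not> vanish H crit_del \<and>
      (\<forall>z\<in>crit X S K. G z * F z = (snd z $ i) ^ k * H z)"
  proof (rule curve_chart[OF crit_props(2) reg poly_funs.const[of 1] _ _ pf_coordinate van _ F])
    show "\<not> vanish (\<lambda>_. 1) (crit X S K)"
      using crit_zero unfolding vanish_def by (metis one_neq_zero)
    show "\<not> vanish (\<lambda>z. f i (fst z)) crit_del"
      using del_zero x0(2)[of i] i by (force simp: vanish_def)
    fix z assume z: "z \<in> crit X S K"
    then have fz: "f i (fst z) \<noteq> 0" using i by (auto simp: crit_def)
    have \<gamma>Z: "\<gamma> z s \<in> crit X S K" for s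
      unfolding \<gamma>_def by (rule crit_add_relation) (use z in simp)
    have "\<gamma> z 0 \<in> crit_del" by (rule crit_in_del[OF \<gamma>Z \<gamma>i[OF fz]])
    moreover have "fst (\<gamma> z 0) = fst z" by (simp add: \<gamma>_def)
    moreover have "\<gamma> z (snd z $ i) = z" by (simp add: \<gamma>_def)
    moreover have "\<gamma> (\<gamma> z 0) s = \<gamma> z s" for s
    proof -
      have "\<gamma> (\<gamma> z 0) s = (fst z, snd (\<gamma> z 0) + ((s - 0) / f i (fst z)) *s relation_vec (fst z))"
        unfolding \<gamma>_def[of "\<gamma> z 0" s] \<gamma>i[OF fz] by (simp add: \<gamma>_def)
      also have "\<dots> = \<gamma> z s"
        by (simp add: \<gamma>_def vec_eq_iff algebra_simps diff_divide_distrib)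
      finally show ?thesis .
    qed
    ultimately show "z \<in> T \<and> \<gamma> z 0 \<in> crit_del \<and> \<gamma> z 0 \<in> T \<and> f i (fst z) \<noteq> 0 \<and> f i (fst (\<gamma> z 0)) \<noteq> 0 \<and>
      \<gamma> z (snd z $ i) = z \<and> (\<forall>s. \<gamma> (\<gamma> z 0) s = \<gamma> z s)"
      using fz by (simp add: T_def)
  qed
qed

context
  fixes x1 assumes x1: "x1 \<in> Xi" "\<And>j. j \<in> insert n0 S - {i} \<Longrightarrow> f j x1 \<noteq> 0"
begin

lemma res_zero: "(x1, 0) \<in> crit_res"
  using x1 i by (auto simp: crit_def)

lemma res_integral: "integral_set crit_res"
  using crit_integral[OF Xi] res_zero by blast

lemma sum_without_i:
  assumes "u \<in> X" "f n0 u = 0" "f i u = 0" shows "(\<Sum>j\<in>S - {i}. \<rho> $ j * f j u) = 0"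
  using \<rho>(1)[OF assms(1,2)] assms(3) sum_remove_i[of "\<lambda>j. \<rho> $ j * f j u"] by simp

lemma res_relation: "(x1, relation_vec x1) \<in> crit_res"
proof -
  have "(\<Sum>j\<in>S - {i}. relation_vec x1 $ j * (f j u / f j x1)) = (\<Sum>j\<in>S - {i}. \<rho> $ j * f j u)" for u
    by (intro sum.cong refl) (use x1 in \<open>auto simp: relation_vec_def\<close>)
  then show ?thesis
    using x1 \<rho>(2) i sum_without_i by (auto simp: crit_def relation_vec_def)
qed

lemma sum_\<rho>_u0: "(\<Sum>j\<in>S - {i}. \<rho> $ j * f j u0) = - 1"
  using \<rho>(1)[OF u0(1,2)] u0(3) \<rho>(3) sum_remove_i[of "\<lambda>j. \<rho> $ j * f j u0"]
  by (simp add: eq_neg_iff_add_eq_0 add.commute)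

text \<open>The relation cannot consist of the term \<open>i\<close> alone: its other terms sum to
  \<open>-1\<close> at \<open>u0\<close>. So the relation vector at \<open>x1\<close> is
  nonzero.\<close>

lemma res_nondegenerate: "nondegenerate crit_res"
proof -
  have "relation_vec x1 \<noteq> 0"
  proof
    assume 0: "relation_vec x1 = 0"
    have "\<rho> $ j = 0" if "j \<in> S - {i}" for j
    proof -
      have "relation_vec x1 $ j = 0" using 0 by simp
      then show ?thesis using x1(2)[of j] that by (auto simp: relation_vec_def)
    qed
    then show False using sum_\<rho>_u0 by simp
  qed
  moreover have "n0 \<noteq> i" using i by blast
  then have "x1 \<noteq> 0" using x1(2)[of n0] by auto
  ultimately show ?thesis using res_relation unfolding nondegenerate_def by blast
qed

text \<open>A point of the restriction is approached along \<open>u0\<close>, which is parallel to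
  infinity and transversal to the hyperplane \<open>i\<close>. The relation on
  \<open>J = {i}\<close> holds because coordinate \<open>i\<close> is zero.\<close>

lemma res_subset_stratum: "crit_res \<subseteq> stratum X S K {i}"
proof
  fix z assume "z \<in> crit_res"
  then obtain y l where z: "z = (y, l)" and y: "y \<in> X" "f i y = 0" "\<And>j. j \<in> insert n0 S - {i} \<Longrightarrow> f j y \<noteq> 0"
    and l: "\<And>j. j \<notin> S - {i} \<union> K \<Longrightarrow> l $ j = 0"
      "\<And>u. u \<in> X \<Longrightarrow> f n0 u = 0 \<Longrightarrow> f i u = 0 \<Longrightarrow> (\<Sum>j\<in>S - {i}. l $ j * (f j u / f j y)) = 0"
    by (auto simp: crit_def)
  define r :: "complex ^ 'n" where "r = (\<chi> j. if j \<in> S - {i} then l $ j / f j y else l $ j)"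
  have li: "l $ i = 0" using l(1)[of i] i by simp
  have "(\<Sum>j\<in>S - {i}. r $ j * f j u) = (\<Sum>j\<in>S - {i}. l $ j * (f j u / f j y))" for u
    by (intro sum.cong) (auto simp: r_def)
  moreover have "(\<Sum>j\<in>S \<inter> {i}. r $ j * f j u) = 0" for u
    by (intro sum.neutral) (use li in \<open>auto simp: r_def\<close>)
  moreover have "r $ j = 0" if "j \<notin> S \<union> K" for j using that l(1)[of j] i by (auto simp: r_def)
  ultimately have "stratum_data X S K {i} y u0 r"
    using y l(2) u0 by (auto simp: stratum_data_def)
  moreover have "l = stratum_vec S {i} y u0 r"
    using y(3) li by (auto simp: vec_eq_iff stratum_vec_def r_def)
  ultimately show "z \<in> stratum X S K {i}" unfolding z stratum_def by blast
qed

lemma res_subset_closure: "crit_res \<subseteq> zariski_closure (crit X S K)"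
proof -
  have "{i} \<subseteq> insert n0 S" using i by simp
  from stratum_subset_closure[OF X this] res_subset_stratum show ?thesis by blast
qed

text \<open>Move \<open>x\<close> along \<open>u0\<close> and keep all quotients
  \<open>l $ j / f j x\<close>. The equation at \<open>u0\<close> determines the quotient for
  \<open>i\<close> as \<open>r z\<close> from the others, so coordinate \<open>i\<close> equals
  \<open>f i\<close> times \<open>r\<close>. Here \<open>f i\<close> is the parameter of the chart
  and \<open>r\<close> a unit along the restriction.\<close>

lemma uniformizer_res: "uniformizer 0 1 (proj (crit X S K)) (proj crit_res) (\<lambda>z. snd z $ i)"
proof (rule uniformizer_projI[OF crit_props crit_biconical[OF Xi] res_integral res_nondegenerate
      res_subset_closure bihom_coordinate _ coordinate_not_vanish])
  show "vanish (\<lambda>z. snd z $ i) crit_res" using i by (auto simp: vanish_def crit_def)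
  fix F assume F: "F \<in> poly_funs" "\<not> vanish F (crit X S K)"
  let ?S = "S - {i}"
  define x\<gamma> where "x\<gamma> x s = x + scaleV (s - f i x) u0" for x s
  define r where "r z = - (\<Sum>j\<in>?S. snd z $ j * f j u0 / f j (fst z))" for z :: "'v \<times> (complex ^ 'n)"
  define \<gamma> where "\<gamma> z s = (x\<gamma> (fst z) s, (\<chi> j. if j \<in> ?S then f j (x\<gamma> (fst z) s) * (snd z $ j / f j (fst z))
      else if j = i then s * r z else snd z $ j) :: complex ^ 'n)" for z :: "'v \<times> (complex ^ 'n)" and s
  define g where "g = (\<lambda>z :: 'v \<times> (complex ^ 'n). \<Prod>j\<in>?S. f j (fst z))"
  \<comment> \<open>The factors are the values of the \<open>f j\<close> at the foot
    \<open>x - f i x * u0\<close> of the curve; the foot must avoid the other hyperplanes.\<close>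
  define q where "q = (\<lambda>z :: 'v \<times> (complex ^ 'n). \<Prod>j\<in>?S. f j (fst z) - f i (fst z) * f j u0)"
  define w' where "w' = (\<lambda>z :: 'v \<times> (complex ^ 'n). - (\<Sum>j\<in>?S. snd z $ j * f j u0 * (\<Prod>k\<in>?S - {j}. f k (fst z))))"
  define T where "T = {z :: 'v \<times> (complex ^ 'n). \<forall>j\<in>?S. f j (fst z) \<noteq> 0}"
  have g: "g \<in> poly_funs" unfolding g_def by (intro pf_prod pf_f)
  have q: "q \<in> poly_funs" unfolding q_def by (intro pf_prod pf_diff poly_funs.mult pf_f poly_funs.const)
  have w': "w' \<in> poly_funs"
    unfolding w'_def by (intro pf_uminus pf_sum poly_funs.mult pf_coordinate poly_funs.const pf_prod pf_f)
  have div: "regular_fun T g (\<lambda>z s. h z s / f j (fst z))" if "regular_fun T g h" "j \<in> ?S" for h j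
  proof (rule regular_fun_divide[OF g that(1)])
    show "(\<lambda>z. \<Prod>k\<in>?S - {j}. f k (fst z)) \<in> poly_funs" by (intro pf_prod pf_f)
    show "f j (fst z) \<noteq> 0 \<and> g z = f j (fst z) * (\<Prod>k\<in>?S - {j}. f k (fst z))" if "z \<in> T" for z
      using that \<open>j \<in> ?S\<close> by (auto simp: T_def g_def intro!: prod.remove)
  qed
  have x\<gamma>: "regular_fun T g (\<lambda>z s. \<phi> (x\<gamma> (fst z) s))" if \<phi>: "Vector_Spaces.linear scaleV (*) \<phi>" for \<phi>
    unfolding x\<gamma>_def linear_functional_simps[OF \<phi>]
    by (intro regular_fun_add[OF g] regular_fun_mult[OF g] regular_fun_diff[OF g] regular_fun_param
        regular_fun_pf poly_funs.fst \<phi> pf_f poly_funs.const)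
  have rreg: "regular_fun T g (\<lambda>z s. r z)"
    unfolding r_def
    by (intro regular_fun_uminus[OF g] regular_fun_sum[OF g] div regular_fun_mult[OF g] regular_fun_pf
        pf_coordinate poly_funs.const)
  have reg: "regular_curves T g \<gamma>"
  proof (rule regular_curves_vecI[OF g], goal_cases)
    case (1 \<phi>)
    show ?case unfolding \<gamma>_def fst_conv by (rule x\<gamma>[OF 1])
  next
    case (2 j)
    have "regular_fun T g (\<lambda>z s. f j (x\<gamma> (fst z) s) * (snd z $ j / f j (fst z)))" if "j \<in> ?S"
      by (intro regular_fun_mult[OF g] x\<gamma> f_linear div regular_fun_pf pf_coordinate that)
    moreover have "regular_fun T g (\<lambda>z s. s * r z)"
      by (intro regular_fun_mult[OF g] regular_fun_param rreg)
    moreover have "regular_fun T g (\<lambda>z s. snd z $ j)" by (intro regular_fun_pf pf_coordinate)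
    ultimately show ?case unfolding \<gamma>_def snd_conv vec_lambda_beta
      by (cases "j \<in> ?S"; cases "j = i") simp_all
  qed
  have w'_eq: "w' z = g z * r z" if z: "\<And>j. j \<in> ?S \<Longrightarrow> f j (fst z) \<noteq> 0" for z
    unfolding w'_def r_def g_def mult_minus_right sum_distrib_left
  proof (intro arg_cong[of _ _ uminus] sum.cong refl)
    fix j assume j: "j \<in> ?S"
    have "(\<Prod>j\<in>?S. f j (fst z)) = f j (fst z) * (\<Prod>k\<in>?S - {j}. f k (fst z))"
      by (rule prod.remove) (use j in auto)
    then show "snd z $ j * f j u0 * (\<Prod>k\<in>?S - {j}. f k (fst z)) =
      (\<Prod>j\<in>?S. f j (fst z)) * (snd z $ j * f j u0 / f j (fst z))" using z[OF j] by simp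
  qed
  have r_eq: "f i (fst z) * r z = snd z $ i" if z: "z \<in> crit X S K" for z
  proof -
    have "(\<Sum>j\<in>S. snd z $ j * (f j u0 / f j (fst z))) = 0" "f i (fst z) \<noteq> 0"
      using z u0 i by (auto simp: crit_def)
    then have "snd z $ i / f i (fst z) = r z"
      unfolding sum_remove_i u0(3) r_def by (simp add: eq_neg_iff_add_eq_0)
    then show ?thesis using \<open>f i (fst z) \<noteq> 0\<close> by (auto simp: field_simps)
  qed
  have chart: "\<exists>k G H. G \<in> poly_funs \<and> H \<in> poly_funs \<and> \<not> vanish G crit_res \<and> \<not> vanish H crit_res \<and>
      (\<forall>z\<in>crit X S K. G z * F z = (f i (fst z)) ^ k * H z)"
  proof (rule curve_chart[OF crit_props(2) reg q _ _ pf_f _ _ F])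
    show "\<not> vanish q (crit X S K)"
    proof -
      \<comment> \<open>The points \<open>x1 + t u0\<close> all have foot \<open>x1\<close>, where
        no other form vanishes; only finitely many \<open>t\<close> leave the complement.\<close>
      let ?A = "insert 0 {t. \<exists>j\<in>insert n0 S - {i}. f j (x1 + scaleV t u0) = 0}"
      have "finite ?A" using x1(2) by (intro finite.insertI finite_roots_all) auto
      then obtain t where t: "t \<notin> ?A" using ex_new_if_finite[OF infinite_UNIV_char_0] by blast
      have fi: "f i (x1 + scaleV t u0) = t" using x1(1) u0 by simp
      have "x1 + scaleV t u0 \<in> X" using x1(1) u0 X by (intro V.subspace_add V.subspace_scale) auto
      moreover have "f j (x1 + scaleV t u0) \<noteq> 0" if "j \<in> insert n0 S" for j
        using t fi that by (cases "j = i") auto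
      ultimately have "(x1 + scaleV t u0, 0) \<in> crit X S K" by (auto simp: crit_def)
      moreover have "q (x1 + scaleV t u0, 0) \<noteq> 0" using x1 u0(3) by (auto simp: q_def)
      ultimately show ?thesis unfolding vanish_def by blast
    qed
    show "vanish (\<lambda>z. f i (fst z)) crit_res" by (auto simp: vanish_def crit_def)
    show "\<not> vanish g crit_res"
    proof
      assume "vanish g crit_res"
      then have "g (x1, 0) = 0" using res_zero unfolding vanish_def by blast
      then show False using x1(2) by (auto simp: g_def)
    qed
    fix z assume z: "z \<in> crit X S K" and qz: "q z \<noteq> 0"
    obtain x l where xl: "z = (x, l)" by (cases z)
    have x: "x \<in> X" "\<forall>j\<in>insert n0 S. f j x \<noteq> 0" "\<forall>j. j \<notin> S \<union> K \<longrightarrow> l $ j = 0"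
      "\<And>u. u \<in> X \<Longrightarrow> f n0 u = 0 \<Longrightarrow> (\<Sum>j\<in>S. l $ j * (f j u / f j x)) = 0"
      using z by (auto simp: crit_def xl)
    have f0: "f j (x\<gamma> x 0) \<noteq> 0" if "j \<in> ?S" for j
      using qz that by (auto simp: q_def xl x\<gamma>_def)
    have x\<gamma>i: "f i (x\<gamma> x s) = s" "f n0 (x\<gamma> x s) = f n0 x" for s by (simp_all add: x\<gamma>_def u0)
    have x\<gamma>X: "x\<gamma> x s \<in> X" for s
      unfolding x\<gamma>_def using x u0 X by (intro V.subspace_add V.subspace_scale)
    have x\<gamma>x\<gamma>: "x\<gamma> (x\<gamma> x 0) s = x\<gamma> x s" for s
    proof -
      have "x\<gamma> (x\<gamma> x 0) s = x\<gamma> x 0 + scaleV (s - 0) u0" by (simp only: x\<gamma>_def[of "x\<gamma> x 0"] x\<gamma>i)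
      then show ?thesis by (simp add: x\<gamma>_def V.scale_left_diff_distrib)
    qed
    have \<gamma>0: "\<gamma> z 0 = (x\<gamma> x 0, (\<chi> j. if j \<in> ?S then f j (x\<gamma> x 0) * (l $ j / f j x)
      else if j = i then 0 else l $ j))" by (simp add: \<gamma>_def xl vec_eq_iff)
    note \<gamma>0' = \<gamma>0[unfolded xl]
    have in_res: "\<gamma> z 0 \<in> crit_res"
    proof -
      have "(\<Sum>j\<in>?S. snd (\<gamma> z 0) $ j * (f j u / f j (x\<gamma> x 0))) = 0"
        if u: "u \<in> X" "f i u = 0" "f n0 u = 0" for u
      proof -
        have "(\<Sum>j\<in>?S. snd (\<gamma> z 0) $ j * (f j u / f j (x\<gamma> x 0))) = (\<Sum>j\<in>?S. l $ j * (f j u / f j x))"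
          by (intro sum.cong refl) (use f0 in \<open>auto simp: \<gamma>0\<close>)
        also have "\<dots> = 0" using x(4)[OF u(1,3)] u(2) unfolding sum_remove_i by simp
        finally show ?thesis .
      qed
      moreover have "snd (\<gamma> z 0) $ j = 0" if "j \<notin> S - {i} \<union> K" for j
        using that x(3) by (auto simp: \<gamma>0)
      moreover have "f j (x\<gamma> x 0) \<noteq> 0" if "j \<in> insert n0 ?S" for j
        using that f0 x\<gamma>i(2) x(2) by auto
      moreover have "fst (\<gamma> z 0) = x\<gamma> x 0" by (simp add: \<gamma>0)
      ultimately show ?thesis
        using x\<gamma>X[of 0] x\<gamma>i(1)[of 0] unfolding crit_def
        by (cases "\<gamma> z 0") (simp only: mem_Collect_eq case_prod_conv fst_conv snd_conv Int_iff, blast)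
    qed
    have "r (\<gamma> z 0) = r z"
      unfolding r_def by (intro arg_cong[of _ _ uminus] sum.cong refl) (use f0 in \<open>auto simp: \<gamma>0' xl\<close>)
    then have "\<gamma> (\<gamma> z 0) s = \<gamma> z s" for s
      unfolding \<gamma>_def[of "\<gamma> z 0" s] using f0 x\<gamma>x\<gamma> by (auto simp: \<gamma>0' \<gamma>_def[of "(x, l)" s] xl vec_eq_iff)
    moreover have "\<gamma> z (f i (fst z)) = z"
    proof -
      have "x\<gamma> x (f i x) = x" by (simp add: x\<gamma>_def)
      then show ?thesis using r_eq[OF z] x(2) by (auto simp: \<gamma>_def xl vec_eq_iff)
    qed
    ultimately show "z \<in> T \<and> \<gamma> z 0 \<in> crit_res \<and> \<gamma> z 0 \<in> T \<and> g z \<noteq> 0 \<and> g (\<gamma> z 0) \<noteq> 0 \<and>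
      \<gamma> z (f i (fst z)) = z \<and> (\<forall>s. \<gamma> (\<gamma> z 0) s = \<gamma> z s)"
      using in_res f0 x(2) by (auto simp: T_def g_def \<gamma>0' xl)
  qed
  show "\<exists>k G H. G \<in> poly_funs \<and> H \<in> poly_funs \<and> \<not> vanish G crit_res \<and> \<not> vanish H crit_res \<and>
      (\<forall>z\<in>crit X S K. G z * F z = (snd z $ i) ^ k * H z)"
  proof (rule chart_change_parameter[OF res_integral g _ w' _ _ chart])
    have g1: "g (x1, l) \<noteq> 0" for l using x1(2) by (auto simp: g_def)
    then show "\<not> vanish g crit_res" using res_zero unfolding vanish_def by blast
    \<comment> \<open>By \<open>sum_\<rho>_u0\<close> the value is \<open>1\<close>, which shows
      that \<open>w' = g r\<close> is not identically zero on the restriction.\<close>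
    have "r (x1, relation_vec x1) = - (\<Sum>j\<in>?S. \<rho> $ j * f j u0)"
      unfolding r_def by (intro arg_cong[of _ _ uminus] sum.cong refl)
        (use x1(2) in \<open>auto simp: relation_vec_def\<close>)
    then have "w' (x1, relation_vec x1) = g (x1, relation_vec x1)"
      using w'_eq[of "(x1, relation_vec x1)"] x1(2) by (simp add: sum_\<rho>_u0)
    then show "\<not> vanish w' crit_res" using res_relation g1 unfolding vanish_def by force
    fix z assume z: "z \<in> crit X S K"
    then have "w' z = g z * r z" by (intro w'_eq) (auto simp: crit_def)
    then show "g z * snd z $ i = w' z * f i (fst z)" using r_eq[OF z] by (simp add: ac_simps)
  qed
qed

end

lemma res_pointE:
  assumes "crit_res \<noteq> {}"
  obtains x1 where "x1 \<in> Xi" "\<And>j. j \<in> insert n0 S - {i} \<Longrightarrow> f j x1 \<noteq> 0"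
proof -
  obtain z where z: "z \<in> crit_res" using assms by blast
  have "fst z \<in> Xi" using z by (auto simp: crit_def)
  moreover have "f j (fst z) \<noteq> 0" if "j \<in> insert n0 S - {i}" for j
    using z that by (auto simp: crit_def)
  ultimately show ?thesis by (rule that)
qed

lemma res_props:
  assumes "crit_res \<noteq> {}"
  shows "subvariety (proj crit_res)" "proj crit_res \<subset> proj (crit X S K)"
    "uniformizer 0 1 (proj (crit X S K)) (proj crit_res) (\<lambda>z. snd z $ i)"
proof -
  obtain x1 where x1: "x1 \<in> Xi" "\<And>j. j \<in> insert n0 S - {i} \<Longrightarrow> f j x1 \<noteq> 0"
    using res_pointE[OF assms] by blast
  show "subvariety (proj crit_res)"
    by (rule subvariety_proj[OF crit_biconical[OF Xi] res_integral[OF x1] res_nondegenerate[OF x1]])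
  show u: "uniformizer 0 1 (proj (crit X S K)) (proj crit_res) (\<lambda>z. snd z $ i)"
    by (rule uniformizer_res[OF x1])
  show "proj crit_res \<subset> proj (crit X S K)"
    by (rule uniformizer_subset_proper[OF u proj_mono[OF res_subset_closure[OF x1]]])
qed

lemma del_props:
  assumes "proj crit_del \<noteq> {}"
  shows "subvariety (proj crit_del)" "proj crit_del \<subset> proj (crit X S K)"
    "uniformizer 0 1 (proj (crit X S K)) (proj crit_del) (\<lambda>z. snd z $ i)"
proof -
  have nd: "nondegenerate crit_del" using proj_degenerate assms by blast
  show "subvariety (proj crit_del)"
    by (rule subvariety_proj[OF crit_biconical[OF X] del_integral nd])
  show u: "uniformizer 0 1 (proj (crit X S K)) (proj crit_del) (\<lambda>z. snd z $ i)"
    by (rule uniformizer_del[OF nd])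
  show "proj crit_del \<subset> proj (crit X S K)"
    by (rule uniformizer_subset_proper[OF u proj_mono[OF del_subset_closure]])
qed

text \<open>
  If no relation among the \<open>f j\<close>, \<open>j \<in> J\<close>, involves \<open>i\<close>, then \<open>\<nu>\<close> can be moved into the
  hyperplane \<open>f i\<close> without changing the other \<open>f j \<nu>\<close>.
\<close>

lemma stratum_in_res:
  assumes J: "i \<in> J" "J \<subseteq> insert n0 S" and van: "vanish (\<lambda>z. snd z $ i) (stratum X S K J)"
  shows "stratum X S K J \<subseteq> zariski_closure crit_res"
proof (cases "stratum X S K J = {}")
  case False
  then obtain y \<nu> r0 where d0: "stratum_data X S K J y \<nu> r0" unfolding stratum_def by blast
  \<comment> \<open>A relation supported on \<open>J\<close> with nonzero entry at \<open>i\<close>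
    would itself give a point of the stratum whose coordinate \<open>i\<close> is
    \<open>f i \<nu>\<close> times that entry.\<close>
  have no_rel: "\<rho>' $ i = 0"
    if "\<And>u. u \<in> X \<Longrightarrow> f n0 u = 0 \<Longrightarrow> (\<Sum>j\<in>S \<inter> J. \<rho>' $ j * f j u) = 0" for \<rho>' :: "complex ^ 'n"
  proof -
    define r :: "complex ^ 'n" where "r = (\<chi> j. if j \<in> S \<inter> J then \<rho>' $ j else 0)"
    have "(\<Sum>j\<in>S - J. r $ j * f j u) = 0" "(\<Sum>j\<in>S \<inter> J. r $ j * f j u) = (\<Sum>j\<in>S \<inter> J. \<rho>' $ j * f j u)" for u
      by (auto intro!: sum.neutral sum.cong simp: r_def)
    then have "stratum_data X S K J y \<nu> r"
      using d0 that unfolding stratum_data_def by (auto simp: r_def)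
    then have "(y, stratum_vec S J y \<nu> r) \<in> stratum X S K J" unfolding stratum_def by blast
    then have "stratum_vec S J y \<nu> r $ i = 0" using van unfolding vanish_def by force
    moreover have "f i \<nu> \<noteq> 0" using d0 J(1) by (auto simp: stratum_data_def)
    ultimately show ?thesis using i J(1) by (simp add: stratum_vec_def r_def)
  qed
  define U where "U = X \<inter> {u. f n0 u = 0}"
  have U: "V.subspace U" using X by (auto simp: U_def V.subspace_def)
  \<comment> \<open>Dual form of the absence of relations: otherwise \<open>f i\<close> would be a
    combination of the other forms in \<open>J\<close> on the directions parallel to
    infinity.\<close>
  have "\<exists>w\<in>U. f i w = 1 \<and> (\<forall>j\<in>S \<inter> J - {i}. f j w = 0)"
  proof (rule ccontr)
    assume n: "\<not> (\<exists>w\<in>U. f i w = 1 \<and> (\<forall>j\<in>S \<inter> J - {i}. f j w = 0))"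
    have "\<exists>c. \<forall>u\<in>U. f i u = (\<Sum>j\<in>S \<inter> J - {i}. c j * f j u)"
    proof (rule linear_combination_of_functionals[OF V.vector_space_axioms _ U f_linear f_linear])
      fix u assume u: "u \<in> U" "\<And>j. j \<in> S \<inter> J - {i} \<Longrightarrow> f j u = 0"
      show "f i u = 0"
      proof (rule ccontr)
        assume "f i u \<noteq> 0"
        then have "scaleV (1 / f i u) u \<in> U \<and> f i (scaleV (1 / f i u) u) = 1 \<and>
            (\<forall>j\<in>S \<inter> J - {i}. f j (scaleV (1 / f i u) u) = 0)"
          using u U by (auto simp: V.subspace_scale)
        then show False using n by blast
      qed
    qed simp
    then obtain c where c: "\<forall>u\<in>U. f i u = (\<Sum>j\<in>S \<inter> J - {i}. c j * f j u)" by blast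
    define \<rho>' :: "complex ^ 'n" where "\<rho>' = (\<chi> j. if j = i then - 1 else c j)"
    have "\<rho>' $ i = 0"
    proof (rule no_rel)
      fix u assume "u \<in> X" "f n0 u = 0"
      then have "f i u = (\<Sum>j\<in>S \<inter> J - {i}. \<rho>' $ j * f j u)"
        using c by (auto simp: U_def \<rho>'_def intro!: sum.cong)
      moreover have "(\<Sum>j\<in>S \<inter> J. \<rho>' $ j * f j u) = \<rho>' $ i * f i u + (\<Sum>j\<in>S \<inter> J - {i}. \<rho>' $ j * f j u)"
        by (rule sum.remove) (use i J in auto)
      ultimately show "(\<Sum>j\<in>S \<inter> J. \<rho>' $ j * f j u) = 0" by (simp add: \<rho>'_def)
    qed
    then show False by (simp add: \<rho>'_def)
  qed
  then obtain w where w: "w \<in> X" "f n0 w = 0" "f i w = 1" "\<And>j. j \<in> S \<inter> J - {i} \<Longrightarrow> f j w = 0"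
    unfolding U_def by blast
  have n0i: "n0 \<noteq> i" using i by blast
  \<comment> \<open>With \<nu> moved into the hyperplane \<open>i\<close>, the same point is a limit
    of points of the restriction, approached within \<open>Xi\<close>.\<close>
  have "stratum X S K J \<subseteq> stratum Xi (S - {i}) K (J - {i})"
  proof
    fix z assume "z \<in> stratum X S K J"
    then obtain y \<nu> r where z: "z = (y, stratum_vec S J y \<nu> r)" and d: "stratum_data X S K J y \<nu> r"
      unfolding stratum_def by blast
    define \<nu>' where "\<nu>' = \<nu> - scaleV (f i \<nu>) w"
    have dd: "y \<in> X" "\<nu> \<in> X" "\<And>j. j \<in> J \<Longrightarrow> f j y = 0 \<and> f j \<nu> \<noteq> 0"
      "\<And>j. j \<in> insert n0 S - J \<Longrightarrow> f j y \<noteq> 0" "\<And>j. j \<notin> S \<union> K \<Longrightarrow> r $ j = 0"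
      "\<And>u. u \<in> X \<Longrightarrow> f n0 u = 0 \<Longrightarrow> \<forall>j\<in>J. f j u = 0 \<Longrightarrow> (\<Sum>j\<in>S - J. r $ j * f j u) = 0"
      "\<And>u. u \<in> X \<Longrightarrow> f n0 u = 0 \<Longrightarrow> (\<Sum>j\<in>S \<inter> J. r $ j * f j u) = 0"
      using d unfolding stratum_data_def by auto
    have ri: "r $ i = 0" by (rule no_rel[OF dd(7)])
    have \<nu>': "\<nu>' \<in> X" "f i \<nu>' = 0" "\<And>j. j \<in> J - {i} \<Longrightarrow> f j \<nu>' = f j \<nu>"
    proof -
      show "\<nu>' \<in> X" unfolding \<nu>'_def using dd(2) w(1) X by (intro V.subspace_diff V.subspace_scale)
      show "f i \<nu>' = 0" by (simp add: \<nu>'_def w(3))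
      show "f j \<nu>' = f j \<nu>" if "j \<in> J - {i}" for j
        using that J(2) w(2) w(4)[of j] by (cases "j = n0") (auto simp: \<nu>'_def)
    qed
    have sets: "S - {i} - (J - {i}) = S - J"
      "insert n0 (S - {i}) - (J - {i}) = insert n0 S - J"
      using J(1) n0i by auto
    have sum_i: "(\<Sum>j\<in>(S - {i}) \<inter> (J - {i}). r $ j * f j u) = (\<Sum>j\<in>S \<inter> J. r $ j * f j u)" for u
      by (rule sum.mono_neutral_left) (use ri in auto)
    have "stratum_data Xi (S - {i}) K (J - {i}) y \<nu>' r"
      unfolding stratum_data_def sets sum_i
    proof (intro conjI ballI allI impI)
      show "y \<in> Xi" "\<nu>' \<in> Xi" using dd(1) dd(3)[of i] J(1) \<nu>' by auto
      show "f j y = 0" "f j \<nu>' \<noteq> 0" if "j \<in> J - {i}" for j using dd(3) \<nu>'(3)[OF that] that by auto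
      show "f j y \<noteq> 0" if "j \<in> insert n0 S - J" for j by (rule dd(4)[OF that])
      show "(\<Sum>j\<in>S - J. r $ j * f j u) = 0" if "u \<in> Xi" "f n0 u = 0" "\<forall>j\<in>J - {i}. f j u = 0" for u
        by (rule dd(6)) (use that in auto)
      show "(\<Sum>j\<in>S \<inter> J. r $ j * f j u) = 0" if "u \<in> Xi" "f n0 u = 0" for u
        by (rule dd(7)) (use that in auto)
      show "r $ j = 0" if "j \<notin> S - {i} \<union> K" for j using that dd(5)[of j] ri by (cases "j = i") auto
    qed
    moreover have "stratum_vec S J y \<nu> r = stratum_vec (S - {i}) (J - {i}) y \<nu>' r"
      using ri \<nu>'(3) J(1) by (auto simp: vec_eq_iff stratum_vec_def)
    ultimately show "z \<in> stratum Xi (S - {i}) K (J - {i})" unfolding z stratum_def by blast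
  qed
  moreover have "J - {i} \<subseteq> insert n0 (S - {i})" using J(2) by blast
  ultimately show ?thesis using stratum_subset_closure[OF Xi, of "J - {i}" "S - {i}" K] by blast
qed simp

text \<open>A codimension-one \<open>D\<close> equals any proper subvariety containing it, so it
  suffices to locate its general point. \<open>J\<close> collects the hyperplanes containing
  \<open>D\<close>; off the others \<open>D\<close> lies in \<open>crit\<close> itself or in one
  stratum.\<close>

lemma codim_one_cases:
  assumes D: "codim_one D (proj (crit X S K))" and van: "vanishes_on (\<lambda>z. snd z $ i) D"
  shows "D = proj crit_del \<or> D = proj crit_res"
proof -
  have sD: "subvariety D" "D \<subseteq> proj (crit X S K)" "D \<noteq> {}"
    using D by (auto simp: codim_one_def subvariety_def)
  define J where "J = {j \<in> insert n0 S. vanishes_on (\<lambda>z. f j (fst z)) D}"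
  let ?h = "\<lambda>z :: 'v \<times> (complex ^ 'n). \<Prod>j\<in>insert n0 S - J. f j (fst z)"
  have h: "bihom (card (insert n0 S - J)) 0 ?h" "\<not> vanishes_on ?h D"
    using prod_f_nonvanishing[OF sD(1), of "insert n0 S - J"] by (auto simp: J_def)
  have cl: "(x, l) \<in> zariski_closure (crit X S K)" if "x \<noteq> 0" "l \<noteq> 0" "pt x l \<in> D" for x l
    using pt_in_proj[OF crit_biconical[OF X] that(1,2)] that(3) sD(2) by blast
  have nz: "f j x \<noteq> 0" if "?h (x, l) \<noteq> 0" "j \<in> insert n0 S - J" for x l j
    using that by auto
  show ?thesis
  proof (cases "J = {}")
    case True
    have "D \<subseteq> proj crit_del"
    proof (rule subvariety_subset_projI[OF sD(1) h crit_biconical[OF X]])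
      fix x and l :: "complex ^ 'n" assume xl: "x \<noteq> 0" "l \<noteq> 0" "pt x l \<in> D" "?h (x, l) \<noteq> 0"
      have "(x, l) \<in> crit X S K"
        by (rule crit_closed_in_complement[OF X cl[OF xl(1-3)]]) (use nz[OF xl(4)] True in auto)
      moreover have "snd (x, l) $ i = 0" using vanishes_onD[OF van xl(1-3)] .
      ultimately have "(x, l) \<in> crit_del" by (rule crit_in_del)
      then show "(x, l) \<in> zariski_closure crit_del" using closure_subset by blast
    qed
    then show ?thesis
      using codim_one_eqI[OF D del_props(1) _ del_props(2)] sD(3) by blast
  next
    case False
    then obtain j where j: "j \<in> J" by blast
    let ?E = "stratum X S K J"
    have JS: "J \<subseteq> insert n0 S" by (auto simp: J_def)
    have DE: "D \<subseteq> proj ?E"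
    proof (rule subvariety_subset_projI[OF sD(1) h stratum_biconical[OF X]])
      fix x and l :: "complex ^ 'n" assume xl: "x \<noteq> 0" "l \<noteq> 0" "pt x l \<in> D" "?h (x, l) \<noteq> 0"
      show "(x, l) \<in> zariski_closure ?E"
      proof (rule closure_crit_in_stratum[OF X JS cl[OF xl(1-3)] closure_crit_subspace[OF X cl[OF xl(1-3)]]])
        show "f j x = 0" if "j \<in> J" for j
          using vanishes_onD[OF _ xl(1-3), of "\<lambda>z. f j (fst z)"] that by (simp add: J_def)
        show "f j x \<noteq> 0" if "j \<in> insert n0 S - J" for j by (rule nz[OF xl(4) that])
      qed
    qed
    then have pE: "proj ?E \<noteq> {}" using sD(3) by blast
    then have E0: "?E \<noteq> {}" by auto
    have nd: "nondegenerate ?E" using proj_degenerate pE by blast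
    note E = stratum_biconical[OF X, of S K J] stratum_integral[OF X E0] nd
    have "proj ?E \<subseteq> proj (crit X S K)" by (rule proj_mono[OF stratum_subset_closure[OF X JS]])
    \<comment> \<open>A form \<open>f j\<close> with \<open>j \<in> J\<close> vanishes on the
      stratum but not at \<open>(x0, 0)\<close>.\<close>
    moreover have "proj ?E \<noteq> proj (crit X S K)"
    proof
      assume eq: "proj ?E = proj (crit X S K)"
      have "vanish (\<lambda>z. f j (fst z)) ?E"
        using j by (auto simp: vanish_def stratum_def stratum_data_def)
      then have "vanish (\<lambda>z. f j (fst z)) (crit X S K)"
        using vanishes_on_proj[OF E pf_f] vanishes_on_proj[OF crit_props pf_f] eq by simp
      then have "f j (fst (x0, 0 :: complex ^ 'n)) = 0" using crit_zero unfolding vanish_def by blast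
      then show False using x0(2) j JS by auto
    qed
    ultimately have DeqE: "D = proj ?E"
      using codim_one_eqI[OF D subvariety_proj[OF E] DE] by blast
    then have vE: "vanish (\<lambda>z. snd z $ i) ?E"
      using van vanishes_on_proj[OF E pf_coordinate] by simp
    \<comment> \<open>Otherwise \<rho>, cut down to the indices outside \<open>J\<close>, is an
      admissible \<open>r\<close>, and its point has coordinate \<open>i\<close> equal to
      \<open>f i y\<close>, which is nonzero.\<close>
    have iJ: "i \<in> J"
    proof (rule ccontr)
      assume iJ: "i \<notin> J"
      obtain y \<nu> r0 where d0: "stratum_data X S K J y \<nu> r0" using E0 unfolding stratum_def by blast
      define r :: "complex ^ 'n" where "r = (\<chi> j. if j \<in> S - J then \<rho> $ j else 0)"
      have "(\<Sum>j\<in>S - J. r $ j * f j u) = 0" if u: "u \<in> X" "f n0 u = 0" "\<forall>j\<in>J. f j u = 0" for u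
      proof -
        have "(\<Sum>j\<in>S - J. r $ j * f j u) = (\<Sum>j\<in>S - J. \<rho> $ j * f j u)"
          by (intro sum.cong) (auto simp: r_def)
        also have "\<dots> = (\<Sum>j\<in>S. \<rho> $ j * f j u)"
          by (rule sum.mono_neutral_left) (use u in auto)
        finally show ?thesis using \<rho>(1)[OF u(1,2)] by simp
      qed
      moreover have "(\<Sum>j\<in>S \<inter> J. r $ j * f j u) = 0" for u
        by (intro sum.neutral) (auto simp: r_def)
      ultimately have "stratum_data X S K J y \<nu> r"
        using d0 unfolding stratum_data_def by (auto simp: r_def)
      then have "(y, stratum_vec S J y \<nu> r) \<in> ?E" unfolding stratum_def by blast
      then have "stratum_vec S J y \<nu> r $ i = 0" using vE unfolding vanish_def by force
      moreover have "f i y \<noteq> 0" using d0 i iJ by (auto simp: stratum_data_def)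
      ultimately show False using i iJ \<rho>(3) by (simp add: stratum_vec_def r_def)
    qed
    have Er: "?E \<subseteq> zariski_closure crit_res" by (rule stratum_in_res[OF iJ JS vE])
    then have res: "crit_res \<noteq> {}" using E0 closure_empty by auto
    have "D \<subseteq> proj crit_res" unfolding DeqE by (rule proj_mono[OF Er])
    then show ?thesis
      using codim_one_eqI[OF D res_props(1)[OF res] _ res_props(2)[OF res]] by blast
  qed
qed

theorem div_coordinate:
  "\<not> vanishes_on (\<lambda>z. snd z $ i) (proj (crit X S K))"
  "subvariety (proj (crit X S K))"
  "div_form (proj (crit X S K)) (\<lambda>z. snd z $ i) =
     fundamental_cycle (proj crit_del) + fundamental_cycle (proj crit_res)"
proof -
  show "\<not> vanishes_on (\<lambda>z. snd z $ i) (proj (crit X S K))"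
    using vanishes_on_proj[OF crit_props pf_coordinate] coordinate_not_vanish by simp
  show Z: "subvariety (proj (crit X S K))" by (rule subvariety_proj[OF crit_props])
  \<comment> \<open>The deletion may be degenerate and the restriction empty; such members have
    cycle \<open>0\<close> and must not be listed as components.\<close>
  define \<D> where "\<D> = {D \<in> {proj crit_del, proj crit_res}. D \<noteq> {}}"
  have "div_form (proj (crit X S K)) (\<lambda>z. snd z $ i) = (\<Sum>D\<in>\<D>. frag_of D)"
  proof (rule div_form_eq[OF Z bihom_coordinate])
    show "finite \<D>" by (simp add: \<D>_def)
    fix D
    show "subvariety D \<and> D \<subseteq> proj (crit X S K) \<and> uniformizer 0 1 (proj (crit X S K)) D (\<lambda>z. snd z $ i)"
      if "D \<in> \<D>"
    proof (cases "D = proj crit_del")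
      case True
      then have "proj crit_del \<noteq> {}" using that by (simp add: \<D>_def)
      from del_props[OF this] show ?thesis unfolding True by blast
    next
      case False
      then have D: "D = proj crit_res" "proj crit_res \<noteq> {}" using that by (auto simp: \<D>_def)
      then have "crit_res \<noteq> {}" by auto
      from res_props[OF this] show ?thesis unfolding D(1) by blast
    qed
    assume D: "codim_one D (proj (crit X S K))" "vanishes_on (\<lambda>z. snd z $ i) D"
    then have "D \<noteq> {}" by (auto simp: codim_one_def subvariety_def)
    then show "D \<in> \<D>" using codim_one_cases[OF D] by (auto simp: \<D>_def)
  qed
  also have "\<dots> = fundamental_cycle (proj crit_del) + fundamental_cycle (proj crit_res)"
  proof (cases "proj crit_del = {} \<or> proj crit_res = {}")
    case True
    then show ?thesis
    proof
      assume 1: "proj crit_del = {}"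
      then have "\<D> = (if proj crit_res = {} then {} else {proj crit_res})" by (auto simp: \<D>_def)
      then show ?thesis using 1 by auto
    next
      assume 1: "proj crit_res = {}"
      then have "\<D> = (if proj crit_del = {} then {} else {proj crit_del})" by (auto simp: \<D>_def)
      then show ?thesis using 1 by auto
    qed
  next
    case False
    then have "crit_res \<noteq> {}" by auto
    then obtain x1 where x1: "x1 \<in> Xi" "\<And>j. j \<in> insert n0 S - {i} \<Longrightarrow> f j x1 \<noteq> 0"
      using res_pointE by blast
    have nd: "nondegenerate crit_del" using False proj_degenerate by blast
    \<comment> \<open>\<open>f i\<close> vanishes on the restriction but not at the point
      \<open>(x0, 0)\<close> of the deletion. Were the two equal, the sum over \<D> would count the
      component only once.\<close>
    have "proj crit_del \<noteq> proj crit_res"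
    proof
      assume eq: "proj crit_del = proj crit_res"
      have "vanish (\<lambda>z. f i (fst z)) crit_res" by (auto simp: vanish_def crit_def)
      then have "vanish (\<lambda>z. f i (fst z)) crit_del"
        using vanishes_on_proj[OF crit_biconical[OF Xi] res_integral[OF x1] res_nondegenerate[OF x1] pf_f]
          vanishes_on_proj[OF crit_biconical[OF X] del_integral nd pf_f] eq by simp
      then have "f i (fst (x0, 0 :: complex ^ 'n)) = 0" using del_zero unfolding vanish_def by blast
      then show False using x0(2) i by auto
    qed
    moreover have "\<D> = {proj crit_del, proj crit_res}" using False by (auto simp: \<D>_def)
    ultimately show ?thesis using False by simp
  qed
  finally show "div_form (proj (crit X S K)) (\<lambda>z. snd z $ i) =
     fundamental_cycle (proj crit_del) + fundamental_cycle (proj crit_res)" .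
qed

end

end

section \<open>Alternating sums over subsets\<close>

lemma sum_Pow_insert:
  assumes "finite A" "a \<notin> A"
  shows "(\<Sum>B\<in>Pow (insert a A). g B) = (\<Sum>B\<in>Pow A. g B) + (\<Sum>B\<in>Pow A. g (insert a B))"
proof -
  have "inj_on (insert a) (Pow A)" using assms(2) by (auto simp: inj_on_def)
  moreover have "Pow A \<inter> insert a ` Pow A = {}" using assms(2) by auto
  ultimately show ?thesis
    using assms(1) by (simp add: Pow_insert sum.union_disjoint sum.reindex)
qed

lemma sum_Pow_alternating:
  assumes "finite A" shows "(\<Sum>B\<in>Pow A. (- 1) ^ card B :: int) = (if A = {} then 1 else 0)"
proof (cases "A = {}")
  case False
  then obtain a A' where A: "A = insert a A'" "a \<notin> A'" by (meson Set.set_insert ex_in_conv)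
  have fin: "finite A'" using assms A by simp
  have "(\<Sum>B\<in>Pow A'. (- 1) ^ card (insert a B) :: int) = (\<Sum>B\<in>Pow A'. - ((- 1) ^ card B))"
  proof (intro sum.cong refl)
    fix B assume "B \<in> Pow A'"
    then have "finite B" "a \<notin> B" using A(2) finite_subset[OF _ fin] by auto
    then show "(- 1) ^ card (insert a B) = - ((- 1) ^ card B :: int)" by simp
  qed
  then show ?thesis using False sum_Pow_insert[OF fin A(2), of "\<lambda>B. (- 1) ^ card B :: int"]
    unfolding A(1) by (simp add: sum_negf)
qed simp

context arrangement
begin

subsection \<open>Characteristic polynomials\<close>

definition kern :: "'n set \<Rightarrow> 'v set" where
  "kern B = {x. \<forall>j\<in>B. f j x = 0}"

definition rank_on :: "'v set \<Rightarrow> 'n set \<Rightarrow> nat" where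
  "rank_on X B = V.dim X - V.dim (X \<inter> kern B)"

text \<open>Whitney's subset expansion of the homogenized characteristic polynomial, on a subspace \<open>X\<close>.\<close>

definition chi :: "'v set \<Rightarrow> 'n set \<Rightarrow> 'r::comm_ring_1 \<Rightarrow> 'r \<Rightarrow> 'r" where
  "chi X S s t = (\<Sum>B\<in>Pow S. (- 1) ^ card B * s ^ rank_on X B * t ^ (rank_on X S - rank_on X B))"

lemma kern_empty [simp]: "kern {} = UNIV"
  by (simp add: kern_def)

lemma kern_insert: "X \<inter> kern (insert i B) = (X \<inter> {x. f i x = 0}) \<inter> kern B"
  by (auto simp: kern_def)

lemma kern_mono: "B \<subseteq> B' \<Longrightarrow> kern B' \<subseteq> kern B"
  by (auto simp: kern_def)

lemma subspace_kern: "V.subspace X \<Longrightarrow> V.subspace (X \<inter> kern B)"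
  by (auto simp: kern_def V.subspace_def)

lemma dim_hyperplane_section:
  assumes X: "V.subspace X" and u: "u \<in> X" "f i u \<noteq> 0"
  shows "Suc (V.dim (X \<inter> {x. f i x = 0})) = V.dim X"
proof (rule dim_kernel_section[OF V.finite_dimensional_vector_space_axioms X f_linear])
  show "scaleV (1 / f i u) u \<in> X" using X u by (simp add: V.subspace_scale)
  show "f i (scaleV (1 / f i u) u) = 1" using u by simp
qed

lemma rank_on_insert:
  assumes X: "V.subspace X" and u: "u \<in> X" "f i u \<noteq> 0"
  shows "rank_on X (insert i B) = Suc (rank_on (X \<inter> {x. f i x = 0}) B)"
proof -
  let ?Xi = "X \<inter> {x. f i x = 0}"
  have "V.dim (?Xi \<inter> kern B) \<le> V.dim ?Xi" by (rule V.dim_subset) blast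
  then show ?thesis
    using dim_hyperplane_section[OF X u] by (simp add: rank_on_def kern_insert)
qed

lemma rank_on_mono: "B \<subseteq> B' \<Longrightarrow> rank_on X B \<le> rank_on X B'"
  unfolding rank_on_def by (intro diff_le_mono2 V.dim_subset Int_mono order_refl kern_mono)

lemma chi_empty [simp]: "chi X {} s t = 1"
  by (simp add: chi_def rank_on_def)

text \<open>Adding \<open>i\<close> to a subset changes the sign but not the rank, so the terms
  cancel in pairs.\<close>

lemma chi_loop:
  assumes "i \<in> S" "\<And>x. x \<in> X \<Longrightarrow> f i x = 0" shows "chi X S s t = 0"
proof -
  have S: "S = insert i (S - {i})" using assms(1) by blast
  let ?g = "\<lambda>B. (- 1) ^ card B * s ^ rank_on X B * t ^ (rank_on X S - rank_on X B)"
  have "?g (insert i B) = - ?g B" if "B \<in> Pow (S - {i})" for B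
  proof -
    have "X \<inter> kern (insert i B) = X \<inter> kern B" using assms(2) by (auto simp: kern_def)
    then have "rank_on X (insert i B) = rank_on X B" by (simp add: rank_on_def)
    moreover have "card (insert i B) = Suc (card B)" using that by (intro card_insert_disjoint) auto
    ultimately show ?thesis by simp
  qed
  then have "(\<Sum>B\<in>Pow (S - {i}). ?g (insert i B)) = (\<Sum>B\<in>Pow (S - {i}). - ?g B)"
    by (intro sum.cong) auto
  moreover have "chi X S s t = (\<Sum>B\<in>Pow (insert i (S - {i})). ?g B)"
    unfolding chi_def using S by simp
  moreover have "(\<Sum>B\<in>Pow (insert i (S - {i})). ?g B) =
      (\<Sum>B\<in>Pow (S - {i}). ?g B) + (\<Sum>B\<in>Pow (S - {i}). ?g (insert i B))"
    by (rule sum_Pow_insert) auto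
  ultimately show ?thesis by (simp add: sum_negf)
qed

text \<open>Split the subsets by whether they contain \<open>i\<close>. The power of
  \<open>t\<close> makes up for the drop of the total rank under deletion, which occurs for
  coloops.\<close>

lemma chi_deletion_restriction:
  assumes X: "V.subspace X" and u: "u \<in> X" "f i u \<noteq> 0" and i: "i \<notin> S"
  shows "chi X (insert i S) s t = t ^ (rank_on X (insert i S) - rank_on X S) * chi X S s t -
    s * chi (X \<inter> {x. f i x = 0}) S s t"
proof -
  let ?Xi = "X \<inter> {x. f i x = 0}"
  let ?r = "rank_on X (insert i S)"
  let ?g = "\<lambda>B. (- 1) ^ card B * s ^ rank_on X B * t ^ (?r - rank_on X B)"
  have "(\<Sum>B\<in>Pow S. ?g B) =
      (\<Sum>B\<in>Pow S. t ^ (?r - rank_on X S) * ((- 1) ^ card B * s ^ rank_on X B * t ^ (rank_on X S - rank_on X B)))"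
  proof (intro sum.cong refl)
    fix B assume "B \<in> Pow S"
    then have "rank_on X B \<le> rank_on X S" by (intro rank_on_mono) auto
    moreover have "rank_on X S \<le> ?r" by (rule rank_on_mono) auto
    ultimately have "?r - rank_on X B = (?r - rank_on X S) + (rank_on X S - rank_on X B)" by linarith
    then show "?g B = t ^ (?r - rank_on X S) * ((- 1) ^ card B * s ^ rank_on X B * t ^ (rank_on X S - rank_on X B))"
      by (simp add: power_add ac_simps)
  qed
  then have 1: "(\<Sum>B\<in>Pow S. ?g B) = t ^ (?r - rank_on X S) * chi X S s t"
    by (simp add: chi_def sum_distrib_left)
  have "(\<Sum>B\<in>Pow S. ?g (insert i B)) =
      (\<Sum>B\<in>Pow S. - s * ((- 1) ^ card B * s ^ rank_on ?Xi B * t ^ (rank_on ?Xi S - rank_on ?Xi B)))"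
  proof (intro sum.cong refl)
    fix B assume "B \<in> Pow S"
    then have "card (insert i B) = Suc (card B)" using i by (intro card_insert_disjoint) auto
    then show "?g (insert i B) = - s * ((- 1) ^ card B * s ^ rank_on ?Xi B * t ^ (rank_on ?Xi S - rank_on ?Xi B))"
      by (simp add: rank_on_insert[OF X u] ac_simps)
  qed
  then have 2: "(\<Sum>B\<in>Pow S. ?g (insert i B)) = - s * chi ?Xi S s t"
    by (simp only: chi_def sum_distrib_left)
  have "chi X (insert i S) s t = (\<Sum>B\<in>Pow S. ?g B) + (\<Sum>B\<in>Pow S. ?g (insert i B))"
    unfolding chi_def by (rule sum_Pow_insert) (use i in auto)
  then show ?thesis unfolding 1 2 by simp
qed

text \<open>\<open>w\<close> lies in every \<open>kern B\<close> with
  \<open>B \<subseteq> S\<close>, so each of these drops by one dimension in the hyperplane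
  \<open>i\<close>. Hence all ranks agree on \<open>X\<close> and on the restriction.\<close>

lemma chi_coloop:
  assumes X: "V.subspace X" and w: "w \<in> X" "f i w \<noteq> 0" "\<And>j. j \<in> S \<Longrightarrow> f j w = 0" and i: "i \<notin> S"
  shows "chi X (insert i S) s t = (t - s) * chi X S s t"
proof -
  let ?Xi = "X \<inter> {x. f i x = 0}"
  have r: "rank_on ?Xi B = rank_on X B" if B: "B \<subseteq> S" for B
  proof -
    have "w \<in> X \<inter> kern B" using w B by (auto simp: kern_def)
    then have "Suc (V.dim ((X \<inter> kern B) \<inter> {x. f i x = 0})) = V.dim (X \<inter> kern B)"
      using w by (intro dim_hyperplane_section subspace_kern X) auto
    moreover have "(X \<inter> kern B) \<inter> {x. f i x = 0} = ?Xi \<inter> kern B" by blast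
    ultimately show ?thesis using dim_hyperplane_section[OF X w(1,2)] by (simp add: rank_on_def)
  qed
  then have "chi ?Xi S s t = chi X S s t" unfolding chi_def by (intro sum.cong) auto
  moreover have "rank_on X (insert i S) = Suc (rank_on X S)"
    using rank_on_insert[OF X w(1,2), of S] r[of S] by simp
  ultimately show ?thesis
    using chi_deletion_restriction[OF X w(1,2) i, of s t] by (simp add: algebra_simps)
qed

lemma chi_not_coloop:
  assumes X: "V.subspace X" and u: "u \<in> X" "f i u \<noteq> 0" and i: "i \<notin> S"
    and dep: "\<And>x. x \<in> X \<Longrightarrow> (\<And>j. j \<in> S \<Longrightarrow> f j x = 0) \<Longrightarrow> f i x = 0"
  shows "chi X (insert i S) s t = chi X S s t - s * chi (X \<inter> {x. f i x = 0}) S s t"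
proof -
  have "X \<inter> kern (insert i S) = X \<inter> kern S" using dep by (auto simp: kern_def)
  then have "rank_on X (insert i S) = rank_on X S" by (simp add: rank_on_def)
  then show ?thesis using chi_deletion_restriction[OF X u i, of s t] by simp
qed

lemma intersection_lattice_eq: "intersection_lattice f = range kern"
proof -
  have "(\<Inter>i\<in>I. hyperplane (f i)) = kern I" for I by (auto simp: kern_def hyperplane_def)
  then show ?thesis unfolding intersection_lattice_def by auto
qed

text \<open>The right-hand side satisfies the defining recursion: summed over all flats containing
  \<open>Y\<close>, it is the alternating sum over all sets of hyperplanes containing
  \<open>Y\<close>, which is zero unless there are none, that is, unless \<open>Y\<close> is the
  whole space.\<close>

lemma moebius_eq_alternating_sum:
  assumes nz: "\<And>j. f j \<noteq> (\<lambda>_. 0)" and Y: "Y \<in> intersection_lattice f"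
  shows "moebius (intersection_lattice f) UNIV Y = (\<Sum>B\<in>{B. kern B = Y}. (- 1) ^ card B)"
  using Y
proof (induction "card {Z \<in> intersection_lattice f. Y \<subset> Z}" arbitrary: Y rule: less_induct)
  case less
  let ?L = "intersection_lattice f"
  let ?\<nu> = "\<lambda>Y. \<Sum>B\<in>{B. kern B = Y}. (- 1) ^ card B :: int"
  have fin: "finite ?L" unfolding intersection_lattice_eq by simp
  have UL: "UNIV \<in> ?L" unfolding intersection_lattice_eq using kern_empty by (metis rangeI)
  have IH: "moebius ?L UNIV Z = ?\<nu> Z" if Z: "Z \<in> ?L" "Y \<subset> Z" for Z
  proof (rule less.hyps[OF _ Z(1)])
    have "{Z' \<in> ?L. Z \<subset> Z'} \<subset> {Z \<in> ?L. Y \<subset> Z}" using Z by auto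
    then show "card {Z' \<in> ?L. Z \<subset> Z'} < card {Z \<in> ?L. Y \<subset> Z}"
      using fin by (intro psubset_card_mono) auto
  qed
  define A where "A = {j. Y \<subseteq> kern {j}}"
  have sub: "Y \<subseteq> kern B \<longleftrightarrow> B \<in> Pow A" for B by (auto simp: A_def kern_def)
  have "(\<Sum>Z\<in>{Z \<in> ?L. Y \<subseteq> Z}. ?\<nu> Z) = (\<Sum>Z\<in>{Z \<in> ?L. Y \<subseteq> Z}. \<Sum>B\<in>{B. B \<in> Pow A \<and> kern B = Z}. (- 1) ^ card B)"
    using sub by (intro sum.cong) auto
  also have "\<dots> = (\<Sum>B\<in>Pow A. (- 1) ^ card B)"
    by (rule sum.group) (use fin sub in \<open>auto simp: intersection_lattice_eq\<close>)
  also have "\<dots> = (if A = {} then 1 else 0)" by (rule sum_Pow_alternating) simp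
  also have "A = {} \<longleftrightarrow> Y = UNIV"
  proof
    assume A: "A = {}"
    obtain I where I: "Y = kern I" using less.prems unfolding intersection_lattice_eq by blast
    then have "I \<subseteq> A" using sub[of I] by auto
    then show "Y = UNIV" using A I by simp
  next
    assume "Y = UNIV"
    then show "A = {}" using nz by (auto simp: A_def kern_def fun_eq_iff)
  qed
  finally have total: "(\<Sum>Z\<in>{Z \<in> ?L. Y \<subseteq> Z}. ?\<nu> Z) = (if Y = UNIV then 1 else 0)" .
  have "{Z \<in> ?L. Y \<subseteq> Z} = insert Y {Z \<in> ?L. Y \<subset> Z}" using less.prems by auto
  then have split: "(\<Sum>Z\<in>{Z \<in> ?L. Y \<subseteq> Z}. ?\<nu> Z) = ?\<nu> Y + (\<Sum>Z\<in>{Z \<in> ?L. Y \<subset> Z}. ?\<nu> Z)"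
    using fin by simp
  have "(\<Sum>Z\<in>{Z \<in> ?L. Y \<subset> Z \<and> Z \<subseteq> UNIV}. moebius ?L UNIV Z) = (\<Sum>Z\<in>{Z \<in> ?L. Y \<subset> Z}. ?\<nu> Z)"
    using IH by (intro sum.cong) auto
  then have m: "moebius ?L UNIV Y = (if Y = UNIV then 1 else - (\<Sum>Z\<in>{Z \<in> ?L. Y \<subset> Z}. ?\<nu> Z))"
    using fin UL less.prems by (subst moebius.simps) auto
  show ?case
  proof (cases "Y = UNIV")
    case True
    then have "{Z \<in> ?L. Y \<subset> Z} = {}" by auto
    then show ?thesis using m total split True by simp
  next
    case False
    then show ?thesis using m total split by simp
  qed
qed

text \<open>Grouping the subsets by their flat \<open>kern B\<close> turns the subset expansion into
  the sum over the lattice.\<close>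

lemma char_poly_hom_eq_chi:
  fixes s t :: "'r::comm_ring_1"
  assumes nz: "\<And>j. f j \<noteq> (\<lambda>_. 0)"
  shows "char_poly_hom scaleV f s t = chi UNIV UNIV s t"
proof -
  let ?L = "intersection_lattice f" and ?l = "arr_rank scaleV f"
  let ?\<mu> = "moebius (intersection_lattice f) UNIV"
  have fin: "finite ?L" unfolding intersection_lattice_eq by simp
  have "(\<Inter>i. hyperplane (f i)) = kern UNIV" by (auto simp: kern_def hyperplane_def)
  then have l: "?l = rank_on UNIV UNIV" by (simp add: arr_rank_def flat_rank_def rank_on_def)
  have fr: "flat_rank scaleV (kern B) = rank_on UNIV B" for B
    by (simp add: flat_rank_def rank_on_def)
  have le: "flat_rank scaleV Y \<le> ?l" if "Y \<in> ?L" for Y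
    using that unfolding intersection_lattice_eq l by (auto simp: fr intro: rank_on_mono[OF subset_UNIV])
  have "char_poly_hom scaleV f s t = (\<Sum>d\<le>?l. \<Sum>Y\<in>?L.
      of_int (if ?l - flat_rank scaleV Y = d then ?\<mu> Y else 0) * s ^ (?l - d) * t ^ d)"
    unfolding char_poly_hom_def char_poly_def
    by (simp add: coeff_sum sum_distrib_right)
  also have "\<dots> = (\<Sum>Y\<in>?L. \<Sum>d\<le>?l.
      of_int (if ?l - flat_rank scaleV Y = d then ?\<mu> Y else 0) * s ^ (?l - d) * t ^ d)"
    by (rule sum.swap)
  also have "\<dots> = (\<Sum>Y\<in>?L. of_int (?\<mu> Y) * s ^ flat_rank scaleV Y * t ^ (?l - flat_rank scaleV Y))"
  proof (intro sum.cong refl)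
    fix Y assume Y: "Y \<in> ?L"
    have "(\<Sum>d\<le>?l. of_int (if ?l - flat_rank scaleV Y = d then ?\<mu> Y else 0) * s ^ (?l - d) * t ^ d) =
      (\<Sum>d\<le>?l. if ?l - flat_rank scaleV Y = d then of_int (?\<mu> Y) * s ^ (?l - d) * t ^ d else 0)"
      by (intro sum.cong) auto
    also have "\<dots> = of_int (?\<mu> Y) * s ^ (?l - (?l - flat_rank scaleV Y)) * t ^ (?l - flat_rank scaleV Y)"
      by simp
    also have "?l - (?l - flat_rank scaleV Y) = flat_rank scaleV Y" using le[OF Y] by simp
    finally show "(\<Sum>d\<le>?l. of_int (if ?l - flat_rank scaleV Y = d then ?\<mu> Y else 0) * s ^ (?l - d) * t ^ d) =
      of_int (?\<mu> Y) * s ^ flat_rank scaleV Y * t ^ (?l - flat_rank scaleV Y)" .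
  qed
  also have "\<dots> = (\<Sum>Y\<in>?L. \<Sum>B\<in>{B. B \<in> UNIV \<and> kern B = Y}.
      (- 1) ^ card B * s ^ rank_on UNIV B * t ^ (rank_on UNIV UNIV - rank_on UNIV B))"
  proof (intro sum.cong refl)
    fix Y assume Y: "Y \<in> ?L"
    have "(of_int (?\<mu> Y) :: 'r) = (\<Sum>B\<in>{B. B \<in> UNIV \<and> kern B = Y}. (- 1) ^ card B)"
      by (simp add: moebius_eq_alternating_sum[OF nz Y])
    then show "of_int (?\<mu> Y) * s ^ flat_rank scaleV Y * t ^ (?l - flat_rank scaleV Y) =
      (\<Sum>B\<in>{B. B \<in> UNIV \<and> kern B = Y}.
        (- 1) ^ card B * s ^ rank_on UNIV B * t ^ (rank_on UNIV UNIV - rank_on UNIV B))"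
      by (simp add: sum_distrib_right l fr[symmetric])
  qed
  also have "\<dots> = (\<Sum>B\<in>UNIV. (- 1) ^ card B * s ^ rank_on UNIV B * t ^ (rank_on UNIV UNIV - rank_on UNIV B))"
    by (rule sum.group) (auto simp: intersection_lattice_eq)
  also have "\<dots> = chi UNIV UNIV s t" by (simp add: chi_def)
  finally show ?thesis .
qed

end

context arrangement
begin

subsection \<open>The class of a critical variety\<close>

lemma ex_generic_point:
  assumes X: "V.subspace X" and J: "\<And>j. j \<in> J \<Longrightarrow> \<exists>x\<in>X. f j x \<noteq> 0"
  shows "\<exists>x\<in>X. \<forall>j\<in>J. f j x \<noteq> 0"
proof -
  have "finite J" by simp
  then show ?thesis
    using J
  proof (induction J)
    case empty
    then show ?case using V.subspace_0[OF X] by blast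
  next
    case (insert i J)
    then obtain x where x: "x \<in> X" "\<forall>j\<in>J. f j x \<noteq> 0" by auto
    obtain e where e: "e \<in> X" "f i e \<noteq> 0" using insert.prems by blast
    have "finite {t. f i x + t * f i e = 0}"
    proof -
      have "{t. f i x + t * f i e = 0} \<subseteq> {- f i x / f i e}"
        using e(2) by (auto simp: field_simps add_eq_0_iff)
      then show ?thesis using finite_subset by blast
    qed
    then have "finite ({t. f i x + t * f i e = 0} \<union> {t. \<exists>j\<in>J. f j (x + scaleV t e) = 0})"
      using x(2) by (intro finite_UnI finite_roots_all) auto
    then obtain t where "t \<notin> {t. f i x + t * f i e = 0} \<union> {t. \<exists>j\<in>J. f j (x + scaleV t e) = 0}"
      using ex_new_if_finite[OF infinite_UNIV_char_0] by blast
    then have "\<forall>j\<in>insert i J. f j (x + scaleV t e) \<noteq> 0" by auto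
    moreover have "x + scaleV t e \<in> X" using x e X by (intro V.subspace_add V.subspace_scale)
    ultimately show ?case by blast
  qed
qed

text \<open>A free coordinate does not enter the equations, so \<open>crit\<close> is invariant
  under translation along its axis. Any \<psi> with value \<open>1\<close> there qualifies, both the
  coordinate itself and the sum of all coordinates.\<close>

lemma free_coordinate_section:
  assumes X: "V.subspace X" and x0: "x0 \<in> X" "\<And>j. j \<in> insert n0 S \<Longrightarrow> f j x0 \<noteq> 0"
    and \<psi>: "Vector_Spaces.linear (*s) (*) \<psi>" "\<psi> (axis k 1) = 1" and k: "k \<notin> S" "k \<in> K"
  shows "\<not> vanishes_on (\<lambda>z. \<psi> (snd z)) (proj (crit X S K))"
    and "div_form (proj (crit X S K)) (\<lambda>z. \<psi> (snd z)) =
      fundamental_cycle (proj {z \<in> crit X S K. \<psi> (snd z) = 0})"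
    and "subvariety (proj (crit X S K))"
    and "biconical {z \<in> crit X S K. \<psi> (snd z) = 0}" "integral_set {z \<in> crit X S K. \<psi> (snd z) = 0}"
proof -
  have Ce: "(x + scaleV s 0, l + s *s axis k 1) \<in> crit X S K" if "(x, l) \<in> crit X S K" for x l s
  proof -
    have "(\<Sum>j\<in>S. (l + s *s axis k 1) $ j * (f j u / f j x)) = (\<Sum>j\<in>S. l $ j * (f j u / f j x))" for u
      by (intro sum.cong) (use k in \<open>auto simp: axis_def\<close>)
    then show ?thesis using that k by (auto simp: crit_def axis_def)
  qed
  have z0: "(x0, 0) \<in> crit X S K" using x0 by (auto simp: crit_def)
  have "x0 \<noteq> 0" using x0(2)[of n0] by auto
  moreover have "(x0, axis k 1) \<in> crit X S K" using Ce[OF z0, of 1] by simp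
  moreover have "axis k 1 \<noteq> (0 :: complex ^ 'n)" by (simp add: axis_eq_0_iff)
  ultimately have nd: "nondegenerate (crit X S K)" unfolding nondegenerate_def by blast
  have "crit X S K \<noteq> {}" using z0 by blast
  note C = crit_biconical[OF X, of S K] crit_integral[OF X this] nd
  have \<psi>e: "\<psi> (snd (x + scaleV s 0, l + s *s axis k 1)) = \<psi> (snd (x, l)) + s" for x l s
    by (simp add: linear_functional_simps[OF \<psi>(1)] \<psi>(2))
  note sec = cone_section[OF C bihom_snd[OF \<psi>(1)] \<psi>e Ce]
  show "subvariety (proj (crit X S K))" by (rule subvariety_proj[OF C])
  show "\<not> vanishes_on (\<lambda>z. \<psi> (snd z)) (proj (crit X S K))" by (rule sec(1))
  show "div_form (proj (crit X S K)) (\<lambda>z. \<psi> (snd z)) =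
      fundamental_cycle (proj {z \<in> crit X S K. \<psi> (snd z) = 0})" by (rule sec(2))
  show "integral_set {z \<in> crit X S K. \<psi> (snd z) = 0}" by (rule sec(3))
  show "biconical {z \<in> crit X S K. \<psi> (snd z) = 0}" by (rule sec(4))
qed

text \<open>Without relations the set is dense and open in the product of \<open>X\<close> with a
  coordinate subspace.\<close>

lemma crit_no_hyperplanes:
  assumes X: "V.subspace X" and x0: "x0 \<in> X" "f n0 x0 \<noteq> 0"
  shows "rat_eq (fundamental_cycle (proj (crit X {} K)))
    (hyperplane_monomial (V.dim UNIV - V.dim X) (card (- K)))"
proof -
  let ?B = "{l :: complex ^ 'n. \<forall>j. j \<notin> K \<longrightarrow> l $ j = 0}"
  have B: "W.subspace ?B" by (auto simp: W.subspace_def)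
  have e: "crit X {} K = {z \<in> X \<times> ?B. f n0 (fst z) \<noteq> 0}" by (auto simp: crit_def)
  have nv: "\<not> vanish (\<lambda>z. f n0 (fst z)) (X \<times> ?B)"
  proof
    assume "vanish (\<lambda>z. f n0 (fst z)) (X \<times> ?B)"
    moreover have "(x0, 0) \<in> X \<times> ?B" using x0 by simp
    ultimately have "f n0 (fst (x0, 0 :: complex ^ 'n)) = 0" unfolding vanish_def by blast
    then show False using x0(2) by simp
  qed
  have "X \<times> ?B \<subseteq> zariski_closure (crit X {} K)"
    unfolding e by (rule closure_open_subset[OF linear_integral[OF X B] pf_f nv])
  moreover have "crit X {} K \<subseteq> zariski_closure (X \<times> ?B)"
    using closure_subset[of "X \<times> ?B"] unfolding e by blast
  ultimately have p: "proj (crit X {} K) = proj (X \<times> ?B)" by (intro proj_eqI)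
  have "V.dim X \<le> V.dim UNIV" by (rule V.dim_subset) simp
  moreover have "card K + card (- K) = CARD('n)"
    by (subst card_Un_disjoint[symmetric]) (auto simp: Compl_partition)
  ultimately show ?thesis
    unfolding p
    by (intro linear_rat_eq_monomial X B)
      (simp_all only: dim_substandard_cart vec.dim_UNIV card_cart_basis le_add_diff_inverse)
qed

text \<open>Each coordinate outside \<open>S \<union> K\<close> vanishes and costs a factor
  \<open>k\<close>. One of these factors is already contained in \<open>chi\<close>, because of
  \<open>n0\<close>; this explains the exponent and why at least one vanishing coordinate is
  required.\<close>

theorem class_crit:
  assumes "V.subspace X" "n0 \<notin> S" "S \<inter> K = {}" "- (S \<union> K) \<noteq> {}"
  shows "rat_eq (fundamental_cycle (proj (crit X S K)))
    (hk_cycle (k_var ^ (card (- (S \<union> K)) - 1) * h_var ^ (V.dim UNIV - V.dim X) *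
      chi X (insert n0 S) (- h_var) (k_var - h_var)))"
  using assms
proof (induction "card S" arbitrary: S K X)
  case 0
  note X = \<open>V.subspace X\<close>
  have S: "S = {}" using 0(1) by simp
  show ?case
  proof (cases "\<exists>x\<in>X. f n0 x \<noteq> 0")
    case False
    then have "crit X S K = {}" by (auto simp: crit_def)
    moreover have c0: "chi X (insert n0 S) (- h_var) (k_var - h_var) = 0"
      by (rule chi_loop[of n0]) (use False in auto)
    ultimately show ?thesis unfolding c0 by (simp add: hk_cycle_def)
  next
    case True
    then obtain x0 where x0: "x0 \<in> X" "f n0 x0 \<noteq> 0" by blast
    \<comment> \<open>The only form left is a coloop and contributes \<open>t - s = k\<close>, the
      factor held back in the exponent.\<close>
    have "chi X (insert n0 S) (- h_var) (k_var - h_var) = (k_var - h_var - - h_var) * chi X {} (- h_var) (k_var - h_var)"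
      unfolding S by (rule chi_coloop[OF X x0]) auto
    then have c: "chi X (insert n0 S) (- h_var) (k_var - h_var) = k_var" by simp
    have "card (- K) > 0" using 0(5) S by (simp add: card_gt_0_iff)
    then have k: "k_var ^ (card (- K) - 1) * k_var = (k_var ^ card (- K) :: int poly poly)"
      by (rule power_minus_mult)
    have comm: "a * b * c = b * (a * c)" for a b c :: "int poly poly" by (simp only: ac_simps)
    have "k_var ^ (card (- (S \<union> K)) - 1) * h_var ^ (V.dim UNIV - V.dim X) * k_var =
        h_var ^ (V.dim UNIV - V.dim X) * k_var ^ card (- K)"
      unfolding S Un_empty_left comm k ..
    then show ?thesis
      unfolding c using crit_no_hyperplanes[OF X x0, of K] by (simp only: hk_cycle_monomial S)
  qed
next
  case (Suc m)
  note X = \<open>V.subspace X\<close> and n0 = \<open>n0 \<notin> S\<close> and SK = \<open>S \<inter> K = {}\<close> and Z = \<open>- (S \<union> K) \<noteq> {}\<close>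
  let ?s = "- h_var" and ?t = "k_var - h_var"
  show ?case
  proof (cases "\<forall>j\<in>insert n0 S. \<exists>x\<in>X. f j x \<noteq> 0")
    case False
    then obtain j where j: "j \<in> insert n0 S" "\<And>x. x \<in> X \<Longrightarrow> f j x = 0" by blast
    then have "crit X S K = {}" by (auto simp: crit_def)
    moreover have c0: "chi X (insert n0 S) ?s ?t = 0" by (rule chi_loop[OF j(1)]) (rule j(2))
    ultimately show ?thesis unfolding c0 by (simp add: hk_cycle_def)
  next
    case True
    then obtain x0 where x0: "x0 \<in> X" "\<And>j. j \<in> insert n0 S \<Longrightarrow> f j x0 \<noteq> 0"
      using ex_generic_point[OF X, of "insert n0 S"] by blast
    obtain i where i: "i \<in> S" using Suc(2) by fastforce
    define S' where "S' = S - {i}"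
    define T where "T = insert n0 S'"
    have S: "S = insert i S'" "i \<notin> S'" "insert n0 S = insert i T" "i \<notin> T" "n0 \<notin> S'"
      using i n0 by (auto simp: S'_def T_def)
    have m: "m = card S'" using Suc(2) i by (simp add: S'_def)
    have iK: "i \<notin> K" using i SK by blast
    let ?Xi = "X \<inter> {x. f i x = 0}"
    have Xi: "V.subspace ?Xi" using X by (auto simp: V.subspace_def)
    have fi: "f i x0 \<noteq> 0" using x0 i by blast
    have sum_i: "(\<Sum>j\<in>S. h j) = h i + (\<Sum>j\<in>S'. h j)" for h :: "'n \<Rightarrow> complex"
      unfolding S'_def by (rule sum.remove) (use i in auto)
    show ?thesis
    proof (cases "\<exists>u\<in>X. f n0 u = 0 \<and> f i u \<noteq> 0")
      case False
      text \<open>On \<open>X\<close> the forms \<open>f i\<close> and \<open>f n0\<close> are proportional, so the coordinate \<open>i\<close> is free.\<close>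
      have par: "f i x = f n0 x / f n0 x0 * f i x0" if x: "x \<in> X" for x
      proof -
        have "x - scaleV (f n0 x / f n0 x0) x0 \<in> X"
          using x x0 X by (intro V.subspace_diff V.subspace_scale)
        moreover have "f n0 (x - scaleV (f n0 x / f n0 x0) x0) = 0" using x0(2)[of n0] by simp
        ultimately have "f i (x - scaleV (f n0 x / f n0 x0) x0) = 0" using False by blast
        then show ?thesis by simp
      qed
      have "crit X S K = crit X S' (insert i K)"
      proof -
        have "f i x \<noteq> 0" if "x \<in> X" "f n0 x \<noteq> 0" for x using par[OF that(1)] that fi x0(2)[of n0] by auto
        moreover have "f i u = 0" if "u \<in> X" "f n0 u = 0" for u using False that by blast
        ultimately show ?thesis unfolding crit_def S'_def[symmetric] sum_i using S(1) by auto
      qed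
      moreover have "S' \<union> insert i K = S \<union> K" using S by auto
      moreover have "chi X (insert n0 S) ?s ?t = chi X T ?s ?t"
      proof -
        have c0: "chi ?Xi T ?s ?t = 0"
          by (rule chi_loop[of n0]) (use par fi x0(2)[of n0] in \<open>auto simp: T_def\<close>)
        have dep: "f i x = 0" if "x \<in> X" "\<And>j. j \<in> T \<Longrightarrow> f j x = 0" for x
          using par[OF that(1)] that(2)[of n0] by (simp add: T_def)
        have "chi X (insert i T) ?s ?t = chi X T ?s ?t - ?s * chi ?Xi T ?s ?t"
          by (rule chi_not_coloop[OF X x0(1) fi S(4)]) (rule dep)
        then show ?thesis unfolding S(3) c0 by (simp only: mult_zero_right diff_zero)
      qed
      ultimately show ?thesis
        using Suc(1)[OF m X S(5), of "insert i K"] SK S iK Z by (auto simp: T_def)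
    next
      case True
      then obtain u where u: "u \<in> X" "f n0 u = 0" "f i u \<noteq> 0" by blast
      define U where "U = X \<inter> {u. f n0 u = 0}"
      have U: "V.subspace U" using X by (auto simp: U_def V.subspace_def)
      show ?thesis
      proof (cases "\<exists>w\<in>U. f i w \<noteq> 0 \<and> (\<forall>j\<in>S'. f j w = 0)")
        case True
        text \<open>Here every relation has \<open>i\<close>-th coefficient \<open>0\<close>.\<close>
        then obtain w where w: "w \<in> X" "f n0 w = 0" "f i w \<noteq> 0" "\<And>j. j \<in> S' \<Longrightarrow> f j w = 0"
          unfolding U_def by blast
        have e: "crit X S K = {z \<in> crit X S' K. f i (fst z) \<noteq> 0}"
        proof -
          have "(x, l) \<in> crit X S K \<longleftrightarrow> (x, l) \<in> crit X S' K \<and> f i x \<noteq> 0" for x and l :: "complex ^ 'n"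
          proof (cases "l $ i = 0")
            case True
            have "(\<forall>j\<in>S. P j) \<longleftrightarrow> P i \<and> (\<forall>j\<in>S'. P j)" "j \<in> S \<longleftrightarrow> j = i \<or> j \<in> S'" for P j
              using S(1) by auto
            then show ?thesis using True by (auto simp: crit_def sum_i) metis
          next
            case False
            have "(x, l) \<notin> crit X S' K" using False S(2) iK by (auto simp: crit_def)
            moreover have "(x, l) \<notin> crit X S K"
            proof
              assume "(x, l) \<in> crit X S K"
              then have "(\<Sum>j\<in>S. l $ j * (f j w / f j x)) = 0" "f i x \<noteq> 0"
                using w(1,2) i by (auto simp: crit_def)
              then show False using w(3,4) False by (simp add: sum_i)
            qed
            ultimately show ?thesis by blast
          qed
          then show ?thesis by auto
        qed
        have z0: "(x0, 0) \<in> crit X S' K" using x0 S(1) by (auto simp: crit_def)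
        then have "integral_set (crit X S' K)" using crit_integral[OF X] by blast
        moreover have "\<not> vanish (\<lambda>z. f i (fst z)) (crit X S' K)"
          using z0 fi by (force simp: vanish_def)
        ultimately have "crit X S' K \<subseteq> zariski_closure (crit X S K)"
          unfolding e by (intro closure_open_subset pf_f)
        moreover have "crit X S K \<subseteq> zariski_closure (crit X S' K)"
          using closure_subset[of "crit X S' K"] unfolding e by blast
        ultimately have p: "proj (crit X S K) = proj (crit X S' K)" by (intro proj_eqI)
        \<comment> \<open>The coloop factor \<open>t - s = k\<close> matches the additional
          vanishing coordinate \<open>i\<close>.\<close>
        have c: "chi X (insert n0 S) ?s ?t = k_var * chi X T ?s ?t"
        proof -
          have ts: "?t - ?s = k_var" by simp
          have wT: "f j w = 0" if "j \<in> T" for j using that w by (auto simp: T_def)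
          have "chi X (insert i T) ?s ?t = (?t - ?s) * chi X T ?s ?t"
            by (rule chi_coloop[OF X w(1,3) _ S(4)]) (rule wT)
          then show ?thesis unfolding S(3) ts .
        qed
        have "- (S' \<union> K) = insert i (- (S \<union> K))" using S iK by auto
        then have card: "card (- (S' \<union> K)) = Suc (card (- (S \<union> K)))" using i by simp
        have pos: "card (- (S \<union> K)) > 0" using Z by (simp add: card_gt_0_iff)
        have IH: "rat_eq (fundamental_cycle (proj (crit X S' K)))
            (hk_cycle (k_var ^ (card (- (S' \<union> K)) - 1) * h_var ^ (V.dim UNIV - V.dim X) * chi X T ?s ?t))"
          unfolding T_def by (rule Suc(1)[OF m X S(5)]) (use SK S Z in auto)
        have "k_var ^ (card (- (S' \<union> K)) - 1) = k_var ^ (card (- (S \<union> K)) - 1) * (k_var :: int poly poly)"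
          unfolding card using pos by (simp only: diff_Suc_1 power_minus_mult)
        then have e: "k_var ^ (card (- (S' \<union> K)) - 1) * h_var ^ (V.dim UNIV - V.dim X) * chi X T ?s ?t =
          k_var ^ (card (- (S \<union> K)) - 1) * h_var ^ (V.dim UNIV - V.dim X) * chi X (insert n0 S) ?s ?t"
          unfolding c by (simp only: ac_simps)
        show ?thesis using IH unfolding p e .
      next
        case False
        then have dep: "f i w = 0" if "w \<in> X" "f n0 w = 0" "\<And>j. j \<in> S' \<Longrightarrow> f j w = 0" for w
          using that unfolding U_def by blast
        \<comment> \<open>Parallel to infinity \<open>f i\<close> is nonzero but dependent on the
          other forms: exactly the relation \<rho> and the transversal direction \<open>u0\<close>
          that the divisor of coordinate \<open>i\<close> requires.\<close>
        have "\<exists>c. \<forall>u\<in>U. f i u = (\<Sum>j\<in>S'. c j * f j u)"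
          by (rule linear_combination_of_functionals[OF V.vector_space_axioms _ U f_linear f_linear])
            (use dep in \<open>auto simp: U_def\<close>)
        then obtain c where c: "\<And>u. u \<in> X \<Longrightarrow> f n0 u = 0 \<Longrightarrow> f i u = (\<Sum>j\<in>S'. c j * f j u)"
          unfolding U_def by blast
        define \<rho> :: "complex ^ 'n" where "\<rho> = (\<chi> j. if j = i then 1 else if j \<in> S' then - c j else 0)"
        have \<rho>: "(\<Sum>j\<in>S. \<rho> $ j * f j u) = 0" if "u \<in> X" "f n0 u = 0" for u
        proof -
          have "(\<Sum>j\<in>S'. \<rho> $ j * f j u) = (\<Sum>j\<in>S'. - (c j * f j u))"
            by (intro sum.cong) (use S in \<open>auto simp: \<rho>_def\<close>)
          then show ?thesis using c[OF that] by (simp add: sum_i \<rho>_def sum_negf)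
        qed
        have \<rho>': "\<rho> $ j = 0" if "j \<notin> S" for j using that S by (auto simp: \<rho>_def)
        have \<rho>i: "\<rho> $ i = 1" by (simp add: \<rho>_def)
        define u0 where "u0 = scaleV (1 / f i u) u"
        have u0: "u0 \<in> X" "f n0 u0 = 0" "f i u0 = 1"
          using u X by (auto simp: u0_def V.subspace_scale)
        \<comment> \<open>Freeing one vanishing coordinate gives a variety on which the coordinates
          \<open>k\<close> and \<open>i\<close> are sections of the same bundle; the zero locus of
          coordinate \<open>k\<close> is the original set.\<close>
        obtain k where k: "k \<notin> S" "k \<notin> K" using Z by blast
        define K' where "K' = insert k K"
        have K': "i \<notin> K'" "k \<in> K'" "S' \<inter> K' = {}" using k iK i SK S by (auto simp: K'_def)
        note sec = free_coordinate_section[OF X x0 linear_coordinate[of k] axis_nth k(1) K'(2)]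
        have "{z \<in> crit X S K'. snd z $ k = 0} = crit X S K"
          using k by (auto simp: crit_def K'_def)
        then have d1: "div_form (proj (crit X S K')) (\<lambda>z. snd z $ k) = fundamental_cycle (proj (crit X S K))"
          using sec(2) by simp
        note dc = div_coordinate[OF X x0 i K'(1) n0 u0 \<rho> \<rho>' \<rho>i]
        have d2: "div_form (proj (crit X S K')) (\<lambda>z. snd z $ i) =
            fundamental_cycle (proj (crit X S' K')) + fundamental_cycle (proj (crit ?Xi S' K'))"
          unfolding S'_def by (rule dc(3))
        have "rat_eq (fundamental_cycle (proj (crit X S K)))
            (fundamental_cycle (proj (crit X S' K')) + fundamental_cycle (proj (crit ?Xi S' K')))"
          unfolding d1[symmetric] d2[symmetric]
        proof (rule rat_eq_div_form[OF _ bihom_coordinate bihom_coordinate])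
          show "subvariety (proj (crit X S K'))" by (rule dc(2))
          show "\<not> vanishes_on (\<lambda>z. snd z $ k) (proj (crit X S K'))" by (rule sec(1))
          show "\<not> vanishes_on (\<lambda>z. snd z $ i) (proj (crit X S K'))" by (rule dc(1))
        qed
        also have "rat_eq \<dots>
            (hk_cycle (k_var ^ (card (- (S' \<union> K')) - 1) * h_var ^ (V.dim UNIV - V.dim X) * chi X T ?s ?t) +
             hk_cycle (k_var ^ (card (- (S' \<union> K')) - 1) * h_var ^ (V.dim UNIV - V.dim ?Xi) * chi ?Xi T ?s ?t))"
          unfolding T_def
        proof (rule rat_eq_add)
          have ne: "- (S' \<union> K') \<noteq> {}" using S(2) K'(1) by blast
          show "rat_eq (fundamental_cycle (proj (crit X S' K')))
            (hk_cycle (k_var ^ (card (- (S' \<union> K')) - 1) * h_var ^ (V.dim UNIV - V.dim X) *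
              chi X (insert n0 S') ?s ?t))"
            by (rule Suc(1)[OF m X S(5) K'(3) ne])
          show "rat_eq (fundamental_cycle (proj (crit ?Xi S' K')))
            (hk_cycle (k_var ^ (card (- (S' \<union> K')) - 1) * h_var ^ (V.dim UNIV - V.dim ?Xi) *
              chi ?Xi (insert n0 S') ?s ?t))"
            by (rule Suc(1)[OF m Xi S(5) K'(3) ne])
        qed
        also have "hk_cycle (k_var ^ (card (- (S' \<union> K')) - 1) * h_var ^ (V.dim UNIV - V.dim X) * chi X T ?s ?t) +
             hk_cycle (k_var ^ (card (- (S' \<union> K')) - 1) * h_var ^ (V.dim UNIV - V.dim ?Xi) * chi ?Xi T ?s ?t) =
           hk_cycle (k_var ^ (card (- (S \<union> K)) - 1) * h_var ^ (V.dim UNIV - V.dim X) * chi X (insert n0 S) ?s ?t)"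
        proof -
          have depT: "f i x = 0" if "x \<in> X" "\<And>j. j \<in> T \<Longrightarrow> f j x = 0" for x
            by (rule dep) (use that in \<open>auto simp: T_def\<close>)
          have "chi X (insert i T) ?s ?t = chi X T ?s ?t - ?s * chi ?Xi T ?s ?t"
            by (rule chi_not_coloop[OF X u(1,3) S(4)]) (rule depT)
          then have c: "chi X (insert n0 S) ?s ?t = chi X T ?s ?t + h_var * chi ?Xi T ?s ?t"
            unfolding S(3) by (simp only: mult_minus_left diff_minus_eq_add)
          \<comment> \<open>Restriction costs one dimension of \<open>X\<close>, that is one more
            factor \<open>h\<close>, which is the coefficient \<open>-s\<close> of the restriction
            term.\<close>
          have "Suc (V.dim ?Xi) = V.dim X" by (rule dim_hyperplane_section[OF X u(1,3)])
          moreover have "V.dim X \<le> V.dim UNIV" by (rule V.dim_subset) simp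
          ultimately have d: "V.dim UNIV - V.dim ?Xi = Suc (V.dim UNIV - V.dim X)" by linarith
          \<comment> \<open>Coordinate \<open>i\<close> joins the vanishing coordinates and
            \<open>k\<close> leaves them, so the power of \<open>k\<close> is unchanged.\<close>
          have "- (S' \<union> K') = insert i (- (S \<union> K) - {k})" using k iK S by (auto simp: K'_def)
          then have "card (- (S' \<union> K')) = Suc (card (- (S \<union> K) - {k}))" using i by simp
          also have "\<dots> = card (- (S \<union> K))" using k by (intro card_Suc_Diff1) auto
          finally have e: "card (- (S' \<union> K')) = card (- (S \<union> K))" .
          show ?thesis
            unfolding hk_cycle_add[symmetric] c d e power_Suc
            by (rule arg_cong[of _ _ hk_cycle]) (simp only: distrib_left ac_simps)
        qed
        finally show ?thesis .
      qed
    qed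
  qed
qed

lemma sum_coordinates_linear: "Vector_Spaces.linear (*s) (*) (\<lambda>l :: complex ^ 'n. \<Sum>j\<in>UNIV. l $ j)"
  by (rule linear_functionalI[OF vec.vector_space_axioms]) (simp_all add: sum.distrib sum_distrib_left)

text \<open>Contracting with the Euler field gives \<open>\<Sum>j. l $ j\<close>.\<close>

lemma critical_set_eq:
  "critical_set f = {z \<in> crit UNIV (- {n0}) {n0}. (\<Sum>j\<in>UNIV. snd z $ j) = 0}"
proof -
  have un: "insert n0 (- {n0}) = UNIV" by blast
  have sum_n0: "(\<Sum>j\<in>UNIV. h j) = h n0 + (\<Sum>j\<in>- {n0}. h j)" for h :: "'n \<Rightarrow> complex"
    using sum.remove[of UNIV n0 h] by (simp add: Compl_eq_Diff_UNIV)
  have eq: "(\<forall>v. log_form f l x v = 0) \<longleftrightarrow>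
      (\<forall>u. f n0 u = 0 \<longrightarrow> (\<Sum>j\<in>- {n0}. l $ j * (f j u / f j x)) = 0) \<and> (\<Sum>j\<in>UNIV. l $ j) = 0"
    if x: "\<And>j. f j x \<noteq> 0" for x and l :: "complex ^ 'n"
  proof
    assume L: "\<forall>v. log_form f l x v = 0"
    have "(\<Sum>j\<in>UNIV. l $ j) = log_form f l x x" using x by (simp add: log_form_def)
    moreover have "(\<Sum>j\<in>- {n0}. l $ j * (f j u / f j x)) = log_form f l x u" if "f n0 u = 0" for u
      using that by (simp add: log_form_def sum_n0)
    ultimately show "(\<forall>u. f n0 u = 0 \<longrightarrow> (\<Sum>j\<in>- {n0}. l $ j * (f j u / f j x)) = 0) \<and> (\<Sum>j\<in>UNIV. l $ j) = 0"
      using L by simp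
  next
    assume R: "(\<forall>u. f n0 u = 0 \<longrightarrow> (\<Sum>j\<in>- {n0}. l $ j * (f j u / f j x)) = 0) \<and> (\<Sum>j\<in>UNIV. l $ j) = 0"
    show "\<forall>v. log_form f l x v = 0"
    proof
      fix v
      \<comment> \<open>Subtracting a multiple of the Euler direction \<open>x\<close> makes
        \<open>v\<close> parallel to infinity; along \<open>x\<close> the logarithmic form has the
        value \<open>\<Sum>j. l $ j\<close>.\<close>
      define c where "c = f n0 v / f n0 x"
      let ?u = "v - scaleV c x"
      have u: "f n0 ?u = 0" using x by (simp add: c_def)
      have "log_form f l x v = (\<Sum>j\<in>UNIV. l $ j * (f j ?u / f j x) + c * l $ j)"
        unfolding log_form_def by (intro sum.cong refl) (use x in \<open>simp add: field_simps\<close>)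
      also have "\<dots> = (\<Sum>j\<in>UNIV. l $ j * (f j ?u / f j x)) + c * (\<Sum>j\<in>UNIV. l $ j)"
        by (simp only: sum.distrib sum_distrib_left)
      also have "(\<Sum>j\<in>UNIV. l $ j * (f j ?u / f j x)) = 0"
      proof -
        have "(\<Sum>j\<in>- {n0}. l $ j * (f j ?u / f j x)) = 0" using R u by blast
        then show ?thesis unfolding sum_n0 u by simp
      qed
      finally show "log_form f l x v = 0" using R by simp
    qed
  qed
  have "(x, l) \<in> critical_set f \<longleftrightarrow>
      (x, l) \<in> {z \<in> crit UNIV (- {n0}) {n0}. (\<Sum>j\<in>UNIV. snd z $ j) = 0}" for x and l :: "complex ^ 'n"
  proof -
    have "(x, l) \<in> critical_set f \<longleftrightarrow> (\<forall>j. f j x \<noteq> 0) \<and> (\<forall>v. log_form f l x v = 0)"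
      by (auto simp: critical_set_def arr_complement_def hyperplane_def)
    also have "\<dots> \<longleftrightarrow> (\<forall>j. f j x \<noteq> 0) \<and>
        (\<forall>u. f n0 u = 0 \<longrightarrow> (\<Sum>j\<in>- {n0}. l $ j * (f j u / f j x)) = 0) \<and> (\<Sum>j\<in>UNIV. l $ j) = 0"
      by (rule conj_cong[OF refl]) (rule eq, blast)
    also have "\<dots> \<longleftrightarrow> (x, l) \<in> {z \<in> crit UNIV (- {n0}) {n0}. (\<Sum>j\<in>UNIV. snd z $ j) = 0}"
      unfolding crit_def un by auto
    finally show ?thesis .
  qed
  then show ?thesis by auto
qed

lemma critical_variety_eq: "critical_variety scaleV f = proj (critical_set f)"
  by (simp add: critical_variety_def proj_def)

theorem class_critical_variety:
  assumes nz: "\<And>j. f j \<noteq> (\<lambda>_. 0)"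
  shows "chow_class (fundamental_cycle (critical_variety scaleV f)) =
    hk_class (char_poly_hom scaleV f (- h_var) (k_var - h_var))"
proof -
  have "\<exists>x\<in>UNIV. f j x \<noteq> 0" for j using nz[of j] by (auto simp: fun_eq_iff)
  then obtain x0 where x0: "\<And>j. f j x0 \<noteq> 0" using ex_generic_point[OF V.subspace_UNIV, of UNIV] by auto
  let ?S = "- {n0}"
  have sum_axis: "(\<Sum>j\<in>UNIV. axis n0 1 $ j) = (1 :: complex)" by (simp add: axis_def)
  have mem: "n0 \<notin> ?S" "n0 \<in> {n0}" by simp_all
  \<comment> \<open>The sum of all coordinates and the coordinate at infinity both have value
    \<open>1\<close> on the axis of \<open>n0\<close>, so the same cone is cut by two sections of
    bidegree \<open>(0, 1)\<close>.\<close>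
  note sec = free_coordinate_section[OF V.subspace_UNIV UNIV_I x0 sum_coordinates_linear sum_axis mem,
      folded critical_set_eq]
  note sec' = free_coordinate_section[OF V.subspace_UNIV UNIV_I x0 linear_coordinate[of n0] axis_nth mem]
  have "{z \<in> crit UNIV ?S {n0}. snd z $ n0 = 0} = crit UNIV ?S {}"
    by (auto simp: crit_def)
  then have d: "div_form (proj (crit UNIV ?S {n0})) (\<lambda>z. snd z $ n0) = fundamental_cycle (proj (crit UNIV ?S {}))"
    using sec'(2) by simp
  have "rat_eq (fundamental_cycle (proj (critical_set f))) (fundamental_cycle (proj (crit UNIV ?S {})))"
    unfolding d[symmetric] sec(2)[symmetric]
    by (rule rat_eq_div_form[OF sec(3) bihom_snd[OF sum_coordinates_linear] bihom_coordinate[of n0]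
          sec(1) sec'(1)])
  also have "rat_eq \<dots> (hk_cycle (k_var ^ (card (- (?S \<union> {})) - 1) * h_var ^ (V.dim UNIV - V.dim UNIV) *
      chi UNIV (insert n0 ?S) (- h_var) (k_var - h_var)))"
    by (rule class_crit) auto
  also have "k_var ^ (card (- (?S \<union> {})) - 1) * h_var ^ (V.dim UNIV - V.dim UNIV) *
      chi UNIV (insert n0 ?S) (- h_var) (k_var - h_var) = chi UNIV UNIV (- h_var) (k_var - h_var)"
  proof -
    \<comment> \<open>Only coordinate \<open>n0\<close> vanishes and \<open>X\<close> is the whole
      space, so both monomial factors are \<open>1\<close>.\<close>
    have "insert n0 ?S = UNIV" "- (?S \<union> {}) = {n0}" by auto
    then show ?thesis by simp
  qed
  finally have r: "rat_eq (fundamental_cycle (proj (critical_set f)))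
    (hk_cycle (char_poly_hom scaleV f (- h_var) (k_var - h_var)))"
    unfolding char_poly_hom_eq_chi[OF nz] .
  show ?thesis
    unfolding critical_variety_eq hk_class_eq
    by (rule chow_class_eqI[OF fundamental_cycle_carrier[OF sec(4,5)] r])
qed

end

theorem theorem1p1:
  fixes scaleV :: "complex \<Rightarrow> 'v::ab_group_add \<Rightarrow> 'v"
    and Basis :: "'v set"
    and f :: "'n::finite \<Rightarrow> 'v \<Rightarrow> complex"
  assumes "finite_dimensional_vector_space scaleV Basis"
    and "\<And>i. Vector_Spaces.linear scaleV (*) (f i)"
    and "\<And>i. f i \<noteq> (\<lambda>_. 0)"
    and "inj (\<lambda>i. hyperplane (f i))"
  shows "biprojective.chow_class scaleV (*s)
           (fundamental_cycle (critical_variety scaleV f)) =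
         biprojective.hk_class scaleV (*s)
           (char_poly_hom scaleV f (- h_var) (k_var - h_var))"
proof -
  interpret V: finite_dimensional_vector_space scaleV Basis by (rule assms(1))
  \<comment> \<open>Any index can serve as the hyperplane at infinity; \<open>undefined\<close>
    names some element of the index type.\<close>
  interpret arrangement scaleV Basis f undefined
    by unfold_locales (simp_all add: linear_functional_simps[OF assms(2)])
  show ?thesis by (rule class_critical_variety[OF assms(3)])
qed

end
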